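(* Let $(X,0)$ be a germ of a closed semialgebraic set of dimension $k$. If $n\ge 2k+1$, then $(X,0)$ has a unique semialgebraic and bi-Lipschitz embedding into $(\mathbb{R}^n,0)$, up to a germ of a semialgebraic and bi-Lipschitz tame homeomorphism of $(\mathbb{R}^n,0)$. That is, there exists a semialgebraic and bi-Lipschitz embedding $(X,0)\to(\mathbb{R}^n,0)$, and for any two such embeddings $f,g:(X,0)\to(\mathbb{R}^n,0)$ there is a germ of a semialgebraic and bi-Lipschitz tame homeomorphism $\Phi$ of $(\mathbb{R}^n,0)$ such that $g=\Phi\circ f$.
   Context: Here $(X,0)\subset(\mathbb{R}^m,0)$ for some $m$, and sets carry the outer metric, i.e. the restriction of the Euclidean distance. A semialgebraic and bi-Lipschitz embedding $f:(X,0)\to(\mathbb{R}^n,0)$ is a germ at $0$ of a semialgebraic map such that $f((X,0))=(Y,0)$ is a germ of a closed semialgebraic subset of $\mathbb{R}^n$ and $f:(X,0)\to(Y,0)$ is a germ of a bijection with $f$ and $f^{-1}$ Lipschitz and semialgebraic. A germ of a bi-Lipschitz homeomorphism of $(\mathbb{R}^n,0)$ is called tame if it is a composition of germs of bi-Lipschitz homeomorphisms of the form $(x_1,\dots,x_n)\mapsto(x_1,\dots,x_{n-1},x_n+p(x_1,\dots,x_{n-1}))$ (fixing $0$) and linear mappings of $\mathbb{R}^n$ with determinant one. *)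

theory Defs
  imports "HOL-Analysis.Analysis"
begin

inductive semialgebraic :: "'a::euclidean_space set \<Rightarrow> bool" where
  pos: "real_polynomial_function p \<Longrightarrow> semialgebraic {x. p x > 0}"
| compl: "semialgebraic S \<Longrightarrow> semialgebraic (- S)"
| union: "semialgebraic S \<Longrightarrow> semialgebraic T \<Longrightarrow> semialgebraic (S \<union> T)"

(* Since projections of semialgebraic sets are semialgebraic, this forces A to be semialgebraic. *)
definition semialgebraic_map_on ::
  "'a::euclidean_space set \<Rightarrow> ('a \<Rightarrow> 'b::euclidean_space) \<Rightarrow> bool" where
  "semialgebraic_map_on A f \<longleftrightarrow> semialgebraic ((\<lambda>x. (x, f x)) ` A)"

(* A d-dimensional linear subspace V plays the role of the open cube (0,1)^d, to which
   it is semialgebraically homeomorphic; this avoids a type of dimension d. *)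
definition contains_cell :: "nat \<Rightarrow> 'a::euclidean_space set \<Rightarrow> bool" where
  "contains_cell d A \<longleftrightarrow>
     (\<exists>(V :: 'a set) C h h'. subspace V \<and> dim V = d \<and> C \<subseteq> A \<and>
        homeomorphism V C h h' \<and> semialgebraic_map_on V h)"

(* Only meaningful for nonempty semialgebraic sets. The set of such d is bounded by DIM('a). *)
definition semialgebraic_dim :: "'a::euclidean_space set \<Rightarrow> nat" where
  "semialgebraic_dim A = Max {d. contains_cell d A}"

(* Germs at 0 are given by representatives. The dimension of the germ (X,0) is that of
   every sufficiently small representative, not that of X as a whole. *)
definition germ_dim :: "'a::euclidean_space set \<Rightarrow> nat \<Rightarrow> bool" where
  "germ_dim X k \<longleftrightarrow> (\<forall>\<^sub>F r in at_right 0. semialgebraic_dim (X \<inter> ball 0 r) = k)"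

definition bilipschitz_bij ::
  "'a::euclidean_space set \<Rightarrow> 'b::euclidean_space set \<Rightarrow> ('a \<Rightarrow> 'b) \<Rightarrow> bool" where
  "bilipschitz_bij A B f \<longleftrightarrow> bij_betw f A B \<and>
     (\<exists>L. L-lipschitz_on A f) \<and> (\<exists>L. L-lipschitz_on B (inv_into A f))"

definition semialgebraic_bij ::
  "'a::euclidean_space set \<Rightarrow> 'b::euclidean_space set \<Rightarrow> ('a \<Rightarrow> 'b) \<Rightarrow> bool" where
  "semialgebraic_bij A B f \<longleftrightarrow> bij_betw f A B \<and>
     semialgebraic_map_on A f \<and> semialgebraic_map_on B (inv_into A f)"

(* f represents a germ (X,0) \<rightarrow> (Y,0); its values off X are irrelevant. *)
definition bilipschitz_germ ::
  "'a::euclidean_space set \<Rightarrow> 'b::euclidean_space set \<Rightarrow> ('a \<Rightarrow> 'b) \<Rightarrow> bool" where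
  "bilipschitz_germ X Y f \<longleftrightarrow> f 0 = 0 \<and>
     (\<exists>U V. open U \<and> 0 \<in> U \<and> open V \<and> 0 \<in> V \<and> bilipschitz_bij (X \<inter> U) (Y \<inter> V) f)"

definition semialgebraic_bilipschitz_germ ::
  "'a::euclidean_space set \<Rightarrow> 'b::euclidean_space set \<Rightarrow> ('a \<Rightarrow> 'b) \<Rightarrow> bool" where
  "semialgebraic_bilipschitz_germ X Y f \<longleftrightarrow> f 0 = 0 \<and>
     (\<exists>U V. open U \<and> 0 \<in> U \<and> open V \<and> 0 \<in> V \<and>
        bilipschitz_bij (X \<inter> U) (Y \<inter> V) f \<and> semialgebraic_bij (X \<inter> U) (Y \<inter> V) f)"

definition semialgebraic_bilipschitz_embedding ::
  "'a::euclidean_space set \<Rightarrow> ('a \<Rightarrow> 'b::euclidean_space) \<Rightarrow> bool" where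
  "semialgebraic_bilipschitz_embedding X f \<longleftrightarrow>
     (\<exists>Y. closed Y \<and> semialgebraic Y \<and> 0 \<in> Y \<and> semialgebraic_bilipschitz_germ X Y f)"

(* The linear order on the index type only serves to single out the last coordinate. *)
definition last_index :: "'n::{finite,linorder}" where
  "last_index = Max UNIV"

(* (x_1,...,x_n) \<mapsto> (x_1,...,x_{n-1}, x_n + p(x_1,...,x_{n-1})), where R^{n-1} is identified
   with the hyperplane x_n = 0. *)
definition shear :: "(real^('n::{finite,linorder}) \<Rightarrow> real) \<Rightarrow>
  real^('n::{finite,linorder}) \<Rightarrow> real^('n::{finite,linorder})" where
  "shear p x = (\<chi> i. if i = last_index
     then x $ i + p (\<chi> j. if j = last_index then 0 else x $ j) else x $ i)"

(* The rule "germ" makes tameness depend only on the germ at 0. *)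
inductive tame_germ :: "(real^('n::{finite,linorder}) \<Rightarrow> real^('n::{finite,linorder})) \<Rightarrow> bool" where
  shear: "bilipschitz_germ UNIV UNIV (shear p) \<Longrightarrow> tame_germ (shear p)"
| linear: "linear A \<Longrightarrow> det (matrix A) = 1 \<Longrightarrow> tame_germ A"
| comp: "tame_germ \<Phi> \<Longrightarrow> tame_germ \<Psi> \<Longrightarrow> tame_germ (\<Phi> \<circ> \<Psi>)"
| germ: "tame_germ \<Phi> \<Longrightarrow> (\<forall>\<^sub>F x in nhds 0. \<Psi> x = \<Phi> x) \<Longrightarrow> tame_germ \<Psi>"

end

theory Submission
  imports Defs "HOL-Computational_Algebra.Polynomial"
begin

text \<open>Both parts rest on one genericity statement about the limits \<open>u\<close> of secant directions at \<open>0\<close> of a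
  semialgebraic germ \<open>\<Gamma>\<close> of dimension \<open>k\<close>: if at least \<open>2 k\<close> linear forms, each with free coefficients on a
  block of coordinates, are chosen generically, then no \<open>u\<close> with nonzero components in these blocks is
  annihilated by all of them. The matrices annihilating an honest secant of \<open>\<Gamma>\<close>, together with
  \<open>t = \<bar>z\<bar>\<^sup>2 + \<bar>z'\<bar>\<^sup>2\<close>, satisfy a nontrivial polynomial relation, because the Hilbert function of \<open>\<Gamma>\<close> grows like
  \<open>d\<^sup>k\<close>; dividing the relation by a power of \<open>t\<close> and letting \<open>t \<rightarrow> 0\<close> gives a hypersurface containing the bad
  matrices. It is this limit that gains one dimension over the global theorem. The growth bound in turn holds
  because a coordinate projection of \<open>\<Gamma>\<close> to \<open>k + 1\<close> coordinates that lies in no hypersurface would yield a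
  \<open>(k + 1)\<close>-dimensional cell; this uses a version of the Cohen-Hoermander elimination procedure that keeps
  track of the continuity of the roots.

  Existence: a generic linear map is an embedding. Uniqueness: after replacing \<open>f\<close> and \<open>g\<close> by \<open>A f\<close> and \<open>B g\<close>
  for generic \<open>A\<close>, \<open>B\<close> of determinant one, the coordinates of \<open>A f\<close> are exchanged one by one for those of \<open>B g\<close>.
  The \<open>n - 1 \<ge> 2 k\<close> coordinates not involved in an exchange are already bi-Lipschitz, so that each exchange is
  a shear by a semialgebraic Lipschitz function of the other coordinates, extended by infimal convolution.\<close>

text \<open>Why \<open>2 k\<close> rows suffice: let \<open>q\<close> be the number of all
  coefficients and \<open>R\<close> the number of rows. Two points of \<Gamma> and the coefficients
  other than one pivot per row form a set of algebraic dimension at most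
  \<open>2 k + (q - R)\<close>. They determine a matrix together with \<open>t\<close>, a point of a
  space of dimension \<open>q + 1\<close>, so \<open>R = 2 k\<close> already forces a relation;
  without \<open>t\<close> the count would ask for one more row. Solving for the pivots is
  homogeneous of degree 0 in the secant and so survives the passage to a limit direction.

  The obstacle is that \<open>germ_dim\<close> speaks of cells and the count of polynomials. A
  compact semialgebraic set has a semialgebraic section over its projection, continuous on finitely
  many pieces. If the projection lies in no hypersurface, one piece contains a ball, and the section
  over it gives a cell.

  For uniqueness the genericity statement is applied to the set of pairs \<open>(f x, g x)\<close>,
  a homeomorphic copy of a compact piece of X. As \<open>f\<close> and \<open>g\<close> are
  bi-Lipschitz, both components of its limit secants are nonzero, so a row taken from either matrix
  has a pivot.\<close>

section \<open>Semialgebraic sets as finite unions of sign classes\<close>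

definition same_signs :: "('a \<Rightarrow> real) set \<Rightarrow> 'a \<Rightarrow> 'a \<Rightarrow> bool" where
  "same_signs Q x y \<longleftrightarrow> (\<forall>p\<in>Q. sgn (p x) = sgn (p y))"

lemma same_signs_refl [simp]: "same_signs Q x x"
  by (simp add: same_signs_def)

lemma same_signs_sym: "same_signs Q x y \<Longrightarrow> same_signs Q y x"
  by (simp add: same_signs_def)

lemma same_signs_subset: "same_signs Q x y \<Longrightarrow> P \<subseteq> Q \<Longrightarrow> same_signs P x y"
  by (auto simp: same_signs_def)

text \<open>The finite family stands for a quantifier-free formula. Complements keep the family
  because \<open>same_signs\<close> is symmetric, and unions join two families, so no normal form is
  required.\<close>

lemma semialgebraic_imp_sign_classes:
  "semialgebraic S \<Longrightarrow> \<exists>Q. finite Q \<and> (\<forall>p\<in>Q. real_polynomial_function p) \<and>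
     (\<forall>x y. same_signs Q x y \<longrightarrow> x \<in> S \<longrightarrow> y \<in> S)"
proof (induction rule: semialgebraic.induct)
  case (pos p)
  then show ?case
    by (intro exI[of _ "{p}"]) (auto simp: same_signs_def sgn_if split: if_splits)
next
  case (compl S)
  then show ?case by (metis ComplD ComplI same_signs_sym)
next
  case (union S T)
  then obtain Q R where "finite Q" "\<forall>p\<in>Q. real_polynomial_function p"
     "\<forall>x y. same_signs Q x y \<longrightarrow> x \<in> S \<longrightarrow> y \<in> S"
     "finite R" "\<forall>p\<in>R. real_polynomial_function p"
     "\<forall>x y. same_signs R x y \<longrightarrow> x \<in> T \<longrightarrow> y \<in> T" by blast
  then show ?case
    by (intro exI[of _ "Q \<union> R"]) (meson Un_iff finite_UnI same_signs_subset Un_upper1 Un_upper2)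
qed

lemma semialgebraic_UNIV [simp]: "semialgebraic UNIV"
  using semialgebraic.pos[of "\<lambda>_. 1"] by auto

lemma semialgebraic_empty [simp]: "semialgebraic {}"
  using semialgebraic.compl[OF semialgebraic_UNIV] by simp

lemma semialgebraic_Int: "semialgebraic S \<Longrightarrow> semialgebraic T \<Longrightarrow> semialgebraic (S \<inter> T)"
  using semialgebraic.compl[OF semialgebraic.union[OF semialgebraic.compl semialgebraic.compl]]
  by (metis Compl_Un double_complement)

lemma semialgebraic_Union:
  "finite \<C> \<Longrightarrow> (\<And>C. C \<in> \<C> \<Longrightarrow> semialgebraic C) \<Longrightarrow> semialgebraic (\<Union>\<C>)"
  by (induction rule: finite_induct) (auto intro: semialgebraic.union)

lemma semialgebraic_Inter:
  "finite \<C> \<Longrightarrow> (\<And>C. C \<in> \<C> \<Longrightarrow> semialgebraic C) \<Longrightarrow> semialgebraic (\<Inter>\<C>)"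
  by (induction rule: finite_induct) (auto intro: semialgebraic_Int)

lemma semialgebraic_neg:
  "real_polynomial_function p \<Longrightarrow> semialgebraic {x. p x < 0}"
  using semialgebraic.pos[OF real_polynomial_function_minus, of p] by simp

lemma semialgebraic_zero:
  assumes "real_polynomial_function p" shows "semialgebraic {x. p x = 0}"
proof -
  have "{x. p x = 0} = - ({x. p x > 0} \<union> {x. p x < 0})" by auto
  then show ?thesis
    by (metis assms semialgebraic.compl semialgebraic.union semialgebraic.pos semialgebraic_neg)
qed

lemma semialgebraic_sgn_eq:
  assumes "real_polynomial_function p" shows "semialgebraic {y. sgn (p x) = sgn (p y)}"
proof -
  consider "p x > 0" | "p x = 0" | "p x < 0" by linarith
  then show ?thesis
  proof cases
    case 1
    then have "{y. sgn (p x) = sgn (p y)} = {y. p y > 0}" by (auto simp: sgn_if split: if_splits)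
    then show ?thesis using assms semialgebraic.pos by metis
  next
    case 2
    then have "{y. sgn (p x) = sgn (p y)} = {y. p y = 0}" by (auto simp: sgn_if split: if_splits)
    then show ?thesis using assms semialgebraic_zero by metis
  next
    case 3
    then have "{y. sgn (p x) = sgn (p y)} = {y. p y < 0}" by (auto simp: sgn_if split: if_splits)
    then show ?thesis using assms semialgebraic_neg by metis
  qed
qed

definition sign_class :: "('a \<Rightarrow> real) set \<Rightarrow> 'a \<Rightarrow> 'a set" where
  "sign_class Q x = {y. same_signs Q x y}"

lemma sign_class_self [simp]: "x \<in> sign_class Q x"
  by (simp add: sign_class_def)

lemma semialgebraic_sign_class:
  assumes "finite Q" "\<forall>p\<in>Q. real_polynomial_function p"
  shows "semialgebraic (sign_class Q x)"
proof -
  have "sign_class Q x = \<Inter>((\<lambda>p. {y. sgn (p x) = sgn (p y)}) ` Q)"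
    by (auto simp: sign_class_def same_signs_def)
  then show ?thesis
    using assms by (auto intro!: semialgebraic_Inter semialgebraic_sgn_eq)
qed

lemma finite_sign_classes:
  assumes "finite Q" shows "finite (range (sign_class Q))"
proof -
  define v where "v = (\<lambda>x. restrict (\<lambda>p. sgn (p x)) Q)"
  have *: "sign_class Q x = {y. v x = v y}" for x
    by (auto simp: sign_class_def same_signs_def v_def restrict_def fun_eq_iff)
  have "v ` UNIV \<subseteq> Q \<rightarrow>\<^sub>E {-1, 0, 1}"
    by (auto simp: v_def sgn_if split: if_splits)
  moreover have "finite (Q \<rightarrow>\<^sub>E {-1::real, 0, 1})"
    by (intro finite_PiE assms) auto
  ultimately have "finite (range v)"
    by (rule finite_subset)
  moreover have "range (sign_class Q) = (\<lambda>u. {y. u = v y}) ` range v"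
    by (auto simp: * image_image)
  ultimately show ?thesis by simp
qed

text \<open>Converse of \<open>semialgebraic_imp_sign_classes\<close>: the set is the union of the
  sign classes of its points, and only finitely many classes exist. Together the two reduce
  preimages and projections to the choice of a finite family.\<close>

lemma semialgebraic_if_sign_classes:
  assumes "finite Q" "\<forall>p\<in>Q. real_polynomial_function p"
    "\<And>x y. same_signs Q x y \<Longrightarrow> x \<in> S \<Longrightarrow> y \<in> S"
  shows "semialgebraic S"
proof -
  have "S = \<Union>(sign_class Q ` S)"
    using assms(3) by (auto simp: sign_class_def)
  moreover have "finite (sign_class Q ` S)"
    using finite_sign_classes[OF assms(1)] by (rule rev_finite_subset) auto
  ultimately show ?thesis
    using semialgebraic_Union[of "sign_class Q ` S"] semialgebraic_sign_class[OF assms(1,2)] by auto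
qed

lemma semialgebraic_vimage_polynomial:
  fixes f :: "'a::euclidean_space \<Rightarrow> 'b::euclidean_space"
  assumes "polynomial_function f" "semialgebraic S"
  shows "semialgebraic (f -` S)"
proof -
  obtain Q where Q: "finite Q" "\<forall>p\<in>Q. real_polynomial_function p"
     "\<forall>x y. same_signs Q x y \<longrightarrow> x \<in> S \<longrightarrow> y \<in> S"
    using semialgebraic_imp_sign_classes[OF assms(2)] by blast
  show ?thesis
  proof (rule semialgebraic_if_sign_classes)
    show "finite ((\<lambda>p. p \<circ> f) ` Q)" using Q by simp
    show "\<forall>p\<in>(\<lambda>p. p \<circ> f) ` Q. real_polynomial_function p"
      using Q assms(1) by auto
    show "\<And>x y. same_signs ((\<lambda>p. p \<circ> f) ` Q) x y \<Longrightarrow> x \<in> f -` S \<Longrightarrow> y \<in> f -` S"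
      using Q(3) by (auto simp: same_signs_def)
  qed
qed

subsection \<open>Polynomials in one variable with polynomial coefficients\<close>

text \<open>The degree bound \<open>n\<close> is strict, so that \<open>n = 0\<close> forces the zero polynomial.\<close>

definition param_poly :: "nat \<Rightarrow> ('a::euclidean_space \<Rightarrow> real poly) \<Rightarrow> bool" where
  "param_poly n P \<longleftrightarrow> (\<forall>i. real_polynomial_function (\<lambda>x. coeff (P x) i)) \<and> (\<forall>x i. n \<le> i \<longrightarrow> coeff (P x) i = 0)"

lemma param_poly_mono: "param_poly n P \<Longrightarrow> n \<le> m \<Longrightarrow> param_poly m P"
  by (auto simp: param_poly_def)

lemma poly_param_sum:
  assumes "param_poly n P" shows "poly (P x) t = (\<Sum>i<n. coeff (P x) i * t ^ i)"
proof -
  have "poly (P x) t = (\<Sum>i\<le>degree (P x). coeff (P x) i * t ^ i)"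
    by (simp add: poly_altdef)
  also have "\<dots> = (\<Sum>i<max n (Suc (degree (P x))). coeff (P x) i * t ^ i)"
    by (rule sum.mono_neutral_left) (auto simp: coeff_eq_0)
  also have "\<dots> = (\<Sum>i<n. coeff (P x) i * t ^ i)"
    by (rule sum.mono_neutral_right) (use assms in \<open>auto simp: param_poly_def\<close>)
  finally show ?thesis .
qed

lemma continuous_real_polynomial_function:
  fixes p :: "'a::real_normed_vector \<Rightarrow> real"
  shows "real_polynomial_function p \<Longrightarrow> continuous_on A p"
  using continuous_on_polymonial_function real_polynomial_function_eq by blast

lemma continuous_on_param_poly:
  assumes "param_poly n P" shows "continuous_on A (\<lambda>x. poly (P x) t)"
  using assms unfolding poly_param_sum[OF assms]
  by (intro continuous_intros continuous_real_polynomial_function) (auto simp: param_poly_def)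

lemma param_poly_trunc:
  assumes "param_poly n P"
  shows "param_poly (n - 1) (\<lambda>x. P x - monom (coeff (P x) (n - 1)) (n - 1))"
proof (cases n)
  case (Suc k)
  have "real_polynomial_function (\<lambda>x. coeff (P x - monom (coeff (P x) (n - 1)) (n - 1)) i)" for i
    using assms by (cases "i = n - 1") (auto simp: param_poly_def)
  then show ?thesis using assms Suc by (auto simp: param_poly_def le_Suc_eq)
qed (use assms in \<open>auto simp: param_poly_def\<close>)

lemma param_poly_pderiv:
  assumes "param_poly n P" shows "param_poly (n - 1) (\<lambda>x. pderiv (P x))"
  using assms by (auto simp: param_poly_def coeff_pderiv)

text \<open>The multiplier is an even power in order not to affect signs.\<close>

definition pseudo_rem :: "nat \<Rightarrow> ('a \<Rightarrow> real poly) \<Rightarrow> ('a \<Rightarrow> real poly) \<Rightarrow> ('a \<Rightarrow> real poly) \<Rightarrow> bool" where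
  "pseudo_rem m P Q R \<longleftrightarrow> (\<exists>e. \<forall>x t. poly (Q x) t = 0 \<longrightarrow>
     coeff (Q x) (m - 1) ^ (2 * e) * poly (P x) t = poly (R x) t)"

text \<open>Pseudo-division, one leading term at a time. Since the identity is only required at
  roots of \<open>Q x\<close>, multiples of \<open>Q x\<close> are subtracted without recording a
  quotient.\<close>

lemma pseudo_rem_exists:
  assumes "param_poly n P" "param_poly m Q" "1 \<le> m"
  shows "\<exists>R. param_poly (m - 1) R \<and> pseudo_rem m P Q R"
  using assms(1)
proof (induction n arbitrary: P)
  case 0
  then show ?case
    by (intro exI[of _ P]) (auto simp: pseudo_rem_def param_poly_def intro!: exI[of _ 0])
next
  case (Suc n)
  show ?case
  proof (cases "Suc n \<le> m - 1")
    case True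
    then show ?thesis using Suc.prems
      by (intro exI[of _ P]) (auto simp: pseudo_rem_def intro!: exI[of _ 0] elim: param_poly_mono)
  next
    case False
    define c where "c = (\<lambda>x. coeff (Q x) (m - 1))"
    \<comment> \<open>Both terms have coefficient \<open>(c x)\<^sup>2 * coeff (P x) n\<close> at
      exponent \<open>n\<close>, so the bound drops by one. Multiplying by a square raises
      \<open>e\<close> by one and keeps the total multiplier an even power.\<close>
    define P' where "P' = (\<lambda>x. smult ((c x)\<^sup>2) (P x) - monom (c x * coeff (P x) n) (n - (m - 1)) * Q x)"
    have rc: "real_polynomial_function c" "\<And>i. real_polynomial_function (\<lambda>x. coeff (P x) i)"
      "\<And>i. real_polynomial_function (\<lambda>x. coeff (Q x) i)"
      using assms Suc.prems by (auto simp: c_def param_poly_def)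
    have "param_poly n P'"
      unfolding param_poly_def
    proof (intro conjI allI impI)
      fix i
      show "real_polynomial_function (\<lambda>x. coeff (P' x) i)"
        unfolding P'_def coeff_diff coeff_smult coeff_monom_mult using rc
        by (cases "i < n - (m - 1)")
          (simp_all add: real_polynomial_function_diff real_polynomial_function.intros(4)
            real_polynomial_function_power)
    next
      fix x i assume "n \<le> i"
      show "coeff (P' x) i = 0"
      proof (cases "i = n")
        case True
        then show ?thesis using False
          by (simp add: P'_def coeff_monom_mult c_def power2_eq_square)
      next
        case ne: False
        then have "coeff (P x) i = 0" "coeff (Q x) (i - (n - (m - 1))) = 0"
          using Suc.prems assms(2) \<open>n \<le> i\<close> False by (auto simp: param_poly_def)
        then show ?thesis by (simp add: P'_def coeff_monom_mult)
      qed
    qed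
    then obtain R e where R: "param_poly (m - 1) R"
       "\<And>x t. poly (Q x) t = 0 \<Longrightarrow> c x ^ (2 * e) * poly (P' x) t = poly (R x) t"
      using Suc.IH unfolding pseudo_rem_def c_def by blast
    have "c x ^ (2 * Suc e) * poly (P x) t = poly (R x) t" if "poly (Q x) t = 0" for x t
      using R(2)[OF that] that by (simp add: P'_def power2_eq_square mult_ac)
    then show ?thesis using R(1) unfolding pseudo_rem_def c_def by blast
  qed
qed

text \<open>Three ways of lowering a bound: truncation where the top coefficient vanishes, the
  derivative for monotonicity, the remainder for signs at roots. The threshold \<open>j\<close>
  serves a construction from the highest bounds downwards.\<close>

definition closed_from :: "nat \<Rightarrow> (nat \<times> ('a::euclidean_space \<Rightarrow> real poly)) set \<Rightarrow> bool" where
  "closed_from j S \<longleftrightarrow> (\<forall>(n, P) \<in> S. j \<le> n \<longrightarrow>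
     (n - 1, \<lambda>x. P x - monom (coeff (P x) (n - 1)) (n - 1)) \<in> S \<and>
     (n - 1, \<lambda>x. pderiv (P x)) \<in> S \<and>
     (\<forall>(m, Q) \<in> S. j \<le> m \<longrightarrow> m \<le> n \<longrightarrow> (\<exists>R. (m - 1, R) \<in> S \<and> pseudo_rem m P Q R)))"

text \<open>The closure is finite because lowering the threshold from \<open>Suc j\<close> to
  \<open>j\<close> adds only members of bound \<open>j - 1\<close>, and of those nothing is demanded
  at threshold \<open>j\<close>.\<close>

lemma closed_family_exists:
  fixes S :: "(nat \<times> ('a::euclidean_space \<Rightarrow> real poly)) set"
  assumes "finite S" "\<And>n P. (n, P) \<in> S \<Longrightarrow> param_poly n P"
  obtains S' where "S \<subseteq> S'" "finite S'" "\<And>n P. (n, P) \<in> S' \<Longrightarrow> param_poly n P" "closed_from 1 S'"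
proof -
  obtain N where N: "\<And>n P. (n, P) \<in> S \<Longrightarrow> n \<le> N"
    using finite_nat_set_iff_bounded_le[of "fst ` S"] assms(1) by force
  have "1 \<le> j \<Longrightarrow> j \<le> Suc N \<Longrightarrow> \<exists>S'. S \<subseteq> S' \<and> finite S' \<and> (\<forall>n P. (n, P) \<in> S' \<longrightarrow> param_poly n P \<and> n \<le> N) \<and> closed_from j S'" for j
  proof (induction "Suc N - j" arbitrary: j)
    case 0
    then have "j = Suc N" by simp
    then show ?case using assms N by (intro exI[of _ S]) (auto simp: closed_from_def dest: N)
  next
    case (Suc k)
    then have j: "k = Suc N - Suc j" "j \<le> N" "1 \<le> j" by auto
    have "Suc j \<le> Suc N" "1 \<le> Suc j" using j by auto
    from Suc.hyps(1)[OF j(1) this(2,1)]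
    obtain S' where S': "S \<subseteq> S'" "finite S'" "\<And>n P. (n, P) \<in> S' \<Longrightarrow> param_poly n P"
      "\<And>n P. (n, P) \<in> S' \<Longrightarrow> n \<le> N" "closed_from (Suc j) S'"
      by blast
    define r where "r = (\<lambda>(P::'a \<Rightarrow> real poly) Q. SOME R. param_poly (j - 1) R \<and> pseudo_rem j P Q R)"
    have r: "param_poly (j - 1) (r P Q)" "pseudo_rem j P Q (r P Q)" if "(n, P) \<in> S'" "(j, Q) \<in> S'" for n P Q
      using someI_ex[OF pseudo_rem_exists[OF S'(3)[OF that(1)] S'(3)[OF that(2)] \<open>1 \<le> j\<close>]]
      by (auto simp: r_def)
    \<comment> \<open>Only what involves bound exactly \<open>j\<close> is missing: truncations and
      derivatives of members of bound \<open>j\<close>, and remainders of arbitrary members by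
      divisors of bound \<open>j\<close>.\<close>
    define T where "T = (\<lambda>(n, P). (n - 1, \<lambda>x. P x - monom (coeff (P x) (n - 1)) (n - 1))) ` {p \<in> S'. fst p = j}
       \<union> (\<lambda>(n, P). (n - 1, \<lambda>x. pderiv (P x))) ` {p \<in> S'. fst p = j}
       \<union> (\<lambda>((n, P), (m, Q)). (j - 1, r P Q)) ` (S' \<times> {p \<in> S'. fst p = j})"
    have finT: "finite T" using S'(2) by (auto simp: T_def)
    have T: "param_poly n P \<and> n = j - 1" if "(n, P) \<in> T" for n P
      using that param_poly_trunc[OF S'(3)] param_poly_pderiv[OF S'(3)] r(1)
      unfolding T_def by (auto simp del: One_nat_def)
    have "closed_from j (S' \<union> T)"
      unfolding closed_from_def
    proof (clarify, intro conjI)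
      fix n P assume nP: "(n, P) \<in> S' \<union> T" and "j \<le> n"
      then have nS: "(n, P) \<in> S'" using T \<open>1 \<le> j\<close> by force
      show "(n - 1, \<lambda>x. P x - monom (coeff (P x) (n - 1)) (n - 1)) \<in> S' \<union> T"
      proof (cases "n = j")
        case True
        then show ?thesis using nS by (auto simp: T_def image_iff)
      next
        case False
        then show ?thesis using nS \<open>j \<le> n\<close> S'(5) by (auto simp: closed_from_def)
      qed
      show "(n - 1, \<lambda>x. pderiv (P x)) \<in> S' \<union> T"
      proof (cases "n = j")
        case True
        then show ?thesis using nS by (auto simp: T_def image_iff)
      next
        case False
        then show ?thesis using nS \<open>j \<le> n\<close> S'(5) by (auto simp: closed_from_def)
      qed
      show "\<forall>(m, Q)\<in>S' \<union> T. j \<le> m \<longrightarrow> m \<le> n \<longrightarrow> (\<exists>R. (m - 1, R) \<in> S' \<union> T \<and> pseudo_rem m P Q R)"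
      proof clarify
        fix m Q assume "(m, Q) \<in> S' \<union> T" "j \<le> m" "m \<le> n"
        then have mS: "(m, Q) \<in> S'" using T \<open>1 \<le> j\<close> by force
        show "\<exists>R. (m - 1, R) \<in> S' \<union> T \<and> pseudo_rem m P Q R"
        proof (cases "m = j")
          case True
          have "(m - 1, r P Q) \<in> T" unfolding T_def using nS mS True by force
          then show ?thesis using r(2) nS mS True by blast
        next
          case False
          then show ?thesis using nS mS \<open>j \<le> m\<close> \<open>m \<le> n\<close> S'(5) by (fastforce simp: closed_from_def)
        qed
      qed
    qed
    moreover have "n \<le> N" if "(n, P) \<in> T" for n P using T[OF that] \<open>j \<le> N\<close> by simp
    ultimately show ?case using S' finT T by (intro exI[of _ "S' \<union> T"]) blast
  qed
  from this[of 1] show ?thesis using that by (metis Suc_eq_plus1 le_add2 order_refl)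
qed

subsection \<open>Continuous families of roots\<close>

lemma between_finite_sets:
  fixes L U :: "real set"
  assumes "finite L" "finite U" "\<forall>a\<in>L. \<forall>b\<in>U. a < b"
  shows "\<exists>t. (\<forall>a\<in>L. a < t) \<and> (\<forall>b\<in>U. t < b)"
proof (cases "L = {}")
  case True
  show ?thesis
  proof (cases "U = {}")
    case False
    then show ?thesis using True assms by (intro exI[of _ "Min U - 1"]) (auto simp: less_diff_eq intro: less_le_trans[of _ "Min U"])
  qed (use True in auto)
next
  case L: False
  show ?thesis
  proof (cases "U = {}")
    case True
    have "a < Max L + 1" if "a \<in> L" for a using Max_ge[OF assms(1) that] by linarith
    then show ?thesis using True by (intro exI[of _ "Max L + 1"]) auto
  next
    case False
    define M N where "M = Max L" and "N = Min U"
    have "M < N" using L False assms by (auto simp: M_def N_def)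
    then have "M < (M + N) / 2" "(M + N) / 2 < N" by auto
    moreover have "a \<le> M" if "a \<in> L" for a using assms(1) that by (simp add: M_def)
    moreover have "N \<le> b" if "b \<in> U" for b using assms(2) that by (simp add: N_def)
    ultimately have "\<forall>a\<in>L. a < (M + N) / 2" "\<forall>b\<in>U. (M + N) / 2 < b"
      by (meson le_less_trans less_le_trans)+
    then show ?thesis by blast
  qed
qed

text \<open>An open interval given by finite sets of points below and above it; an empty set stands
  for an infinite end.\<close>

definition gap :: "real set \<Rightarrow> real set \<Rightarrow> real set" where
  "gap L U = {t. (\<forall>a\<in>L. a < t) \<and> (\<forall>b\<in>U. t < b)}"

text \<open>A strictly increasing polynomial takes negative values on an interval exactly when its
  limit at the left end is negative. Maximality in \<open>L\<close> is spelled out instead of using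
  \<open>Max\<close>, so that an empty \<open>L\<close>, where a nonconstant increasing polynomial
  tends to minus infinity, makes the right side true.\<close>

lemma poly_neg_on_gap:
  fixes p :: "real poly"
  assumes "finite L" "gap L U \<noteq> {}" "\<forall>t\<in>gap L U. poly (pderiv p) t > 0"
  shows "(\<exists>t\<in>gap L U. poly p t < 0) \<longleftrightarrow> (\<forall>a\<in>L. (\<forall>a'\<in>L. a' \<le> a) \<longrightarrow> poly p a < 0)"
proof -
  have mono: "poly p s < poly p t" if "t \<in> gap L U" "\<forall>a\<in>L. a \<le> s" "s < t" for s t
  proof -
    obtain x where x: "s < x" "x < t" "poly p t - poly p s = (t - s) * poly (pderiv p) x"
      using poly_MVT[OF \<open>s < t\<close>] by blast
    have "x \<in> gap L U" using x that by (force simp: gap_def)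
    then have "(t - s) * poly (pderiv p) x > 0" using assms(3) \<open>s < t\<close> by simp
    then show ?thesis using x(3) by linarith
  qed
  obtain t0 where t0: "t0 \<in> gap L U" using assms(2) by blast
  show ?thesis
  proof
    assume "\<exists>t\<in>gap L U. poly p t < 0"
    then obtain t where t: "t \<in> gap L U" "poly p t < 0" by blast
    show "\<forall>a\<in>L. (\<forall>a'\<in>L. a' \<le> a) \<longrightarrow> poly p a < 0"
    proof (intro ballI impI)
      fix a assume "a \<in> L" "\<forall>a'\<in>L. a' \<le> a"
      moreover from this have "a < t" using t by (auto simp: gap_def)
      ultimately show "poly p a < 0" using mono[OF t(1), of a] t(2) by simp
    qed
  next
    assume R: "\<forall>a\<in>L. (\<forall>a'\<in>L. a' \<le> a) \<longrightarrow> poly p a < 0"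
    show "\<exists>t\<in>gap L U. poly p t < 0"
    proof (cases "L = {}")
      case True
      have "degree p \<noteq> 0"
        using assms(3) t0 by (auto simp: pderiv_eq_0_iff[symmetric])
      then have "filterlim (poly p) at_infinity at_infinity"
        using filterlim_poly_at_infinity by blast
      then have "\<forall>\<^sub>F z in at_infinity. \<bar>poly p t0\<bar> + 1 \<le> norm (poly p z)"
        by (auto simp: filterlim_at_infinity[of 0] simp del: real_norm_def)
      then obtain r where r: "\<And>z. r \<le> norm z \<Longrightarrow> \<bar>poly p t0\<bar> + 1 \<le> norm (poly p z)"
        by (auto simp: eventually_at_infinity)
      \<comment> \<open>Far to the left the value is smaller than \<open>poly p t0\<close> and yet
        exceeds it in absolute value, so it is negative.\<close>
      define t where "t = min (t0 - 1) (- \<bar>r\<bar>)"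
      have "t < t0" "r \<le> norm t" by (auto simp: t_def)
      have "t \<in> gap L U" using t0 \<open>t < t0\<close> True by (auto simp: gap_def)
      moreover have "poly p t < poly p t0" using mono[OF t0] True \<open>t < t0\<close> by auto
      ultimately show ?thesis using r[OF \<open>r \<le> norm t\<close>] by (intro bexI[of _ t]) auto
    next
      case False
      define a where "a = Max L"
      have a: "a \<in> L" "\<forall>a'\<in>L. a' \<le> a" using False assms(1) by (auto simp: a_def)
      then have "poly p a < 0" using R by blast
      moreover have "isCont (poly p) a" by simp
      ultimately obtain d where d: "d > 0" "\<And>t. dist t a < d \<Longrightarrow> poly p t < 0"
        using order_tendstoD(2)[of "poly p" "poly p a" "at a" 0]
        by (force simp: isCont_def eventually_at)
      have "a < t0" using t0 a by (auto simp: gap_def)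
      define t where "t = min (a + d / 2) ((a + t0) / 2)"
      have "a < t" "t < t0" "dist t a < d" using d(1) \<open>a < t0\<close>
        by (auto simp: t_def dist_real_def min_def)
      then have "t \<in> gap L U" using a t0 by (force simp: gap_def)
      then show ?thesis using d(2)[OF \<open>dist t a < d\<close>] by blast
    qed
  qed
qed

text \<open>Mirror image under the substitution of \<open>- t\<close> for \<open>t\<close>, which
  exchanges the two ends and the sign of the derivative.\<close>

lemma poly_neg_on_gap':
  fixes p :: "real poly"
  assumes "finite U" "gap L U \<noteq> {}" "\<forall>t\<in>gap L U. poly (pderiv p) t < 0"
  shows "(\<exists>t\<in>gap L U. poly p t < 0) \<longleftrightarrow> (\<forall>b\<in>U. (\<forall>b'\<in>U. b \<le> b') \<longrightarrow> poly p b < 0)"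
proof -
  define q where "q = pcompose p [:0, -1:]"
  have q: "poly q t = poly p (- t)" "poly (pderiv q) t = - poly (pderiv p) (- t)" for t
    by (auto simp: q_def poly_pcompose pderiv_pcompose pderiv_pCons)
  have g: "gap (uminus ` U) (uminus ` L) = uminus ` gap L U"
  proof (intro set_eqI iffI)
    fix t assume "t \<in> gap (uminus ` U) (uminus ` L)"
    then have "- t \<in> gap L U" by (auto simp: gap_def)
    then show "t \<in> uminus ` gap L U" by (metis image_eqI minus_minus)
  qed (auto simp: gap_def)
  have "(\<exists>t\<in>gap (uminus ` U) (uminus ` L). poly q t < 0) \<longleftrightarrow>
      (\<forall>a\<in>uminus ` U. (\<forall>a'\<in>uminus ` U. a' \<le> a) \<longrightarrow> poly q a < 0)"
    by (rule poly_neg_on_gap) (use assms g q in auto)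
  then show ?thesis unfolding g by (simp add: q)
qed

text \<open>The two previous facts applied to \<open>smult (- c) p\<close>. The gain is that the
  right side involves only comparisons of end points and signs there, which will be constant over
  the base.\<close>

lemma sgn_on_gap_iff:
  fixes p :: "real poly"
  assumes "finite L" "finite U" "gap L U \<noteq> {}" "\<forall>t\<in>gap L U. sgn (poly (pderiv p) t) = s"
    "s \<in> {1, -1}" "c \<in> {1, -1}"
  shows "(\<exists>t\<in>gap L U. sgn (poly p t) = c) \<longleftrightarrow>
    (if c = - s then \<forall>a\<in>L. (\<forall>a'\<in>L. a' \<le> a) \<longrightarrow> sgn (poly p a) = c
     else \<forall>b\<in>U. (\<forall>b'\<in>U. b \<le> b') \<longrightarrow> sgn (poly p b) = c)"
proof -
  define q where "q = smult (- c) p"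
  have q: "sgn (poly p t) = c \<longleftrightarrow> poly q t < 0" for t
    using assms(6) by (auto simp: q_def sgn_if)
  have dq: "sgn (poly (pderiv q) t) = - c * s" if "t \<in> gap L U" for t
    using assms(4,6) that by (auto simp: q_def pderiv_smult pderiv_minus sgn_mult sgn_minus)
  show ?thesis
  proof (cases "c = - s")
    case True
    have "\<forall>t\<in>gap L U. poly (pderiv q) t > 0"
    proof
      fix t assume "t \<in> gap L U"
      then have "sgn (poly (pderiv q) t) = 1" using dq assms(5) True by auto
      then show "poly (pderiv q) t > 0" by (simp only: sgn_1_pos)
    qed
    from poly_neg_on_gap[OF assms(1,3) this] show ?thesis unfolding if_P[OF True] q .
  next
    case False
    have "\<forall>t\<in>gap L U. poly (pderiv q) t < 0"
    proof
      fix t assume "t \<in> gap L U"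
      then have "sgn (poly (pderiv q) t) = -1" using dq assms(5,6) False by auto
      then show "poly (pderiv q) t < 0" by (simp only: sgn_1_neg)
    qed
    from poly_neg_on_gap'[OF assms(2,3) this] show ?thesis unfolding if_not_P[OF False] q .
  qed
qed

section \<open>Cylinders cut by ordered continuous sections\<close>

text \<open>Two points of the cylinder lie on the same section or in the same band. Describing cells
  by relative position avoids numbering the sections and treating unbounded bands
  separately.\<close>

definition cell_eq :: "('a \<Rightarrow> real) set \<Rightarrow> 'a \<Rightarrow> real \<Rightarrow> 'a \<Rightarrow> real \<Rightarrow> bool" where
  "cell_eq \<Xi> x s y t \<longleftrightarrow> (\<forall>\<xi>\<in>\<Xi>. sgn (s - \<xi> x) = sgn (t - \<xi> y))"

text \<open>The common order of the sections is demanded outright, since the sign classes that serve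
  as bases need not be connected. Two sections agree over all of \<open>A\<close> or
  nowhere.\<close>

definition ordered_on :: "'a::topological_space set \<Rightarrow> ('a \<Rightarrow> real) set \<Rightarrow> bool" where
  "ordered_on A \<Xi> \<longleftrightarrow> finite \<Xi> \<and> (\<forall>\<xi>\<in>\<Xi>. continuous_on A \<xi>) \<and>
     (\<forall>\<xi>\<in>\<Xi>. \<forall>\<eta>\<in>\<Xi>. \<forall>x\<in>A. \<forall>y\<in>A. sgn (\<xi> x - \<eta> x) = sgn (\<xi> y - \<eta> y))"

definition sign_invariant :: "'a set \<Rightarrow> ('a \<Rightarrow> real) set \<Rightarrow> ('a \<Rightarrow> real \<Rightarrow> real) \<Rightarrow> bool" where
  "sign_invariant A \<Xi> f \<longleftrightarrow>
     (\<forall>x\<in>A. \<forall>y\<in>A. \<forall>s t. cell_eq \<Xi> x s y t \<longrightarrow> sgn (f x s) = sgn (f y t))"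

lemma sgn_diff_less: "sgn (a - b) = sgn (c - d) \<Longrightarrow> a < b \<longleftrightarrow> c < (d::real)"
  by (auto simp: sgn_if split: if_splits)

lemma sgn_diff_eq: "sgn (a - b) = sgn (c - d) \<Longrightarrow> a = b \<longleftrightarrow> c = (d::real)"
  by (auto simp: sgn_if split: if_splits)

lemma sgn_diff_eqI: "(a < b \<longleftrightarrow> c < d) \<Longrightarrow> (a = b \<longleftrightarrow> c = d) \<Longrightarrow> sgn (a - b) = sgn (c - (d::real))"
  by (auto simp: sgn_if)

lemma ordered_on_less:
  "ordered_on A \<Xi> \<Longrightarrow> \<xi> \<in> \<Xi> \<Longrightarrow> \<eta> \<in> \<Xi> \<Longrightarrow> x \<in> A \<Longrightarrow> y \<in> A \<Longrightarrow> \<xi> x < \<eta> x \<longleftrightarrow> \<xi> y < \<eta> y"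
  unfolding ordered_on_def using sgn_diff_less by metis

text \<open>Fibres are cut in the same pattern: a point on a section is moved along it, a point in a
  band to any point between the corresponding sections. This is what yields projections.\<close>

lemma ordered_on_transport:
  assumes "ordered_on A \<Xi>" "x \<in> A" "y \<in> A"
  shows "\<exists>t. cell_eq \<Xi> x s y t"
proof (cases "\<exists>\<xi>\<in>\<Xi>. s = \<xi> x")
  case True
  then obtain \<xi> where "\<xi> \<in> \<Xi>" "s = \<xi> x" by blast
  then have "cell_eq \<Xi> x s y (\<xi> y)" using assms unfolding cell_eq_def ordered_on_def by blast
  then show ?thesis ..
next
  case False
  have "\<exists>t. (\<forall>a\<in>(\<lambda>\<xi>. \<xi> y) ` {\<xi>\<in>\<Xi>. \<xi> x < s}. a < t) \<and> (\<forall>b\<in>(\<lambda>\<xi>. \<xi> y) ` {\<xi>\<in>\<Xi>. s < \<xi> x}. t < b)"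
  proof (rule between_finite_sets)
    have "finite \<Xi>" using assms(1) by (simp add: ordered_on_def)
    then show "finite ((\<lambda>\<xi>. \<xi> y) ` {\<xi>\<in>\<Xi>. \<xi> x < s})" "finite ((\<lambda>\<xi>. \<xi> y) ` {\<xi>\<in>\<Xi>. s < \<xi> x})"
      by simp_all
    have "\<xi> y < \<eta> y" if "\<xi> \<in> \<Xi>" "\<eta> \<in> \<Xi>" "\<xi> x < s" "s < \<eta> x" for \<xi> \<eta>
      using ordered_on_less[OF assms(1) that(1,2) assms(2,3)] that(3,4) by simp
    then show "\<forall>a\<in>(\<lambda>\<xi>. \<xi> y) ` {\<xi>\<in>\<Xi>. \<xi> x < s}. \<forall>b\<in>(\<lambda>\<xi>. \<xi> y) ` {\<xi>\<in>\<Xi>. s < \<xi> x}. a < b"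
      by blast
  qed
  then obtain t where t: "\<And>\<xi>. \<xi> \<in> \<Xi> \<Longrightarrow> \<xi> x < s \<Longrightarrow> \<xi> y < t" "\<And>\<xi>. \<xi> \<in> \<Xi> \<Longrightarrow> s < \<xi> x \<Longrightarrow> t < \<xi> y"
    by blast
  have "cell_eq \<Xi> x s y t"
    unfolding cell_eq_def
  proof
    fix \<xi> assume \<xi>: "\<xi> \<in> \<Xi>"
    then have "s \<noteq> \<xi> x" using False by blast
    then consider "\<xi> x < s" | "s < \<xi> x" by linarith
    then show "sgn (s - \<xi> x) = sgn (t - \<xi> y)"
      by cases (use t[OF \<xi>] in simp_all)
  qed
  then show ?thesis ..
qed

lemma cell_eq_nearby:
  assumes "finite \<Xi>" "\<forall>\<xi>\<in>\<Xi>. s \<noteq> \<xi> x"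
  shows "\<exists>e>0. \<forall>s'. \<bar>s' - s\<bar> < e \<longrightarrow> cell_eq \<Xi> x s x s'"
proof -
  have "\<forall>\<^sub>F s' in nhds s. \<forall>\<xi>\<in>\<Xi>. sgn (s - \<xi> x) = sgn (s' - \<xi> x)"
  proof (rule eventually_ball_finite[OF assms(1)], rule ballI)
    fix \<xi> assume "\<xi> \<in> \<Xi>"
    then consider "s < \<xi> x" | "\<xi> x < s" using assms(2) by force
    then show "\<forall>\<^sub>F s' in nhds s. sgn (s - \<xi> x) = sgn (s' - \<xi> x)"
    proof cases
      case 1
      then show ?thesis using eventually_nhds_in_open[of "{..<\<xi> x}" s]
        by (auto elim!: eventually_mono simp: sgn_if)
    next
      case 2
      then show ?thesis using eventually_nhds_in_open[of "{\<xi> x<..}" s]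
        by (auto elim!: eventually_mono simp: sgn_if)
    qed
  qed
  then show ?thesis
    by (auto simp: eventually_nhds_metric dist_real_def cell_eq_def)
qed

text \<open>Bands are open in the fibre, so a root inside a band would be accompanied by an interval
  of roots.\<close>

lemma sign_invariant_root_in:
  assumes "sign_invariant A \<Xi> (\<lambda>x. poly (P x))" "finite \<Xi>" "x \<in> A" "P x \<noteq> 0" "poly (P x) s = 0"
  shows "\<exists>\<xi>\<in>\<Xi>. s = \<xi> x"
proof (rule ccontr)
  assume "\<not> ?thesis"
  then obtain e where e: "e > 0" "\<And>s'. \<bar>s' - s\<bar> < e \<Longrightarrow> cell_eq \<Xi> x s x s'"
    using cell_eq_nearby[OF assms(2)] by metis
  have "{s<..<s + e} \<subseteq> {t. poly (P x) t = 0}"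
  proof
    fix t assume "t \<in> {s<..<s + e}"
    then have "cell_eq \<Xi> x s x t" using e(2) by auto
    then have "sgn (poly (P x) s) = sgn (poly (P x) t)"
      using assms(1,3) unfolding sign_invariant_def by blast
    then show "t \<in> {t. poly (P x) t = 0}" using assms(5) by (auto simp: sgn_if split: if_splits)
  qed
  then have "finite {s<..<s + e}" using poly_roots_finite[OF assms(4)] finite_subset by blast
  then show False using e(1) infinite_Ioo[of s "s + e"] by auto
qed

text \<open>That every section is a root of a member of \<open>G\<close> allows the sign of a
  further polynomial on a section to be replaced by that of a pseudo-remainder.\<close>

definition delineated :: "'a::euclidean_space set \<Rightarrow> ('a \<Rightarrow> real) set \<Rightarrow> (nat \<times> ('a \<Rightarrow> real poly)) set \<Rightarrow> bool" where
  "delineated A \<Xi> G \<longleftrightarrow> ordered_on A \<Xi> \<and>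
     (\<forall>\<xi>\<in>\<Xi>. \<exists>(n, Q)\<in>G. \<forall>x\<in>A. poly (Q x) (\<xi> x) = 0) \<and>
     (\<forall>(n, P)\<in>G. sign_invariant A \<Xi> (\<lambda>x. poly (P x)))"

lemma sign_invariant_mono: "sign_invariant A \<Xi> f \<Longrightarrow> \<Xi> \<subseteq> \<Xi>' \<Longrightarrow> sign_invariant A \<Xi>' f"
  unfolding sign_invariant_def cell_eq_def by blast

text \<open>In a gap the derivative has one sign over the whole cylinder, so each \<open>P x\<close>
  is strictly monotone there and has at most one root. Whether it has one depends on data constant
  over \<open>A\<close>, so the answer is the same in all fibres. \<open>L\<close> is the set of
  sections below the gap; a gap that is empty over \<open>A\<close> falls under the second
  alternative.\<close>

lemma new_root_gap:
  fixes P :: "'a::euclidean_space \<Rightarrow> real poly"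
  assumes ord: "ordered_on A \<Xi>" and pp: "param_poly n P"
    and dinv: "sign_invariant A \<Xi> (\<lambda>x. poly (pderiv (P x)))"
    and dnz: "\<And>x. x \<in> A \<Longrightarrow> pderiv (P x) \<noteq> 0"
    and rinv: "\<And>\<xi> x y. \<xi> \<in> \<Xi> \<Longrightarrow> x \<in> A \<Longrightarrow> y \<in> A \<Longrightarrow> sgn (poly (P x) (\<xi> x)) = sgn (poly (P y) (\<xi> y))"
    and L: "L \<subseteq> \<Xi>" and g: "g = (\<lambda>x. gap ((\<lambda>\<xi>. \<xi> x) ` L) ((\<lambda>\<xi>. \<xi> x) ` (\<Xi> - L)))"
  shows "(\<exists>\<eta>. continuous_on A \<eta> \<and> (\<forall>x\<in>A. \<eta> x \<in> g x \<and> poly (P x) (\<eta> x) = 0) \<and>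
      (\<forall>x\<in>A. \<forall>y\<in>A. \<forall>s\<in>g x. \<forall>t\<in>g y. sgn (s - \<eta> x) = sgn (t - \<eta> y) \<longrightarrow> sgn (poly (P x) s) = sgn (poly (P y) t)))
    \<or> (\<forall>x\<in>A. \<forall>y\<in>A. \<forall>s\<in>g x. \<forall>t\<in>g y. sgn (poly (P x) s) = sgn (poly (P y) t))"
proof (cases "\<exists>x\<in>A. g x \<noteq> {}")
  case True
  have fin: "finite \<Xi>" using ord by (simp add: ordered_on_def)
  have geq: "cell_eq \<Xi> x s y t" if "s \<in> g x" "t \<in> g y" for x y s t
    unfolding cell_eq_def
  proof
    fix \<xi> assume "\<xi> \<in> \<Xi>"
    then show "sgn (s - \<xi> x) = sgn (t - \<xi> y)"
      using that by (cases "\<xi> \<in> L") (auto simp: g gap_def)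
  qed
  have gtr: "t \<in> g y" if "s \<in> g x" "cell_eq \<Xi> x s y t" for x y s t
  proof -
    have "\<xi> y < t" if "\<xi> \<in> L" for \<xi>
    proof -
      have "\<xi> x < s" "sgn (s - \<xi> x) = sgn (t - \<xi> y)" using \<open>s \<in> g x\<close> \<open>cell_eq \<Xi> x s y t\<close> L that
        unfolding g gap_def cell_eq_def by blast+
      then show ?thesis by (auto simp: sgn_if split: if_splits)
    qed
    moreover have "t < \<xi> y" if "\<xi> \<in> \<Xi> - L" for \<xi>
    proof -
      have "s < \<xi> x" "sgn (s - \<xi> x) = sgn (t - \<xi> y)" using \<open>s \<in> g x\<close> \<open>cell_eq \<Xi> x s y t\<close> L that
        unfolding g gap_def cell_eq_def by blast+
      then show ?thesis by (auto simp: sgn_if split: if_splits)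
    qed
    ultimately show ?thesis by (auto simp: g gap_def)
  qed
  obtain x0 s0 where x0: "x0 \<in> A" "s0 \<in> g x0" using True by blast
  have gne: "g x \<noteq> {}" if "x \<in> A" for x
    using ordered_on_transport[OF ord x0(1) that] gtr[OF x0(2)] by blast
  define \<sigma> where "\<sigma> = sgn (poly (pderiv (P x0)) s0)"
  have \<sigma>: "sgn (poly (pderiv (P x)) t) = \<sigma>" if "x \<in> A" "t \<in> g x" for x t
    using dinv geq[OF x0(2) that(2)] x0(1) that(1) unfolding sign_invariant_def \<sigma>_def by metis
  have nroot: "\<forall>\<xi>\<in>\<Xi>. s \<noteq> \<xi> x" if "s \<in> g x" for s x
    using that by (force simp: g gap_def)
  have "\<sigma> \<noteq> 0"
    using sign_invariant_root_in[OF dinv fin x0(1) dnz[OF x0(1)], of s0] nroot[OF x0(2)]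
    by (auto simp: \<sigma>_def sgn_if)
  then have \<sigma>1: "\<sigma> \<in> {1, -1}" by (auto simp: \<sigma>_def sgn_if)
  have conv: "u \<in> g x" if "s \<in> g x" "t \<in> g x" "s \<le> u" "u \<le> t" for s t u x
    using that unfolding g gap_def by (auto intro: less_le_trans le_less_trans)
  have mono: "sgn (poly (P x) t - poly (P x) s) = \<sigma> * sgn (t - s)" if "x \<in> A" "s \<in> g x" "t \<in> g x" for x s t
  proof -
    have *: "sgn (poly (P x) t - poly (P x) s) = \<sigma>" if "s < t" "s \<in> g x" "t \<in> g x" for s t
    proof -
      obtain u where u: "s < u" "u < t" "poly (P x) t - poly (P x) s = (t - s) * poly (pderiv (P x)) u"
        using poly_MVT[OF \<open>s < t\<close>] by blast
      then have "u \<in> g x" using conv[OF that(2,3), of u] by simp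
      then show ?thesis using u \<sigma>[OF \<open>x \<in> A\<close>] by (simp add: sgn_mult)
    qed
    consider "s < t" | "s = t" | "t < s" by linarith
    then show ?thesis
    proof cases
      case 3
      then have "sgn (- (poly (P x) s - poly (P x) t)) = - \<sigma>"
        using *[OF 3 that(3,2)] by (simp only: sgn_minus)
      then show ?thesis using 3 by simp
    qed (use *[of s t] that in auto)
  qed
  \<comment> \<open>By \<open>sgn_on_gap_iff\<close> the occurrence of a sign is decided by which
    sections are extremal in \<open>L\<close> or in its complement and by the signs of
    \<open>P\<close> on them. Neither depends on the base point.\<close>
  have inv: "(\<exists>t\<in>g x. sgn (poly (P x) t) = c) \<longleftrightarrow> (\<exists>t\<in>g y. sgn (poly (P y) t) = c)"
    if "x \<in> A" "y \<in> A" "c \<in> {1, -1}" for x y c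
  proof -
    let ?R = "\<lambda>x. if c = - \<sigma> then \<forall>a\<in>L. (\<forall>a'\<in>L. a' x \<le> a x) \<longrightarrow> sgn (poly (P x) (a x)) = c
        else \<forall>b\<in>\<Xi>-L. (\<forall>b'\<in>\<Xi>-L. b x \<le> b' x) \<longrightarrow> sgn (poly (P x) (b x)) = c"
    have *: "(\<exists>t\<in>g x. sgn (poly (P x) t) = c) \<longleftrightarrow> ?R x" if "x \<in> A" for x
    proof -
      have "\<forall>t\<in>g x. sgn (poly (pderiv (P x)) t) = \<sigma>" using \<sigma>[OF that] by blast
      from sgn_on_gap_iff[OF finite_imageI[OF finite_subset[OF L fin]] finite_imageI[OF finite_Diff[OF fin]]
          gne[OF that, unfolded g] this[unfolded g] \<sigma>1 \<open>c \<in> {1, -1}\<close>]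
      show ?thesis unfolding g by (simp only: ball_simps)
    qed
    have le: "a x \<le> b x \<longleftrightarrow> a y \<le> b y" if "a \<in> \<Xi>" "b \<in> \<Xi>" for a b
      using ordered_on_less[OF ord that(2,1) \<open>x \<in> A\<close> \<open>y \<in> A\<close>] by (simp add: linorder_not_less[symmetric])
    have 1: "(\<forall>a'\<in>L. a' x \<le> a x) \<longleftrightarrow> (\<forall>a'\<in>L. a' y \<le> a y)" if "a \<in> \<Xi>" for a
      using le[OF _ that] L by blast
    have 2: "(\<forall>b'\<in>\<Xi>-L. b x \<le> b' x) \<longleftrightarrow> (\<forall>b'\<in>\<Xi>-L. b y \<le> b' y)" if "b \<in> \<Xi>" for b
      using le[OF that] by blast
    have "?R x \<longleftrightarrow> ?R y"
      by (intro if_cong refl ball_cong) (simp_all add: 1 2 rinv[OF _ that(1,2)] subsetD[OF L])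
    then show ?thesis using * that by simp
  qed
  show ?thesis
  proof (cases "\<forall>c\<in>{1, -1}. \<exists>t\<in>g x0. sgn (poly (P x0) t) = c")
    case True
    have ex: "\<exists>u\<in>g x. poly (P x) u = 0" if "x \<in> A" for x
    proof -
      obtain a b where ab: "a \<in> g x" "b \<in> g x" "poly (P x) a > 0" "poly (P x) b < 0"
      proof -
        have "\<exists>t\<in>g x. sgn (poly (P x) t) = 1" "\<exists>t\<in>g x. sgn (poly (P x) t) = -1"
          using True inv[OF x0(1) \<open>x \<in> A\<close>] by auto
        then show ?thesis using that by (auto simp: sgn_1_pos sgn_1_neg)
      qed
      consider "a < b" | "b < a" using ab by force
      then show ?thesis
      proof cases
        case 1
        then obtain u where "a < u" "u < b" "poly (P x) u = 0" using poly_IVT_neg ab by blast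
        then show ?thesis using conv[OF ab(1,2), of u] by auto
      next
        case 2
        then obtain u where "b < u" "u < a" "poly (P x) u = 0" using poly_IVT_pos ab by blast
        then show ?thesis using conv[OF ab(2,1), of u] by auto
      qed
    qed
    define \<eta> where "\<eta> = (\<lambda>x. SOME u. u \<in> g x \<and> poly (P x) u = 0)"
    have \<eta>: "\<eta> x \<in> g x" "poly (P x) (\<eta> x) = 0" if "x \<in> A" for x
      using someI_ex[of "\<lambda>u. u \<in> g x \<and> poly (P x) u = 0"] ex[OF that] by (auto simp: \<eta>_def)
    have sg: "sgn (poly (P x) s) = \<sigma> * sgn (s - \<eta> x)" if "x \<in> A" "s \<in> g x" for x s
      using mono[OF that(1) \<eta>(1)[OF that(1)] that(2)] \<eta>(2)[OF that(1)] by simp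
    \<comment> \<open>Just left and right of the root \<open>P x\<close> has opposite nonzero signs.
      These signs, and membership in the gap, persist for \<open>y\<close> near \<open>x\<close> and
      trap \<open>\<eta> y\<close> between \<open>\<eta> x - d\<close> and
      \<open>\<eta> x + d\<close>.\<close>
    have "continuous_on A \<eta>"
      unfolding continuous_on_iff
    proof (intro ballI allI impI)
      fix x and e :: real assume x: "x \<in> A" "e > 0"
      obtain e' where e': "e' > 0" "\<And>s'. \<bar>s' - \<eta> x\<bar> < e' \<Longrightarrow> cell_eq \<Xi> x (\<eta> x) x s'"
        using cell_eq_nearby[OF fin, of "\<eta> x" x] nroot[OF \<eta>(1)[OF x(1)]] by blast
      define d where "d = min e e' / 2"
      have d: "d > 0" "d < e" "d < e'" using x(2) e'(1) by (auto simp: d_def min_def)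
      have near: "\<forall>\<^sub>F y in at x within A. u \<in> g y \<and> sgn (poly (P y) u) = sgn (poly (P x) u)"
        if "u \<in> g x" "u \<noteq> \<eta> x" for u
      proof -
        have nz: "poly (P x) u \<noteq> 0" using sg[OF x(1) that(1)] that(2) \<sigma>1 by (auto simp: sgn_if split: if_splits)
        have "((\<lambda>y. poly (P y) u) \<longlongrightarrow> poly (P x) u) (at x within A)"
          using continuous_on_param_poly[OF pp, of A u] x(1) by (auto simp: continuous_on_def)
        then have 1: "\<forall>\<^sub>F y in at x within A. sgn (poly (P y) u) = sgn (poly (P x) u)"
        proof -
          assume t: "((\<lambda>y. poly (P y) u) \<longlongrightarrow> poly (P x) u) (at x within A)"
          consider "poly (P x) u > 0" | "poly (P x) u < 0" using nz by linarith
          then show ?thesis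
          proof cases
            case 1
            then show ?thesis using order_tendstoD(1)[OF t 1] by (auto elim!: eventually_mono)
          next
            case 2
            then show ?thesis using order_tendstoD(2)[OF t 2] by (auto elim!: eventually_mono)
          qed
        qed
        have ct: "(\<xi> \<longlongrightarrow> \<xi> x) (at x within A)" if "\<xi> \<in> \<Xi>" for \<xi>
          using ord that x(1) by (auto simp: ordered_on_def continuous_on_def)
        have "\<forall>\<^sub>F y in at x within A. \<forall>\<xi>\<in>L. \<xi> y < u"
          by (rule eventually_ball_finite[OF finite_subset[OF L fin]])
            (use \<open>u \<in> g x\<close> L in \<open>auto simp: g gap_def intro!: order_tendstoD(2)[OF ct]\<close>)
        moreover have "\<forall>\<^sub>F y in at x within A. \<forall>\<xi>\<in>\<Xi> - L. u < \<xi> y"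
          by (rule eventually_ball_finite)
            (use \<open>u \<in> g x\<close> L fin in \<open>auto simp: g gap_def intro!: order_tendstoD(1)[OF ct]\<close>)
        ultimately have 2: "\<forall>\<^sub>F y in at x within A. u \<in> g y"
          by eventually_elim (auto simp: g gap_def)
        show ?thesis using eventually_conj[OF 2 1] .
      qed
      have a: "\<eta> x - d \<in> g x" and b: "\<eta> x + d \<in> g x"
        using e'(2) d gtr[OF \<eta>(1)[OF x(1)]] by auto
      have "\<forall>\<^sub>F y in at x within A. dist (\<eta> y) (\<eta> x) < e"
      proof -
        have "\<forall>\<^sub>F y in at x within A. y \<in> A" by (auto simp: eventually_at_filter)
        moreover have "\<forall>\<^sub>F y in at x within A. \<eta> x - d \<in> g y \<and> sgn (poly (P y) (\<eta> x - d)) = sgn (poly (P x) (\<eta> x - d))"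
          using near[OF a] d(1) by simp
        moreover have "\<forall>\<^sub>F y in at x within A. \<eta> x + d \<in> g y \<and> sgn (poly (P y) (\<eta> x + d)) = sgn (poly (P x) (\<eta> x + d))"
          using near[OF b] d(1) by simp
        ultimately show ?thesis
        proof eventually_elim
          case (elim y)
          have "\<sigma> * sgn (\<eta> x - d - \<eta> y) = \<sigma> * sgn (- d)"
            using sg[OF elim(1), of "\<eta> x - d"] sg[OF x(1) a] elim(2) by auto
          moreover have "\<sigma> * sgn (\<eta> x + d - \<eta> y) = \<sigma> * sgn d"
            using sg[OF elim(1), of "\<eta> x + d"] sg[OF x(1) b] elim(3) by auto
          ultimately have "\<eta> x - d < \<eta> y" "\<eta> y < \<eta> x + d" using \<sigma>1 d(1)
            by (auto simp: sgn_if split: if_splits)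
          then show ?case using d(2) by (auto simp: dist_real_def)
        qed
      qed
      then show "\<exists>d>0. \<forall>x'\<in>A. dist x' x < d \<longrightarrow> dist (\<eta> x') (\<eta> x) < e"
        using x(2) unfolding eventually_at by (metis dist_self)
    qed
    then show ?thesis using \<eta> sg by (intro disjI1 exI[of _ \<eta>]) auto
  next
    case False
    then obtain c where c: "c \<in> {1, -1}" "\<not> (\<exists>t\<in>g x0. sgn (poly (P x0) t) = c)" by blast
    have "sgn (poly (P x) s) = - c" if "x \<in> A" "s \<in> g x" for x s
    proof -
      have nc: "sgn (poly (P x) t) \<noteq> c" if "t \<in> g x" for t
        using inv[OF x0(1) \<open>x \<in> A\<close> c(1)] c(2) that by blast
      have "poly (P x) s \<noteq> 0"
      proof
        assume z: "poly (P x) s = 0"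
        obtain e where e: "e > 0" "\<And>s'. \<bar>s' - s\<bar> < e \<Longrightarrow> cell_eq \<Xi> x s x s'"
          using cell_eq_nearby[OF fin] nroot[OF \<open>s \<in> g x\<close>] by metis
        \<comment> \<open>At a zero, moving in the direction \<open>c * \<sigma>\<close> would
          produce the sign \<open>c\<close>, which does not occur.\<close>
        define t where "t = s + c * \<sigma> * (e / 2)"
        have "\<bar>t - s\<bar> < e" using e(1) c(1) \<sigma>1 by (auto simp: t_def)
        then have "t \<in> g x" using e(2) gtr[OF \<open>s \<in> g x\<close>] by blast
        then have "sgn (poly (P x) t) = \<sigma> * sgn (t - s)" using mono[OF \<open>x \<in> A\<close> \<open>s \<in> g x\<close>] z by simp
        also have "\<dots> = c" using e(1) c(1) \<sigma>1 by (auto simp: t_def)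
        finally show False using nc \<open>t \<in> g x\<close> by blast
      qed
      then show ?thesis using nc[OF \<open>s \<in> g x\<close>] c(1) by (auto simp: sgn_if split: if_splits)
    qed
    then show ?thesis by simp
  qed
next
  case False
  then have "\<forall>x\<in>A. g x = {}" by blast
  then show ?thesis by (intro disjI2) simp
qed

text \<open>Each gap receives at most one new section, supplied by \<open>new_root_gap\<close>, and
  gaps are indexed by the set \<open>L\<close> of old sections below them.\<close>

lemma delineated_insert:
  fixes P :: "'a::euclidean_space \<Rightarrow> real poly"
  assumes del: "delineated A \<Xi> G" and pp: "param_poly n P"
    and dinv: "sign_invariant A \<Xi> (\<lambda>x. poly (pderiv (P x)))"
    and dnz: "\<And>x. x \<in> A \<Longrightarrow> pderiv (P x) \<noteq> 0"
    and rinv: "\<And>\<xi> x y. \<xi> \<in> \<Xi> \<Longrightarrow> x \<in> A \<Longrightarrow> y \<in> A \<Longrightarrow> sgn (poly (P x) (\<xi> x)) = sgn (poly (P y) (\<xi> y))"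
  shows "\<exists>\<Xi>'. delineated A \<Xi>' (insert (n, P) G)"
proof -
  have ord: "ordered_on A \<Xi>" using del by (simp add: delineated_def)
  then have fin: "finite \<Xi>" by (simp add: ordered_on_def)
  define g where "g = (\<lambda>L x. gap ((\<lambda>\<xi>. \<xi> x) ` L) ((\<lambda>\<xi>. \<xi> x) ` (\<Xi> - L)))"
  define root where "root = (\<lambda>L \<eta>. continuous_on A \<eta> \<and> (\<forall>x\<in>A. \<eta> x \<in> g L x \<and> poly (P x) (\<eta> x) = 0) \<and>
      (\<forall>x\<in>A. \<forall>y\<in>A. \<forall>s\<in>g L x. \<forall>t\<in>g L y. sgn (s - \<eta> x) = sgn (t - \<eta> y) \<longrightarrow> sgn (poly (P x) s) = sgn (poly (P y) t)))"
  have dich: "Ex (root L) \<or> (\<forall>x\<in>A. \<forall>y\<in>A. \<forall>s\<in>g L x. \<forall>t\<in>g L y. sgn (poly (P x) s) = sgn (poly (P y) t))"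
    if "L \<subseteq> \<Xi>" for L
    using new_root_gap[OF ord pp dinv dnz rinv that, of "g L"] unfolding root_def g_def by blast
  define E where "E = {L. L \<subseteq> \<Xi> \<and> Ex (root L)}"
  define \<eta> where "\<eta> = (\<lambda>L. SOME h. root L h)"
  have \<eta>: "root L (\<eta> L)" if "L \<in> E" for L
    using that someI_ex[of "root L"] by (auto simp: E_def \<eta>_def)
  have finE: "finite E" using fin by (auto simp: E_def)
  have \<eta>if: "if \<xi> \<in> L then \<xi> x < \<eta> L x else \<eta> L x < \<xi> x"
    if "L \<in> E" "x \<in> A" "\<xi> \<in> \<Xi>" for L x \<xi>
  proof -
    have "\<eta> L x \<in> g L x" using \<eta>[OF that(1)] that(2) unfolding root_def by blast
    then show ?thesis using that(3) by (simp add: g_def gap_def)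
  qed
  have \<eta>g: "\<xi> x < \<eta> L x \<longleftrightarrow> \<xi> \<in> L" "\<eta> L x < \<xi> x \<longleftrightarrow> \<xi> \<notin> L" "\<xi> x \<noteq> \<eta> L x" "\<eta> L x \<noteq> \<xi> x"
    if "L \<in> E" "x \<in> A" "\<xi> \<in> \<Xi>" for L x \<xi>
    using \<eta>if[OF that] by (simp_all split: if_splits)
  define \<Xi>' where "\<Xi>' = \<Xi> \<union> \<eta> ` E"
  have "ordered_on A \<Xi>'"
    unfolding ordered_on_def
  proof (intro conjI ballI)
    show "finite \<Xi>'" using fin finE by (simp add: \<Xi>'_def)
    show "continuous_on A \<xi>" if "\<xi> \<in> \<Xi>'" for \<xi>
      using that ord \<eta> by (auto simp: \<Xi>'_def ordered_on_def root_def)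
    fix \<xi> \<zeta> x y assume *: "\<xi> \<in> \<Xi>'" "\<zeta> \<in> \<Xi>'" and xy: "x \<in> A" "y \<in> A"
    have ee: "sgn (\<eta> L x - \<eta> M x) = sgn (\<eta> L y - \<eta> M y)" if "L \<in> E" "M \<in> E" for L M
    proof (cases "L = M")
      case False
      \<comment> \<open>Some old section lies below one of the two gaps but not below the other, and
        so separates the two new roots over every point.\<close>
      then consider \<zeta> where "\<zeta> \<in> L" "\<zeta> \<notin> M" | \<zeta> where "\<zeta> \<in> M" "\<zeta> \<notin> L" by blast
      then show ?thesis
      proof cases
        case 1
        then have "\<zeta> \<in> \<Xi>" using that by (auto simp: E_def)
        then have "\<eta> M z < \<eta> L z" if "z \<in> A" for z
          using 1 \<eta>g(1,2)[of _ z \<zeta>] \<open>L \<in> E\<close> \<open>M \<in> E\<close> that by (meson order.strict_trans)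
        then show ?thesis using xy by simp
      next
        case 2
        then have "\<zeta> \<in> \<Xi>" using that by (auto simp: E_def)
        then have "\<eta> L z < \<eta> M z" if "z \<in> A" for z
          using 2 \<eta>g(1,2)[of _ z \<zeta>] \<open>L \<in> E\<close> \<open>M \<in> E\<close> that by (meson order.strict_trans)
        then show ?thesis using xy by simp
      qed
    qed simp
    show "sgn (\<xi> x - \<zeta> x) = sgn (\<xi> y - \<zeta> y)"
    proof -
      have ex: "sgn (\<eta> L x - \<kappa> x) = sgn (\<eta> L y - \<kappa> y)" if "L \<in> E" "\<kappa> \<in> \<Xi>" for L \<kappa>
        using \<eta>g[OF that(1) xy(1) that(2)] \<eta>g[OF that(1) xy(2) that(2)] by (intro sgn_diff_eqI) simp_all
      have xe: "sgn (\<kappa> x - \<eta> L x) = sgn (\<kappa> y - \<eta> L y)" if "L \<in> E" "\<kappa> \<in> \<Xi>" for L \<kappa>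
        using \<eta>g[OF that(1) xy(1) that(2)] \<eta>g[OF that(1) xy(2) that(2)] by (intro sgn_diff_eqI) simp_all
      consider "\<xi> \<in> \<Xi>" "\<zeta> \<in> \<Xi>" | L where "L \<in> E" "\<xi> = \<eta> L" "\<zeta> \<in> \<Xi>"
        | M where "M \<in> E" "\<zeta> = \<eta> M" "\<xi> \<in> \<Xi>" | L M where "L \<in> E" "\<xi> = \<eta> L" "M \<in> E" "\<zeta> = \<eta> M"
        using * unfolding \<Xi>'_def by blast
      then show ?thesis
      proof cases
        case 1
        then show ?thesis using ord xy unfolding ordered_on_def by blast
      qed (simp_all add: ex xe ee)
    qed
  qed
  moreover have "\<forall>\<xi>\<in>\<Xi>'. \<exists>(m, Q)\<in>insert (n, P) G. \<forall>x\<in>A. poly (Q x) (\<xi> x) = 0"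
  proof
    fix \<xi> assume "\<xi> \<in> \<Xi>'"
    then consider "\<xi> \<in> \<Xi>" | L where "L \<in> E" "\<xi> = \<eta> L" unfolding \<Xi>'_def by blast
    then show "\<exists>(m, Q)\<in>insert (n, P) G. \<forall>x\<in>A. poly (Q x) (\<xi> x) = 0"
    proof cases
      case 1
      then have "\<exists>(m, Q)\<in>G. \<forall>x\<in>A. poly (Q x) (\<xi> x) = 0"
        using del unfolding delineated_def by blast
      then show ?thesis by blast
    next
      case 2
      then have "\<forall>x\<in>A. poly (P x) (\<xi> x) = 0" using \<eta> unfolding root_def by blast
      then show ?thesis by blast
    qed
  qed
  moreover have "sign_invariant A \<Xi>' (\<lambda>x. poly (P x))"
    unfolding sign_invariant_def
  proof (intro ballI allI impI)
    fix x y s t assume xy: "x \<in> A" "y \<in> A" and ce: "cell_eq \<Xi>' x s y t"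
    have ce': "sgn (s - \<xi> x) = sgn (t - \<xi> y)" if "\<xi> \<in> \<Xi>" for \<xi>
      using ce that unfolding cell_eq_def \<Xi>'_def by blast
    show "sgn (poly (P x) s) = sgn (poly (P y) t)"
    proof (cases "\<exists>\<xi>\<in>\<Xi>. s = \<xi> x")
      case True
      then obtain \<xi> where \<xi>: "\<xi> \<in> \<Xi>" "s = \<xi> x" by blast
      then have "t = \<xi> y" using sgn_diff_eq[OF ce'[OF \<xi>(1)]] by simp
      then show ?thesis using rinv[OF \<xi>(1) xy] \<xi>(2) by simp
    next
      case False
      \<comment> \<open>The old sections below \<open>(x, s)\<close> identify its gap, and
        \<open>(y, t)\<close> lies in the same one.\<close>
      define L where "L = {\<xi>\<in>\<Xi>. \<xi> x < s}"
      have "L \<subseteq> \<Xi>" by (auto simp: L_def)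
      have side: "if \<xi> \<in> L then \<xi> x < s \<and> \<xi> y < t else s < \<xi> x \<and> t < \<xi> y" if "\<xi> \<in> \<Xi>" for \<xi>
      proof -
        have "s \<noteq> \<xi> x" using False that by blast
        then show ?thesis using sgn_diff_less[OF ce'[OF that]] sgn_diff_eq[OF ce'[OF that]] that
          by (simp add: L_def) linarith
      qed
      have sg: "s \<in> g L x" and tg: "t \<in> g L y"
        using side \<open>L \<subseteq> \<Xi>\<close> by (auto simp: g_def gap_def split: if_splits)
      show ?thesis
      proof (cases "L \<in> E")
        case True
        have "sgn (s - \<eta> L x) = sgn (t - \<eta> L y)"
          using ce True unfolding cell_eq_def \<Xi>'_def by blast
        then show ?thesis using \<eta>[OF True] xy sg tg unfolding root_def by blast
      next
        case False
        then show ?thesis using dich[OF \<open>L \<subseteq> \<Xi>\<close>] xy sg tg \<open>L \<subseteq> \<Xi>\<close> unfolding E_def by blast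
      qed
    qed
  qed
  moreover have "\<forall>(m, Q)\<in>G. sign_invariant A \<Xi>' (\<lambda>x. poly (Q x))"
  proof -
    have "\<Xi> \<subseteq> \<Xi>'" by (simp add: \<Xi>'_def)
    then show ?thesis using del sign_invariant_mono unfolding delineated_def by blast
  qed
  ultimately show ?thesis unfolding delineated_def by (intro exI[of _ \<Xi>'] conjI) auto
qed

lemma delineated_insert_invariant:
  assumes "delineated A \<Xi> G" "sign_invariant A \<Xi> (\<lambda>x. poly (P x))"
  shows "delineated A \<Xi> (insert (n, P) G)"
  using assms unfolding delineated_def by auto

lemma sgn_mult_power_even: "c \<noteq> 0 \<Longrightarrow> sgn (c ^ (2 * e) * z) = sgn (z::real)"
  by (cases "c > 0") (auto simp: sgn_mult power_mult)

lemma closed_fromD: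
  assumes "closed_from j S" "(n, P) \<in> S" "j \<le> n"
  shows "(n - 1, \<lambda>x. P x - monom (coeff (P x) (n - 1)) (n - 1)) \<in> S"
    and "(n - 1, \<lambda>x. pderiv (P x)) \<in> S"
    and "(m, Q) \<in> S \<Longrightarrow> j \<le> m \<Longrightarrow> m \<le> n \<Longrightarrow> \<exists>R. (m - 1, R) \<in> S \<and> pseudo_rem m P Q R"
  using assms unfolding closed_from_def by blast+

text \<open>Induction on the degree bound. Adding \<open>P\<close> requires invariance of its
  derivative, which has a smaller bound, and of its signs on the present sections. A section is a
  root of some \<open>Q\<close> whose bound is at most that of \<open>P\<close>, and there
  \<open>P\<close> has the sign of a remainder of smaller bound, which is already invariant.\<close>

lemma delineation_of_closed_family:
  fixes S :: "(nat \<times> ('a::euclidean_space \<Rightarrow> real poly)) set"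
  assumes fin: "finite S" and pp: "\<And>n P. (n, P) \<in> S \<Longrightarrow> param_poly n P" and cl: "closed_from 1 S"
    and A: "\<And>n P i x y. (n, P) \<in> S \<Longrightarrow> x \<in> A \<Longrightarrow> y \<in> A \<Longrightarrow> sgn (coeff (P x) i) = sgn (coeff (P y) i)"
    and x0: "x0 \<in> A"
  shows "\<exists>\<Xi>. ordered_on A \<Xi> \<and> (\<forall>(n, P)\<in>S. sign_invariant A \<Xi> (\<lambda>x. poly (P x)))"
proof -
  \<comment> \<open>Members whose coefficient at \<open>n - 1\<close> really is a leading one; by
    constancy of signs it vanishes nowhere on \<open>A\<close>. Every other member of positive bound
    equals its truncation over \<open>A\<close> and is reached through it.\<close>
  define T where "T = {(n, P) \<in> S. 1 \<le> n \<and> coeff (P x0) (n - 1) \<noteq> 0}"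
  have TS: "T \<subseteq> S" by (auto simp: T_def)
  have lead: "coeff (P x) (n - 1) \<noteq> 0" if "(n, P) \<in> T" "x \<in> A" for n P x
    using A[of n P x x0 "n - 1"] that x0 by (auto simp: T_def sgn_if split: if_splits)
  have T1: "(n, P) \<in> S" "1 \<le> n" if "(n, P) \<in> T" for n P using that by (auto simp: T_def)
  have all: "sign_invariant A \<Xi> (\<lambda>x. poly (R x))"
    if "(r, R) \<in> S" "r \<le> N" "\<And>n P. (n, P) \<in> T \<Longrightarrow> n \<le> N \<Longrightarrow> sign_invariant A \<Xi> (\<lambda>x. poly (P x))" for r R N \<Xi>
    using that(1,2)
  proof (induction r arbitrary: R)
    case 0
    then have "R x = 0" for x using pp[of 0 R] by (auto simp: param_poly_def poly_eq_iff)
    then show ?case by (simp add: sign_invariant_def)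
  next
    case (Suc r)
    show ?case
    proof (cases "(Suc r, R) \<in> T")
      case False
      then have "coeff (R x0) r = 0" using Suc.prems by (auto simp: T_def)
      then have z: "coeff (R x) r = 0" if "x \<in> A" for x
        using A[OF Suc.prems(1) that x0, of r] by (auto simp: sgn_if split: if_splits)
      define R' where "R' = (\<lambda>x. R x - monom (coeff (R x) r) r)"
      have "(r, R') \<in> S" using closed_fromD(1)[OF cl Suc.prems(1)] by (simp add: R'_def)
      then have "sign_invariant A \<Xi> (\<lambda>x. poly (R' x))" using Suc by simp
      then show ?thesis using z by (simp add: sign_invariant_def R'_def)
    qed (use Suc that(3) in simp)
  qed
  have "\<exists>\<Xi>. delineated A \<Xi> {(n, P) \<in> T. n \<le> N}" for N
  proof (induction N)
    case 0
    have "{(n, P) \<in> T. n \<le> 0} = {}" by (auto simp: T_def)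
    then show ?case by (intro exI[of _ "{}"]) (auto simp: delineated_def ordered_on_def)
  next
    case (Suc N)
    have "\<exists>\<Xi>. delineated A \<Xi> (B \<union> {(n, P) \<in> T. n \<le> N})" if "finite B" "B \<subseteq> {(n, P) \<in> T. n = Suc N}" for B
      using that
    proof (induction B rule: finite_induct)
      case empty
      then show ?case using Suc.IH by simp
    next
      case (insert b B)
      then obtain \<Xi> where del: "delineated A \<Xi> (B \<union> {(n, P) \<in> T. n \<le> N})" by auto
      obtain P where b: "b = (Suc N, P)" "(Suc N, P) \<in> T" using insert.prems by auto
      have P: "(Suc N, P) \<in> S" using T1 b by blast
      have low: "sign_invariant A \<Xi> (\<lambda>x. poly (R x))" if "(r, R) \<in> S" "r \<le> N" for r R
        by (rule all[OF that]) (use del in \<open>auto simp: delineated_def\<close>)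
      show ?case
      proof (cases "N = 0")
        case True
        \<comment> \<open>Bound 1 means that \<open>P x\<close> is constant in the variable, with a
          coefficient as its value.\<close>
        have "sign_invariant A \<Xi> (\<lambda>x. poly (P x))"
        proof -
          have "poly (P x) t = coeff (P x) 0" for x t
            using poly_param_sum[OF pp[OF P]] True by simp
          then show ?thesis unfolding sign_invariant_def
            by (intro ballI allI impI) (simp only:, rule A[OF P])
        qed
        then have "delineated A \<Xi> (insert (Suc N, P) (B \<union> {(n, P) \<in> T. n \<le> N}))"
          by (rule delineated_insert_invariant[OF del])
        then show ?thesis by (auto simp only: b(1) Un_insert_left)
      next
        case False
        have dS: "(N, \<lambda>x. pderiv (P x)) \<in> S" using closed_fromD(2)[OF cl P] by simp
        have dnz: "pderiv (P x) \<noteq> 0" if "x \<in> A" for x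
        proof -
          have "coeff (pderiv (P x)) (N - 1) = real N * coeff (P x) N" using False by (simp add: coeff_pderiv)
          then show ?thesis using lead[OF b(2) that] False by (metis coeff_0 diff_Suc_1 mult_eq_0_iff of_nat_eq_0_iff)
        qed
        \<comment> \<open>\<open>Q\<close> may have the same bound as \<open>P\<close>; the
          remainder nevertheless has bound at most \<open>N\<close>. The multiplier is an even power
          of a nonvanishing leading coefficient.\<close>
        have rinv: "sgn (poly (P x) (\<xi> x)) = sgn (poly (P y) (\<xi> y))"
          if "\<xi> \<in> \<Xi>" "x \<in> A" "y \<in> A" for \<xi> x y
        proof -
          obtain m Q where mQ: "(m, Q) \<in> T" "m \<le> Suc N" "\<And>x. x \<in> A \<Longrightarrow> poly (Q x) (\<xi> x) = 0"
          proof -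
            have "\<exists>(m, Q)\<in>B \<union> {(n, P) \<in> T. n \<le> N}. \<forall>x\<in>A. poly (Q x) (\<xi> x) = 0"
              using del \<open>\<xi> \<in> \<Xi>\<close> unfolding delineated_def by blast
            then obtain m Q where "(m, Q) \<in> B \<union> {(n, P) \<in> T. n \<le> N}" "\<forall>x\<in>A. poly (Q x) (\<xi> x) = 0"
              by blast
            moreover from this(1) insert.prems have "(m, Q) \<in> T" "m \<le> Suc N" by auto
            ultimately show ?thesis using that by blast
          qed
          then have "(m, Q) \<in> S" "1 \<le> m" using T1 by auto
          then obtain R where R: "(m - 1, R) \<in> S" "pseudo_rem m P Q R"
            using closed_fromD(3)[OF cl P, of m Q] \<open>m \<le> Suc N\<close> by auto
          obtain e where e: "\<And>x t. poly (Q x) t = 0 \<Longrightarrow> coeff (Q x) (m - 1) ^ (2 * e) * poly (P x) t = poly (R x) t"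
            using R(2) unfolding pseudo_rem_def by blast
          have "sgn (poly (P z) (\<xi> z)) = sgn (poly (R z) (\<xi> z))" if "z \<in> A" for z
            using e[OF mQ(3)[OF that]] sgn_mult_power_even[OF lead[OF mQ(1) that]] by metis
          moreover have "cell_eq \<Xi> x (\<xi> x) y (\<xi> y)"
            using del that unfolding delineated_def ordered_on_def cell_eq_def by blast
          moreover have "m - 1 \<le> N" using \<open>m \<le> Suc N\<close> by simp
          ultimately show ?thesis
            using low[OF R(1)] that unfolding sign_invariant_def by metis
        qed
        have "\<exists>\<Xi>'. delineated A \<Xi>' (insert (Suc N, P) (B \<union> {(n, P) \<in> T. n \<le> N}))"
          by (rule delineated_insert[OF del pp[OF P] low[OF dS order_refl] dnz rinv])
        then show ?thesis by (simp only: b(1) Un_insert_left)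
      qed
    qed
    note step = this
    obtain \<Xi> where "delineated A \<Xi> ({(n, P) \<in> T. n = Suc N} \<union> {(n, P) \<in> T. n \<le> N})"
    proof -
      have "{(n, P) \<in> T. n = Suc N} \<subseteq> S" using TS by auto
      then have "finite {(n, P) \<in> T. n = Suc N}" using fin by (rule finite_subset)
      then show ?thesis using step[OF _ order_refl] that by blast
    qed
    moreover have "{(n, P) \<in> T. n = Suc N} \<union> {(n, P) \<in> T. n \<le> N} = {(n, P) \<in> T. n \<le> Suc N}" by auto
    ultimately show ?case by auto
  qed
  moreover obtain N where N: "\<And>n P. (n, P) \<in> S \<Longrightarrow> n \<le> N"
    using finite_nat_set_iff_bounded_le[of "fst ` S"] fin by force
  ultimately obtain \<Xi> where del: "delineated A \<Xi> {(n, P) \<in> T. n \<le> N}" by blast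
  then have "sign_invariant A \<Xi> (\<lambda>x. poly (P x))" if "(n, P) \<in> S" for n P
    by (intro all[OF that N[OF that]]) (auto simp: delineated_def)
  then show ?thesis using del by (auto simp: delineated_def)
qed

lemma real_polynomial_function_imp_param_poly:
  fixes p :: "'a::euclidean_space \<times> real \<Rightarrow> real"
  assumes "real_polynomial_function p"
  shows "\<exists>n P. param_poly n P \<and> (\<forall>x t. p (x, t) = poly (P x) t)"
  using assms
proof (induction p rule: real_polynomial_function.induct)
  case (linear f)
  define P where "P = (\<lambda>x. [:f (x, 0), f (0, 1):])"
  have "bounded_linear (\<lambda>x. f (x, 0))"
    by (rule bounded_linear_compose[OF linear]) (intro bounded_linear_intros)
  then have "real_polynomial_function (\<lambda>x. coeff (P x) i)" for i
  proof (cases i)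
    case (Suc j)
    then show ?thesis by (cases j) (auto simp: P_def)
  qed (auto simp: P_def)
  then have "param_poly 2 P"
    by (auto simp: param_poly_def P_def coeff_pCons split: nat.split)
  moreover have "f (x, t) = poly (P x) t" for x t
  proof -
    have lf: "linear f" using linear by (rule bounded_linear.linear)
    have "f (x, t) = f ((x, 0) + t *\<^sub>R (0, 1))" by simp
    also have "\<dots> = f (x, 0) + t * f (0, 1)"
      by (simp only: linear_add[OF lf] linear_scale[OF lf] real_scaleR_def)
    finally show ?thesis by (simp add: P_def)
  qed
  ultimately show ?case by blast
next
  case (const c)
  show ?case
  proof (intro exI conjI allI)
    show "param_poly 1 (\<lambda>x. [:c:])"
      by (auto simp: param_poly_def coeff_pCons split: nat.split intro: real_polynomial_function.intros)
  qed simp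
next
  case (add f g)
  from add.IH obtain n P m Q where *: "param_poly n P" "\<And>x t. f (x, t) = poly (P x) t"
    "param_poly m Q" "\<And>x t. g (x, t) = poly (Q x) t" by blast
  then have "param_poly (max n m) (\<lambda>x. P x + Q x)"
    by (auto simp: param_poly_def intro: real_polynomial_function.intros)
  then show ?case using * by (metis poly_add)
next
  case (mult f g)
  from mult.IH obtain n P m Q where *: "param_poly n P" "\<And>x t. f (x, t) = poly (P x) t"
    "param_poly m Q" "\<And>x t. g (x, t) = poly (Q x) t" by blast
  have "param_poly (n + m) (\<lambda>x. P x * Q x)"
    unfolding param_poly_def
  proof (intro conjI allI impI)
    show "real_polynomial_function (\<lambda>x. coeff (P x * Q x) i)" for i
      unfolding coeff_mult using * by (intro real_polynomial_function_sum real_polynomial_function.intros(4)) (auto simp: param_poly_def)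
    show "coeff (P x * Q x) i = 0" if "n + m \<le> i" for x i
    proof -
      have "coeff (P x) j * coeff (Q x) (i - j) = 0" for j
        using * that by (cases "n \<le> j") (auto simp: param_poly_def)
      then show ?thesis unfolding coeff_mult by (simp add: sum.neutral)
    qed
  qed
  then show ?case using * by (metis poly_mult)
qed

lemma sign_classD: "y \<in> sign_class K x \<Longrightarrow> p \<in> K \<Longrightarrow> sgn (p x) = sgn (p y)"
  by (simp add: sign_class_def same_signs_def)

text \<open>\<open>K\<close> consists of the coefficients of the closed family generated by
  \<open>Q\<close>, so that they have constant signs on each sign class of \<open>K\<close>.\<close>

lemma delineation_exists:
  fixes Q :: "('a::euclidean_space \<times> real \<Rightarrow> real) set"
  assumes "finite Q" "\<forall>p\<in>Q. real_polynomial_function p"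
  shows "\<exists>K. finite K \<and> (\<forall>p\<in>K. real_polynomial_function p) \<and> (\<forall>x. \<exists>\<Xi>. ordered_on (sign_class K x) \<Xi> \<and>
      (\<forall>p\<in>Q. sign_invariant (sign_class K x) \<Xi> (\<lambda>x t. p (x, t))))"
proof -
  define r where "r = (\<lambda>p. SOME q. param_poly (fst q) (snd q) \<and> (\<forall>x t. p (x, t) = poly (snd q (x::'a)) t))"
  have r: "param_poly (fst (r p)) (snd (r p))" "p (x, t) = poly (snd (r p) x) t" if "p \<in> Q" for p x t
  proof -
    have "real_polynomial_function p" using assms(2) that by blast
    from real_polynomial_function_imp_param_poly[OF this] obtain n P
      where "param_poly n P" "\<forall>x t. p (x, t) = poly (P (x::'a)) t" by blast
    then have "\<exists>q. param_poly (fst q) (snd q) \<and> (\<forall>x t. p (x, t) = poly (snd q (x::'a)) t)"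
      by (intro exI[of _ "(n, P)"]) simp
    from someI_ex[OF this] have "param_poly (fst (r p)) (snd (r p)) \<and> (\<forall>x t. p (x, t) = poly (snd (r p) x) t)"
      unfolding r_def .
    then show "param_poly (fst (r p)) (snd (r p))" "p (x, t) = poly (snd (r p) x) t" by blast+
  qed
  have fin: "finite (r ` Q)" using assms by simp
  have pr: "param_poly n P" if "(n, P) \<in> r ` Q" for n P
  proof -
    from that obtain p where "(n, P) = r p" "p \<in> Q" by (rule imageE)
    then show ?thesis using r(1)[of p] by (simp flip: \<open>(n, P) = r p\<close>)
  qed
  obtain S where S: "r ` Q \<subseteq> S" "finite S" "\<And>n P. (n, P) \<in> S \<Longrightarrow> param_poly n P" "closed_from 1 S"
    by (rule closed_family_exists[OF fin]) (rule pr, assumption, (rule that; blast))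
  define K where "K = (\<Union>(n, P)\<in>S. (\<lambda>i x. coeff (P x) i) ` {..n})"
  show ?thesis
  proof (rule exI[of _ K], intro conjI allI)
    show "finite K" using S(2) by (auto simp: K_def)
    show "\<forall>p\<in>K. real_polynomial_function p" using S(3) by (auto simp: K_def param_poly_def)
    fix x
    have "\<exists>\<Xi>. ordered_on (sign_class K x) \<Xi> \<and> (\<forall>(n, P)\<in>S. sign_invariant (sign_class K x) \<Xi> (\<lambda>x. poly (P x)))"
    proof (rule delineation_of_closed_family[OF S(2,3,4)])
      fix n P i y z assume *: "(n, P) \<in> S" "y \<in> sign_class K x" "z \<in> sign_class K x"
      show "sgn (coeff (P y) i) = sgn (coeff (P z) i)"
      proof (cases "i \<le> n")
        case True
        then have "(\<lambda>x. coeff (P x) i) \<in> K" using *(1) by (auto simp: K_def)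
        from sign_classD[OF *(2) this] sign_classD[OF *(3) this] show ?thesis by simp
      next
        case False
        then show ?thesis using S(3)[OF *(1)] by (simp add: param_poly_def)
      qed
    qed (assumption | rule sign_class_self)+
    then obtain \<Xi> where \<Xi>: "ordered_on (sign_class K x) \<Xi>"
      "\<And>n P. (n, P) \<in> S \<Longrightarrow> sign_invariant (sign_class K x) \<Xi> (\<lambda>x. poly (P x))" by auto
    have "sign_invariant (sign_class K x) \<Xi> (\<lambda>x t. p (x, t))" if "p \<in> Q" for p
    proof -
      have "(fst (r p), snd (r p)) \<in> S" using S(1) that by auto
      from \<Xi>(2)[OF this] show ?thesis using r(2)[OF that] by (simp add: sign_invariant_def)
    qed
    then show "\<exists>\<Xi>. ordered_on (sign_class K x) \<Xi> \<and>
      (\<forall>p\<in>Q. sign_invariant (sign_class K x) \<Xi> (\<lambda>x t. p (x, t)))" using \<Xi>(1) by blast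
  qed
qed

section \<open>Projections of semialgebraic sets and piecewise continuity of semialgebraic
  functions\<close>

lemma semialgebraic_delineation:
  fixes S :: "('a::euclidean_space \<times> real) set"
  assumes "semialgebraic S"
  shows "\<exists>K. finite K \<and> (\<forall>p\<in>K. real_polynomial_function p) \<and> (\<forall>x. \<exists>\<Xi>. ordered_on (sign_class K x) \<Xi> \<and>
      (\<forall>y\<in>sign_class K x. \<forall>z\<in>sign_class K x. \<forall>s t. cell_eq \<Xi> y s z t \<longrightarrow> (y, s) \<in> S \<longrightarrow> (z, t) \<in> S))"
proof -
  obtain Q where Q: "finite Q" "\<forall>p\<in>Q. real_polynomial_function p"
     "\<forall>x y. same_signs Q x y \<longrightarrow> x \<in> S \<longrightarrow> y \<in> S"
    using semialgebraic_imp_sign_classes[OF assms] by blast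
  obtain K where K: "finite K" "\<forall>p\<in>K. real_polynomial_function p"
    "\<forall>x. \<exists>\<Xi>. ordered_on (sign_class K x) \<Xi> \<and>
      (\<forall>p\<in>Q. sign_invariant (sign_class K x) \<Xi> (\<lambda>x t. p (x, t)))"
    using delineation_exists[OF Q(1,2)] by blast
  show ?thesis
  proof (rule exI[of _ K], intro conjI K(1,2) allI)
    fix x
    obtain \<Xi> where \<Xi>: "ordered_on (sign_class K x) \<Xi>"
      "\<forall>p\<in>Q. sign_invariant (sign_class K x) \<Xi> (\<lambda>x t. p (x, t))" using spec[OF K(3), of x] by blast
    have "(z, t) \<in> S" if yz: "y \<in> sign_class K x" "z \<in> sign_class K x" and "cell_eq \<Xi> y s z t" "(y, s) \<in> S" for y z s t
    proof -
      have "same_signs Q (y, s) (z, t)"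
        unfolding same_signs_def
      proof
        fix p assume "p \<in> Q"
        then have "sign_invariant (sign_class K x) \<Xi> (\<lambda>x t. p (x, t))" using \<Xi>(2) by blast
        then show "sgn (p (y, s)) = sgn (p (z, t))" using that unfolding sign_invariant_def by blast
      qed
      then show ?thesis using Q(3) \<open>(y, s) \<in> S\<close> by blast
    qed
    then show "\<exists>\<Xi>. ordered_on (sign_class K x) \<Xi> \<and>
      (\<forall>y\<in>sign_class K x. \<forall>z\<in>sign_class K x. \<forall>s t. cell_eq \<Xi> y s z t \<longrightarrow> (y, s) \<in> S \<longrightarrow> (z, t) \<in> S)"
      using \<Xi>(1) by blast
  qed
qed

text \<open>One real quantifier is eliminated: over a sign class of \<open>K\<close> a point of
  \<open>S\<close> can be transported from one fibre to any other.\<close>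

lemma semialgebraic_fst_real:
  fixes S :: "('a::euclidean_space \<times> real) set"
  assumes "semialgebraic S" shows "semialgebraic (fst ` S)"
proof -
  obtain K where K: "finite K" "\<forall>p\<in>K. real_polynomial_function p"
    "\<forall>x. \<exists>\<Xi>. ordered_on (sign_class K x) \<Xi> \<and>
      (\<forall>y\<in>sign_class K x. \<forall>z\<in>sign_class K x. \<forall>s t. cell_eq \<Xi> y s z t \<longrightarrow> (y, s) \<in> S \<longrightarrow> (z, t) \<in> S)"
    using semialgebraic_delineation[OF assms] by blast
  show ?thesis
  proof (rule semialgebraic_if_sign_classes[OF K(1,2)])
    fix x y assume "same_signs K x y" "x \<in> fst ` S"
    then obtain s where s: "(x, s) \<in> S" and y: "y \<in> sign_class K x" by (auto simp: sign_class_def)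
    obtain \<Xi> where \<Xi>: "ordered_on (sign_class K x) \<Xi>"
      "\<forall>y\<in>sign_class K x. \<forall>z\<in>sign_class K x. \<forall>s t. cell_eq \<Xi> y s z t \<longrightarrow> (y, s) \<in> S \<longrightarrow> (z, t) \<in> S"
      using spec[OF K(3), of x] by meson
    obtain t where "cell_eq \<Xi> x s y t" using ordered_on_transport[OF \<Xi>(1) _ y, of x s] by auto
    then have "(y, t) \<in> S" using \<Xi>(2) s y by (meson sign_class_self)
    then show "y \<in> fst ` S" by force
  qed
qed

lemma semialgebraic_vimage_linear:
  "bounded_linear f \<Longrightarrow> semialgebraic S \<Longrightarrow> semialgebraic (f -` S)"
  by (rule semialgebraic_vimage_polynomial[OF polynomial_function_bounded_linear])

lemma semialgebraic_fst:
  fixes S :: "('a::euclidean_space \<times> 'b::euclidean_space) set"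
  assumes "semialgebraic S" shows "semialgebraic (fst ` S)"
proof -
  \<comment> \<open>Adding arbitrary multiples of the vectors in \<open>B\<close> projects out these
    coordinates without changing the type, so real coordinates are eliminated one by one.\<close>
  have step: "semialgebraic {(x, y). \<exists>c. (x, y + (\<Sum>b\<in>B. c b *\<^sub>R b)) \<in> S}" if "finite B" for B :: "'b set"
    using that
  proof (induction B rule: finite_induct)
    case empty
    then show ?case using assms by simp
  next
    case (insert b B)
    let ?T = "{(x, y). \<exists>c. (x, y + (\<Sum>b\<in>B. c b *\<^sub>R b)) \<in> S}"
    let ?f = "\<lambda>z :: ('a \<times> 'b) \<times> real. (fst (fst z), snd (fst z) + snd z *\<^sub>R b)"
    have "semialgebraic (fst ` (?f -` ?T))"
      by (intro semialgebraic_fst_real semialgebraic_vimage_linear[OF _ insert.IH] bounded_linear_intros)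
    moreover have "fst ` (?f -` ?T) = {(x, y). \<exists>c. (x, y + (\<Sum>b\<in>insert b B. c b *\<^sub>R b)) \<in> S}"
    proof (rule set_eqI, rule iffI)
      fix w assume "w \<in> fst ` (?f -` ?T)"
      then obtain x y t c where w: "w = (x, y)" and c: "(x, y + t *\<^sub>R b + (\<Sum>b\<in>B. c b *\<^sub>R b)) \<in> S" by auto
      have "(\<Sum>v\<in>B. (if v = b then t else c v) *\<^sub>R v) = (\<Sum>v\<in>B. c v *\<^sub>R v)"
        by (rule sum.cong) (use insert in auto)
      then have "(x, y + (\<Sum>v\<in>insert b B. (if v = b then t else c v) *\<^sub>R v)) \<in> S"
        using c insert.hyps by (simp add: add.assoc)
      then show "w \<in> {(x, y). \<exists>c. (x, y + (\<Sum>b\<in>insert b B. c b *\<^sub>R b)) \<in> S}"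
        unfolding w mem_Collect_eq case_prod_conv by (rule exI[of _ "\<lambda>v. if v = b then t else c v"])
    next
      fix w assume "w \<in> {(x, y). \<exists>c. (x, y + (\<Sum>b\<in>insert b B. c b *\<^sub>R b)) \<in> S}"
      then obtain x y c where w: "w = (x, y)" and "(x, y + (\<Sum>b\<in>insert b B. c b *\<^sub>R b)) \<in> S" by blast
      then have "((x, y), c b) \<in> ?f -` ?T" using insert.hyps by (auto simp: add.assoc)
      then show "w \<in> fst ` (?f -` ?T)" by (rule rev_image_eqI) (simp add: w)
    qed
    ultimately show ?case by simp
  qed
  \<comment> \<open>Once all of \<open>Basis\<close> is projected out, the second component is
    arbitrary and can be set to 0.\<close>
  have lin: "bounded_linear (\<lambda>x::'a. (x, 0::'b))" by (intro bounded_linear_intros)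
  from semialgebraic_vimage_linear[OF lin step[OF finite_Basis]]
  have "semialgebraic {x. \<exists>c. (x, \<Sum>b\<in>Basis. c b *\<^sub>R b) \<in> S}"
    by (simp add: vimage_def)
  moreover have "{x. \<exists>c. (x, \<Sum>b\<in>Basis. c b *\<^sub>R b) \<in> S} = fst ` S"
  proof (intro set_eqI iffI)
    fix x assume "x \<in> fst ` S"
    then obtain y where "(x, y) \<in> S" by auto
    then show "x \<in> {x. \<exists>c. (x, \<Sum>b\<in>Basis. c b *\<^sub>R b) \<in> S}"
      using euclidean_representation[of y] by (auto intro!: exI[of _ "\<lambda>b. y \<bullet> b"])
  qed force
  ultimately show ?thesis by simp
qed

text \<open>The value \<open>f x\<close> lies on a section, since otherwise the graph would contain
  a vertical interval; by invariance \<open>f\<close> then agrees with that section on the whole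
  sign class. Here the continuity of the roots pays off.\<close>

lemma semialgebraic_function_pieces:
  fixes f :: "'a::euclidean_space \<Rightarrow> real"
  assumes "semialgebraic_map_on T f"
  obtains K where "finite K" "\<forall>p\<in>K. real_polynomial_function p"
    "\<And>x. x \<in> T \<Longrightarrow> sign_class K x \<subseteq> T \<and> continuous_on (sign_class K x) f"
proof -
  define S where "S = (\<lambda>x. (x, f x)) ` T"
  obtain K where K: "finite K" "\<forall>p\<in>K. real_polynomial_function p"
    "\<forall>x. \<exists>\<Xi>. ordered_on (sign_class K x) \<Xi> \<and>
      (\<forall>y\<in>sign_class K x. \<forall>z\<in>sign_class K x. \<forall>s t. cell_eq \<Xi> y s z t \<longrightarrow> (y, s) \<in> S \<longrightarrow> (z, t) \<in> S)"
    using semialgebraic_delineation[OF assms[unfolded semialgebraic_map_on_def, folded S_def]] by blast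
  show ?thesis
  proof (rule that[OF K(1,2)])
    fix x assume "x \<in> T"
    obtain \<Xi> where \<Xi>: "ordered_on (sign_class K x) \<Xi>"
      "\<And>y z s t. y \<in> sign_class K x \<Longrightarrow> z \<in> sign_class K x \<Longrightarrow> cell_eq \<Xi> y s z t \<Longrightarrow> (y, s) \<in> S \<Longrightarrow> (z, t) \<in> S"
      using spec[OF K(3), of x] by meson
    have xS: "(x, f x) \<in> S" using \<open>x \<in> T\<close> by (simp add: S_def)
    have "\<exists>\<xi>\<in>\<Xi>. f x = \<xi> x"
    proof (rule ccontr)
      assume "\<not> ?thesis"
      then obtain e where e: "e > 0" "\<And>s'. \<bar>s' - f x\<bar> < e \<Longrightarrow> cell_eq \<Xi> x (f x) x s'"
        using cell_eq_nearby[of \<Xi> "f x" x] \<Xi>(1) unfolding ordered_on_def by blast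
      have "cell_eq \<Xi> x (f x) x (f x + e / 2)" using e by auto
      then have "(x, f x + e / 2) \<in> S" using \<Xi>(2) xS sign_class_self by metis
      then show False using e(1) by (auto simp: S_def)
    qed
    then obtain \<xi> where \<xi>: "\<xi> \<in> \<Xi>" "f x = \<xi> x" by blast
    have "y \<in> T \<and> f y = \<xi> y" if "y \<in> sign_class K x" for y
    proof -
      have "cell_eq \<Xi> x (f x) y (\<xi> y)"
        using \<Xi>(1) \<xi> that unfolding cell_eq_def ordered_on_def by (metis sign_class_self)
      then have "(y, \<xi> y) \<in> S" using \<Xi>(2) xS that sign_class_self by metis
      then show ?thesis by (auto simp: S_def)
    qed
    moreover have "continuous_on (sign_class K x) \<xi>" using \<Xi>(1) \<xi>(1) by (simp add: ordered_on_def)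
    ultimately show "sign_class K x \<subseteq> T \<and> continuous_on (sign_class K x) f"
      by (auto cong: continuous_on_cong)
  qed
qed

subsection \<open>Closure properties\<close>

lemma semialgebraic_Collect_not: "semialgebraic {x. P x} \<Longrightarrow> semialgebraic {x. \<not> P x}"
  using semialgebraic.compl by (simp add: Collect_neg_eq)

lemma semialgebraic_Collect_conj:
  "semialgebraic {x. P x} \<Longrightarrow> semialgebraic {x. Q x} \<Longrightarrow> semialgebraic {x. P x \<and> Q x}"
  using semialgebraic_Int by (simp add: Collect_conj_eq)

lemma semialgebraic_Collect_imp:
  "semialgebraic {x. P x} \<Longrightarrow> semialgebraic {x. Q x} \<Longrightarrow> semialgebraic {x. P x \<longrightarrow> Q x}"
  using semialgebraic.union[OF semialgebraic_Collect_not] by (simp add: Collect_imp_eq Collect_neg_eq)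

lemma semialgebraic_Collect_ex:
  fixes P :: "'a::euclidean_space \<Rightarrow> 'b::euclidean_space \<Rightarrow> bool"
  assumes "semialgebraic {z. P (fst z) (snd z)}" shows "semialgebraic {x. \<exists>y. P x y}"
proof -
  have "{x. \<exists>y. P x y} = fst ` {z. P (fst z) (snd z)}"
    by (auto simp: image_def)
  then show ?thesis using semialgebraic_fst[OF assms] by simp
qed

lemma semialgebraic_Collect_all:
  fixes P :: "'a::euclidean_space \<Rightarrow> 'b::euclidean_space \<Rightarrow> bool"
  assumes "semialgebraic {z. P (fst z) (snd z)}" shows "semialgebraic {x. \<forall>y. P x y}"
  using semialgebraic_Collect_not[OF semialgebraic_Collect_ex[OF semialgebraic_Collect_not[OF assms]]] by simp

lemma semialgebraic_Collect_mem:
  "bounded_linear f \<Longrightarrow> semialgebraic S \<Longrightarrow> semialgebraic {x. f x \<in> S}"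
  using semialgebraic_vimage_linear by (auto simp: vimage_def)

lemma semialgebraic_Collect_le:
  assumes "real_polynomial_function p" "real_polynomial_function q"
  shows "semialgebraic {x. p x \<le> q x}"
proof -
  have "{x. p x \<le> q x} = - {x. p x - q x > 0}" by auto
  then show ?thesis using assms by (metis real_polynomial_function_diff semialgebraic.compl semialgebraic.pos)
qed

lemma semialgebraic_Collect_eq:
  fixes f :: "'a::euclidean_space \<Rightarrow> 'b::euclidean_space"
  assumes "polynomial_function f" "polynomial_function g"
  shows "semialgebraic {x. f x = g x}"
proof -
  have "{x. f x = g x} = \<Inter> ((\<lambda>b. {x. (f x - g x) \<bullet> b = 0}) ` Basis)"
    by (auto simp: euclidean_eq_iff[of "f _"] inner_diff_left)
  moreover have "semialgebraic {x. (f x - g x) \<bullet> b = 0}" if "b \<in> Basis" for b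
    using polynomial_function_diff[OF assms] that
    by (intro semialgebraic_zero) (simp add: polynomial_function_iff_Basis_inner)
  ultimately show ?thesis by (auto intro!: semialgebraic_Inter)
qed

lemma semialgebraic_Collect_eq_linear:
  fixes f :: "'a::euclidean_space \<Rightarrow> 'b::euclidean_space"
  shows "bounded_linear f \<Longrightarrow> bounded_linear g \<Longrightarrow> semialgebraic {x. f x = g x}"
  by (intro semialgebraic_Collect_eq polynomial_function_bounded_linear)

lemma semialgebraic_linear_image:
  fixes f :: "'a::euclidean_space \<Rightarrow> 'b::euclidean_space"
  assumes "bounded_linear f" "semialgebraic S" shows "semialgebraic (f ` S)"
proof -
  have "semialgebraic {y. \<exists>x. x \<in> S \<and> y = f x}"
    by (intro semialgebraic_Collect_ex semialgebraic_Collect_conj semialgebraic_Collect_mem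
        semialgebraic_Collect_eq_linear assms bounded_linear_intros bounded_linear_compose[OF assms(1)])
  moreover have "{y. \<exists>x. x \<in> S \<and> y = f x} = f ` S" by auto
  ultimately show ?thesis by simp
qed

lemma semialgebraic_cball: "semialgebraic (cball (0::'a::euclidean_space) r)"
proof (cases "r \<ge> 0")
  case True
  have "cball (0::'a) r = {x. x \<bullet> x \<le> r\<^sup>2}"
    using True by (auto simp: norm_le_square)
  moreover have "real_polynomial_function (\<lambda>x::'a. \<Sum>b\<in>Basis. (x \<bullet> b) * (x \<bullet> b))"
    by (intro real_polynomial_function_sum real_polynomial_function.intros(1,4) bounded_linear_inner_left) simp
  then have "real_polynomial_function (\<lambda>x::'a. x \<bullet> x)"
    by (simp add: euclidean_inner[symmetric])
  ultimately show ?thesis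
    by (auto intro!: semialgebraic_Collect_le)
qed (simp add: cball_empty)

lemma semialgebraic_map_onD: "semialgebraic_map_on A f \<Longrightarrow> semialgebraic ((\<lambda>x. (x, f x)) ` A)"
  by (simp add: semialgebraic_map_on_def)

lemma semialgebraic_map_on_cong:
  "semialgebraic_map_on A f \<Longrightarrow> (\<And>x. x \<in> A \<Longrightarrow> g x = f x) \<Longrightarrow> semialgebraic_map_on A g"
  unfolding semialgebraic_map_on_def by (metis (no_types, lifting) image_cong)

lemma semialgebraic_map_on_dom:
  assumes "semialgebraic_map_on A f" shows "semialgebraic A"
  using semialgebraic_fst[OF semialgebraic_map_onD[OF assms]] by (simp add: image_image)

lemma semialgebraic_map_on_subset:
  assumes "semialgebraic_map_on A f" "semialgebraic B" "B \<subseteq> A"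
  shows "semialgebraic_map_on B f"
proof -
  have "(\<lambda>x. (x, f x)) ` B = (\<lambda>x. (x, f x)) ` A \<inter> {z. fst z \<in> B}" using assms(3) by auto
  then show ?thesis unfolding semialgebraic_map_on_def
    using assms by (simp add: semialgebraic_Int semialgebraic_map_onD semialgebraic_Collect_mem bounded_linear_fst)
qed

lemma semialgebraic_map_on_linear:
  assumes "bounded_linear f" "semialgebraic A" shows "semialgebraic_map_on A f"
  unfolding semialgebraic_map_on_def
  by (intro semialgebraic_linear_image assms bounded_linear_intros)

lemma semialgebraic_map_on_comp:
  assumes "semialgebraic_map_on A f" "semialgebraic_map_on B g" "f ` A \<subseteq> B"
  shows "semialgebraic_map_on A (\<lambda>x. g (f x))"
proof -
  have "(\<lambda>x. (x, g (f x))) ` A =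
     {z. \<exists>y. (fst z, y) \<in> (\<lambda>x. (x, f x)) ` A \<and> (y, snd z) \<in> (\<lambda>x. (x, g x)) ` B}"
    using assms(3) by (auto simp: image_iff)
  moreover have "semialgebraic \<dots>"
    by (intro semialgebraic_Collect_ex semialgebraic_Collect_conj semialgebraic_Collect_mem
      semialgebraic_map_onD assms bounded_linear_intros)
  ultimately show ?thesis by (simp add: semialgebraic_map_on_def)
qed

lemma semialgebraic_map_on_Pair:
  assumes "semialgebraic_map_on A f" "semialgebraic_map_on A g"
  shows "semialgebraic_map_on A (\<lambda>x. (f x, g x))"
proof -
  have "(\<lambda>x. (x, f x, g x)) ` A =
     {z. (fst z, fst (snd z)) \<in> (\<lambda>x. (x, f x)) ` A \<and> (fst z, snd (snd z)) \<in> (\<lambda>x. (x, g x)) ` A}"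
    by (auto simp: image_iff)
  moreover have "semialgebraic \<dots>"
    by (intro semialgebraic_Collect_conj semialgebraic_Collect_mem
      semialgebraic_map_onD assms bounded_linear_intros)
  ultimately show ?thesis by (simp add: semialgebraic_map_on_def)
qed

lemma semialgebraic_map_on_image:
  assumes "semialgebraic_map_on A f" shows "semialgebraic (f ` A)"
  using semialgebraic_linear_image[OF bounded_linear_snd semialgebraic_map_onD[OF assms]]
  by (simp add: image_image)

lemma semialgebraic_map_on_linear_comp:
  assumes "semialgebraic_map_on A f" "bounded_linear l"
  shows "semialgebraic_map_on A (\<lambda>x. l (f x))"
  by (rule semialgebraic_map_on_comp[OF assms(1) semialgebraic_map_on_linear[OF assms(2) semialgebraic_UNIV]]) simp

lemma semialgebraic_map_on_descend:
  assumes "semialgebraic_map_on A f" "semialgebraic_map_on A g" "\<And>x. x \<in> A \<Longrightarrow> h (f x) = g x"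
  shows "semialgebraic_map_on (f ` A) h"
proof -
  have "(\<lambda>y. (y, h y)) ` f ` A = (\<lambda>x. (f x, g x)) ` A"
    using assms(3) by (auto simp: image_iff)
  then show ?thesis unfolding semialgebraic_map_on_def
    using semialgebraic_map_on_image[OF semialgebraic_map_on_Pair[OF assms(1,2)]] by simp
qed

lemma semialgebraic_map_on_inverse:
  assumes "semialgebraic_map_on A f" "\<And>x. x \<in> A \<Longrightarrow> g (f x) = x"
  shows "semialgebraic_map_on (f ` A) g"
  using semialgebraic_map_on_descend[OF assms(1), of "\<lambda>x. x" g]
    semialgebraic_map_on_linear[OF bounded_linear_ident semialgebraic_map_on_dom[OF assms(1)]] assms(2) by blast

subsection \<open>Polynomials on subspaces\<close>

lemma real_polynomial_function_on_line:
  fixes p :: "'a::euclidean_space \<Rightarrow> real"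
  assumes "real_polynomial_function p"
  shows "\<exists>q. \<forall>t. p (x + t *\<^sub>R v) = poly q t"
proof -
  have "polynomial_function (\<lambda>t::real. x + t *\<^sub>R v)"
    by (rule polynomial_function_add[OF polynomial_function_const polynomial_function_bounded_linear])
      (intro bounded_linear_intros)
  then have "real_polynomial_function (p \<circ> (\<lambda>t. x + t *\<^sub>R v))"
    using assms by blast
  then obtain a n where *: "p \<circ> (\<lambda>t. x + t *\<^sub>R v) = (\<lambda>t. \<Sum>i\<le>n. a i * t ^ i)"
    using real_polynomial_function_imp_sum by blast
  have "p (x + t *\<^sub>R v) = poly (\<Sum>i\<le>n. monom (a i) i) t" for t
    using fun_cong[OF *, of t] by (simp add: poly_sum poly_monom)
  then show ?thesis by blast
qed

text \<open>A witness \<open>w\<close> for the old members and a witness \<open>v\<close> for the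
  new one are joined by a line in \<open>W\<close>. Every member restricts to a nonzero univariate
  polynomial on it, and finitely many roots cannot fill the line.\<close>

lemma common_nonzero_on_subspace:
  fixes W :: "'a::euclidean_space set"
  assumes "finite Q" "subspace W" "\<And>p. p \<in> Q \<Longrightarrow> real_polynomial_function p"
    "\<And>p. p \<in> Q \<Longrightarrow> \<exists>w\<in>W. p w \<noteq> 0"
  shows "\<exists>w\<in>W. \<forall>p\<in>Q. p w \<noteq> 0"
  using assms(1,3,4)
proof (induction Q rule: finite_induct)
  case empty
  then show ?case using subspace_0[OF assms(2)] by auto
next
  case (insert p Q)
  then obtain w v where w: "w \<in> W" "\<And>q. q \<in> Q \<Longrightarrow> q w \<noteq> 0" and v: "v \<in> W" "p v \<noteq> 0"
    by (metis insertCI)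
  have "\<forall>q\<in>insert p Q. \<exists>r. \<forall>t. q (w + t *\<^sub>R (v - w)) = poly r t"
    using real_polynomial_function_on_line insert.prems(1) by blast
  then obtain r where r: "\<And>q t. q \<in> insert p Q \<Longrightarrow> q (w + t *\<^sub>R (v - w)) = poly (r q) t"
    by metis
  have "r q \<noteq> 0" if "q \<in> insert p Q" for q
  proof (cases "q \<in> Q")
    case True
    then show ?thesis using r[OF that, of 0] w by auto
  next
    case False
    then show ?thesis using r[OF that, of 1] v that by auto
  qed
  then have "finite (\<Union>q\<in>insert p Q. {t. poly (r q) t = 0})"
    using insert.hyps(1) poly_roots_finite by blast
  then obtain t where "t \<notin> (\<Union>q\<in>insert p Q. {t. poly (r q) t = 0})"
    using ex_new_if_finite[OF infinite_UNIV_char_0] by blast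
  then have "\<forall>q\<in>insert p Q. q (w + t *\<^sub>R (v - w)) \<noteq> 0" using r by auto
  moreover have "w + t *\<^sub>R (v - w) \<in> W"
    using assms(2) w(1) v(1) by (simp add: subspace_add subspace_diff subspace_scale)
  ultimately show ?case by blast
qed

section \<open>Hypersurfaces versus open pieces of a subspace\<close>

text \<open>The polynomial must be nontrivial on \<open>W\<close>, not just on the whole space, so
  this means lying in a hypersurface of \<open>W\<close>. It is the notion of a negligible set used
  throughout.\<close>

definition thin_in :: "'a::euclidean_space set \<Rightarrow> 'a set \<Rightarrow> bool" where
  "thin_in W T \<longleftrightarrow> (\<exists>p. real_polynomial_function p \<and> (\<exists>w\<in>W. p w \<noteq> 0) \<and> (\<forall>x\<in>T. p x = 0))"

lemma thin_in_subset: "thin_in W T \<Longrightarrow> S \<subseteq> T \<Longrightarrow> thin_in W S"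
  unfolding thin_in_def by blast

lemma thin_in_Union:
  fixes W :: "'a::euclidean_space set"
  assumes "finite \<C>" "subspace W" "\<And>C. C \<in> \<C> \<Longrightarrow> thin_in W C"
  shows "thin_in W (\<Union>\<C>)"
proof -
  have "\<forall>C\<in>\<C>. \<exists>p. real_polynomial_function p \<and> (\<exists>w\<in>W. p w \<noteq> 0) \<and> (\<forall>x\<in>C. p x = 0)"
    using assms(3) by (auto simp: thin_in_def)
  then obtain p where p: "\<And>C. C \<in> \<C> \<Longrightarrow> real_polynomial_function (p C)"
    "\<And>C. C \<in> \<C> \<Longrightarrow> \<exists>w\<in>W. p C w \<noteq> 0" "\<And>C x. C \<in> \<C> \<Longrightarrow> x \<in> C \<Longrightarrow> p C x = 0"
    by metis
  obtain w where w: "w \<in> W" "\<forall>q\<in>p ` \<C>. q w \<noteq> 0"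
    using common_nonzero_on_subspace[of "p ` \<C>" W] assms(1,2) p by auto
  show ?thesis
    unfolding thin_in_def
  proof (intro exI conjI)
    show "real_polynomial_function (\<lambda>x. \<Prod>C\<in>\<C>. p C x)" by (intro real_polynomial_function_prod assms(1) p(1))
    show "\<exists>w\<in>W. (\<Prod>C\<in>\<C>. p C w) \<noteq> 0" using w assms(1) by auto
    show "\<forall>x\<in>\<Union>\<C>. (\<Prod>C\<in>\<C>. p C x) = 0" using assms(1) p(3) by auto
  qed
qed

text \<open>Some point of \<open>T\<close> is a zero of none of the polynomials that are nontrivial
  on \<open>W\<close>, as otherwise their zero sets would cover \<open>T\<close>. Near that point
  the signs of these polynomials are constant, and the other polynomials vanish on all of
  \<open>W\<close>.\<close>

lemma semialgebraic_thin_or_open: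
  fixes W :: "'a::euclidean_space set"
  assumes "semialgebraic T" "T \<subseteq> W" "subspace W" "\<not> thin_in W T"
  obtains c r where "c \<in> W" "r > 0" "W \<inter> ball c r \<subseteq> T"
proof -
  obtain Q where Q: "finite Q" "\<forall>p\<in>Q. real_polynomial_function p"
     "\<forall>x y. same_signs Q x y \<longrightarrow> x \<in> T \<longrightarrow> y \<in> T"
    using semialgebraic_imp_sign_classes[OF assms(1)] by blast
  define Q' where "Q' = {p \<in> Q. \<exists>w\<in>W. p w \<noteq> 0}"
  have fQ': "finite Q'" using Q(1) by (simp add: Q'_def)
  obtain c where c: "c \<in> T" "\<forall>p\<in>Q'. p c \<noteq> 0"
  proof (rule ccontr)
    assume "\<not> thesis"
    then have "T \<subseteq> \<Union>((\<lambda>p. {x. p x = 0}) ` Q')" using that by blast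
    moreover have "thin_in W (\<Union>((\<lambda>p. {x. p x = 0}) ` Q'))"
      by (rule thin_in_Union) (use fQ' assms(3) Q(2) in \<open>auto simp: Q'_def thin_in_def\<close>)
    ultimately show False using thin_in_subset assms(4) by blast
  qed
  have "\<forall>\<^sub>F y in nhds c. \<forall>p\<in>Q'. sgn (p c) = sgn (p y)"
  proof (rule eventually_ball_finite[OF fQ'], rule ballI)
    fix p assume p: "p \<in> Q'"
    then have "isCont p c"
      using Q(2) continuous_real_polynomial_function[of p UNIV] by (auto simp: Q'_def continuous_on_eq_continuous_at)
    then have t: "(p \<longlongrightarrow> p c) (nhds c)" by (simp add: isCont_def tendsto_at_iff_tendsto_nhds)
    consider "p c > 0" | "p c < 0" using c(2) p by force
    then show "\<forall>\<^sub>F y in nhds c. sgn (p c) = sgn (p y)"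
    proof cases
      case 1
      then show ?thesis using order_tendstoD(1)[OF t 1] by (auto elim!: eventually_mono)
    next
      case 2
      then show ?thesis using order_tendstoD(2)[OF t 2] by (auto elim!: eventually_mono)
    qed
  qed
  then obtain r where r: "r > 0" "\<And>y. dist y c < r \<Longrightarrow> \<forall>p\<in>Q'. sgn (p c) = sgn (p y)"
    by (auto simp: eventually_nhds_metric)
  have "y \<in> T" if "y \<in> W \<inter> ball c r" for y
  proof -
    have "sgn (p c) = sgn (p y)" if "p \<in> Q" for p
    proof (cases "p \<in> Q'")
      case True
      then show ?thesis using r(2)[of y] \<open>y \<in> W \<inter> ball c r\<close> by (auto simp: dist_commute)
    next
      case False
      then have "p c = 0" "p y = 0" using that \<open>y \<in> W \<inter> ball c r\<close> c(1) assms(2) by (auto simp: Q'_def)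
      then show ?thesis by simp
    qed
    then show ?thesis using Q(3) c(1) by (auto simp: same_signs_def)
  qed
  then show ?thesis using that[of c r] c(1) assms(2) r(1) by blast
qed

subsection \<open>Cells from coordinate projections\<close>

definition coord_space :: "'a::euclidean_space set \<Rightarrow> 'a set" where
  "coord_space I = {x. \<forall>i\<in>Basis. i \<notin> I \<longrightarrow> x \<bullet> i = 0}"

definition coord_proj :: "'a::euclidean_space set \<Rightarrow> 'a \<Rightarrow> 'a" where
  "coord_proj I x = (\<Sum>b\<in>I. (x \<bullet> b) *\<^sub>R b)"

lemma subspace_coord_space: "subspace (coord_space I)"
  unfolding coord_space_def by (rule subspace_substandard)

lemma dim_coord_space: "I \<subseteq> Basis \<Longrightarrow> dim (coord_space I) = card I"
  unfolding coord_space_def by (rule dim_substandard)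

lemma semialgebraic_coord_space: "semialgebraic (coord_space I)"
proof -
  have "coord_space I = \<Inter>((\<lambda>i. {x. x \<bullet> i = 0}) ` (Basis - I))"
    by (auto simp: coord_space_def)
  moreover have "semialgebraic {x. x \<bullet> i = 0}" for i :: 'a
    by (intro semialgebraic_zero real_polynomial_function.intros(1) bounded_linear_inner_left)
  ultimately show ?thesis by (auto intro!: semialgebraic_Inter)
qed

lemma bounded_linear_coord_proj: "bounded_linear (coord_proj I)"
proof -
  have "linear (coord_proj I)"
    unfolding coord_proj_def
    by (rule linearI) (simp_all add: inner_add_left scaleR_add_left sum.distrib scaleR_sum_right)
  then show ?thesis by (simp add: linear_conv_bounded_linear)
qed

lemma coord_proj_inner:
  assumes "I \<subseteq> Basis" "b \<in> Basis"
  shows "coord_proj I x \<bullet> b = (if b \<in> I then x \<bullet> b else 0)"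
proof -
  have "finite I" by (rule finite_subset[OF assms(1) finite_Basis])
  have "coord_proj I x \<bullet> b = (\<Sum>c\<in>I. if c = b then x \<bullet> b else 0)"
    unfolding coord_proj_def inner_sum_left
    by (rule sum.cong) (use assms in \<open>auto simp: inner_Basis\<close>)
  then show ?thesis using \<open>finite I\<close> by simp
qed

lemma coord_proj_in: "I \<subseteq> Basis \<Longrightarrow> coord_proj I x \<in> coord_space I"
  by (simp add: coord_space_def coord_proj_inner)

lemma real_polynomial_function_inner_self: "real_polynomial_function (\<lambda>x::'a::euclidean_space. x \<bullet> x)"
proof -
  have "real_polynomial_function (\<lambda>x::'a. \<Sum>b\<in>Basis. (x \<bullet> b) * (x \<bullet> b))"
    by (intro real_polynomial_function_sum real_polynomial_function.intros(1,4) bounded_linear_inner_left) simp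
  then show ?thesis by (simp add: euclidean_inner[symmetric])
qed

lemma real_polynomial_function_comp:
  assumes "polynomial_function f" "real_polynomial_function p"
  shows "real_polynomial_function (\<lambda>x. p (f x))"
  using real_polynomial_function_compose[OF assms] by (simp add: o_def)

lemma semialgebraic_ball: "semialgebraic (ball c r)"
proof (cases "r > 0")
  case True
  have *: "real_polynomial_function (\<lambda>x. r\<^sup>2 - (x - c) \<bullet> (x - c))"
    by (intro real_polynomial_function_diff real_polynomial_function.intros(2)
      real_polynomial_function_comp[OF _ real_polynomial_function_inner_self]
      polynomial_function_diff polynomial_function_id polynomial_function_const)
  have "ball c r = {x. r\<^sup>2 - (x - c) \<bullet> (x - c) > 0}"
    using True by (auto simp: dist_norm norm_lt_square norm_minus_commute)
  then show ?thesis using semialgebraic.pos[OF *] by simp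
next
  case False
  then have "ball c r = {}" by (simp only: ball_eq_empty not_less)
  show ?thesis unfolding \<open>ball c r = {}\<close> by simp
qed

text \<open>The map that wraps a whole subspace onto a ball. The norm is not polynomial and is
  expressed as the nonnegative \<open>s\<close> with \<open>s * s = v \<bullet> v\<close>,
  quantified existentially.\<close>

lemma semialgebraic_ball_chart:
  fixes f :: "'a::euclidean_space \<Rightarrow> 'b::euclidean_space"
  assumes "bounded_linear f" "semialgebraic V"
  shows "semialgebraic_map_on V (\<lambda>v. c + (r / (1 + norm v)) *\<^sub>R f v)"
proof -
  have "(\<lambda>v. (v, c + (r / (1 + norm v)) *\<^sub>R f v)) ` V =
     {z. fst z \<in> V \<and> (\<exists>s::real. 0 \<le> s \<and> s * s = fst z \<bullet> fst z \<and> (1 + s) *\<^sub>R (snd z - c) = r *\<^sub>R f (fst z))}"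
  proof (intro set_eqI iffI)
    fix z assume "z \<in> (\<lambda>v. (v, c + (r / (1 + norm v)) *\<^sub>R f v)) ` V"
    then obtain v where v: "v \<in> V" "z = (v, c + (r / (1 + norm v)) *\<^sub>R f v)" by blast
    have "1 + norm v \<noteq> 0" using norm_ge_zero[of v] by linarith
    then have "(1 + norm v) *\<^sub>R (snd z - c) = r *\<^sub>R f (fst z)" by (simp add: v)
    moreover have "norm v * norm v = fst z \<bullet> fst z" by (simp add: v dot_square_norm power2_eq_square)
    ultimately show "z \<in> {z. fst z \<in> V \<and> (\<exists>s::real. 0 \<le> s \<and> s * s = fst z \<bullet> fst z \<and> (1 + s) *\<^sub>R (snd z - c) = r *\<^sub>R f (fst z))}"
      using v(1) by (intro CollectI conjI exI[of _ "norm v"]) (simp_all add: v(2))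
  next
    fix z assume "z \<in> {z. fst z \<in> V \<and> (\<exists>s::real. 0 \<le> s \<and> s * s = fst z \<bullet> fst z \<and> (1 + s) *\<^sub>R (snd z - c) = r *\<^sub>R f (fst z))}"
    then obtain s where s: "fst z \<in> V" "0 \<le> s" "s * s = fst z \<bullet> fst z" "(1 + s) *\<^sub>R (snd z - c) = r *\<^sub>R f (fst z)"
      by blast
    have "s = norm (fst z)"
    proof -
      have "s\<^sup>2 = (norm (fst z))\<^sup>2" using s(3) by (simp add: power2_norm_eq_inner power2_eq_square[of s])
      then show ?thesis using s(2) by (simp add: power2_eq_iff_nonneg)
    qed
    moreover have "(1 / (1 + s)) *\<^sub>R ((1 + s) *\<^sub>R (snd z - c)) = (1 / (1 + s)) *\<^sub>R (r *\<^sub>R f (fst z))"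
      using s(4) by simp
    ultimately have "snd z - c = (r / (1 + norm (fst z))) *\<^sub>R f (fst z)"
      using s(2) by simp
    then have "z = (fst z, c + (r / (1 + norm (fst z))) *\<^sub>R f (fst z))"
      by (simp add: prod_eq_iff algebra_simps)
    then show "z \<in> (\<lambda>v. (v, c + (r / (1 + norm v)) *\<^sub>R f v)) ` V" using s(1) by blast
  qed
  moreover have "semialgebraic \<dots>"
  proof -
    let ?s = "\<lambda>w :: ('a \<times> 'b) \<times> real. snd w" and ?v = "\<lambda>w :: ('a \<times> 'b) \<times> real. fst (fst w)"
      and ?w = "\<lambda>w :: ('a \<times> 'b) \<times> real. snd (fst w)"
    have lin: "bounded_linear ?s" "bounded_linear ?v" "bounded_linear ?w" "bounded_linear (\<lambda>w. f (?v w))"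
      by (intro bounded_linear_intros bounded_linear_compose[OF assms(1)])+
    have pf: "polynomial_function ?s" "polynomial_function ?v" "polynomial_function ?w"
        "polynomial_function (\<lambda>w. f (?v w))"
      by (rule polynomial_function_bounded_linear, rule lin)+
    have rp: "real_polynomial_function ?s" using lin(1) by (rule real_polynomial_function.intros(1))
    have "semialgebraic {w. 0 \<le> ?s w}"
      by (rule semialgebraic_Collect_le[OF real_polynomial_function.intros(2) rp])
    moreover have "semialgebraic {w. ?s w * ?s w = ?v w \<bullet> ?v w}"
      by (rule semialgebraic_Collect_eq) (simp_all flip: real_polynomial_function_eq
        add: rp real_polynomial_function.intros(4) real_polynomial_function_comp[OF pf(2) real_polynomial_function_inner_self])
    moreover have "semialgebraic {w. (1 + ?s w) *\<^sub>R (?w w - c) = r *\<^sub>R f (?v w)}"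
      by (rule semialgebraic_Collect_eq[OF polynomial_function_mult[OF
        polynomial_function_add[OF polynomial_function_const pf(1)] polynomial_function_diff[OF pf(3) polynomial_function_const]]
        polynomial_function_cmul[OF pf(4)]])
    ultimately have "semialgebraic {z. \<exists>s::real. 0 \<le> s \<and> s * s = fst z \<bullet> fst z \<and> (1 + s) *\<^sub>R (snd z - c) = r *\<^sub>R f (fst z)}"
      by (intro semialgebraic_Collect_ex semialgebraic_Collect_conj)
    then show ?thesis
      by (rule semialgebraic_Collect_conj[OF semialgebraic_Collect_mem[OF bounded_linear_fst assms(2)]])
  qed
  ultimately show ?thesis by (simp add: semialgebraic_map_on_def)
qed

text \<open>Cells are defined through subspaces of the type of \<open>X\<close>, while a chart lives
  on a ball in a subspace of some other type. Invariance of dimension gives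
  \<open>dim W \<le> DIM('a)\<close>, so a subspace \<open>V\<close> of the right type exists; an
  isometry and a radial rescaling identify it with the ball.\<close>

lemma contains_cell_from_chart:
  fixes W :: "'c::euclidean_space set" and X :: "'a::euclidean_space set"
  assumes W: "subspace W" "c \<in> W" "r > 0"
    and cont: "continuous_on (W \<inter> ball c r) \<sigma>" and sa: "semialgebraic_map_on (W \<inter> ball c r) \<sigma>"
    and im: "\<sigma> ` (W \<inter> ball c r) \<subseteq> X"
    and \<tau>: "continuous_on (\<sigma> ` (W \<inter> ball c r)) \<tau>" "\<And>u. u \<in> W \<inter> ball c r \<Longrightarrow> \<tau> (\<sigma> u) = u"
  shows "contains_cell (dim W) X"
proof -
  let ?B = "W \<inter> ball c r"
  have "dim W \<le> dim (UNIV :: 'a set)"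
  proof (rule invariance_of_dimension_subspaces)
    show "openin (top_of_set W) ?B" by (rule openin_open_Int) simp
    show "inj_on \<sigma> ?B" using \<tau>(2) by (rule inj_on_inverseI)
    show "?B \<noteq> {}" using W by auto
  qed (use W cont in auto)
  then obtain J :: "'a set" where J: "J \<subseteq> Basis" "card J = dim W"
    by (metis dim_UNIV obtain_subset_with_card_n)
  define V where "V = coord_space J"
  have V: "subspace V" "dim V = dim W" "semialgebraic V"
    using J by (auto simp: V_def subspace_coord_space dim_coord_space semialgebraic_coord_space)
  obtain f g where fg: "linear f" "linear g" "f ` V = W" "g ` W = V"
    "\<And>x. x \<in> V \<Longrightarrow> norm (f x) = norm x" "\<And>x. x \<in> W \<Longrightarrow> norm (g x) = norm x"
    "\<And>x. x \<in> V \<Longrightarrow> g (f x) = x" "\<And>x. x \<in> W \<Longrightarrow> f (g x) = x"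
    using isometries_subspaces[OF V(1) W(1) V(2)] by blast
  have bl: "bounded_linear f" "bounded_linear g" using fg by (simp_all add: linear_conv_bounded_linear)
  define \<phi> where "\<phi> = (\<lambda>v. c + (r / (1 + norm v)) *\<^sub>R f v)"
  define \<psi> where "\<psi> = (\<lambda>w. (1 / (r - norm (w - c))) *\<^sub>R g (w - c))"
  have pos: "1 + norm v > 0" for v :: 'a by (simp add: add_pos_nonneg)
  have n\<phi>: "norm (\<phi> v - c) = r * norm v / (1 + norm v)" if "v \<in> V" for v
    using that pos[of v] W(3) fg(5) by (simp add: \<phi>_def)
  have hom: "homeomorphism V ?B \<phi> \<psi>"
  proof (rule homeomorphismI)
    have "1 + norm v \<noteq> 0" for v :: 'a using pos[of v] by linarith
    then show "continuous_on V \<phi>" unfolding \<phi>_def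
      by (intro continuous_intros bounded_linear.continuous_on[OF bl(1)]) auto
    show "continuous_on ?B \<psi>" unfolding \<psi>_def
      by (intro continuous_intros bounded_linear.continuous_on[OF bl(2)]) (auto simp: dist_norm norm_minus_commute)
    show "\<phi> ` V \<subseteq> ?B"
    proof (intro image_subsetI IntI)
      fix v assume v: "v \<in> V"
      then have "f v \<in> W" using fg(3) by blast
      then show "\<phi> v \<in> W" using W by (simp add: \<phi>_def subspace_add subspace_scale)
      have "norm (\<phi> v - c) < r" using n\<phi>[OF v] pos[of v] W(3) by (simp add: divide_less_eq)
      then show "\<phi> v \<in> ball c r" by (simp add: dist_norm norm_minus_commute)
    qed
    show "\<psi> ` ?B \<subseteq> V"
    proof (rule image_subsetI)
      fix w assume "w \<in> ?B"
      then have "w - c \<in> W" using W by (simp add: subspace_diff)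
      then have "g (w - c) \<in> V" using fg(4) by blast
      then show "\<psi> w \<in> V" using V(1) by (simp add: \<psi>_def subspace_scale)
    qed
    show "\<psi> (\<phi> v) = v" if v: "v \<in> V" for v
    proof -
      have "g (\<phi> v - c) = (r / (1 + norm v)) *\<^sub>R v"
        using fg(7)[OF v] by (simp add: \<phi>_def linear_scale[OF fg(2)])
      moreover have "r - norm (\<phi> v - c) = r / (1 + norm v)"
        unfolding n\<phi>[OF v] using pos[of v] by (simp add: field_simps)
      ultimately show ?thesis using pos[of v] W(3) by (simp add: \<psi>_def)
    qed
    show "\<phi> (\<psi> w) = w" if w: "w \<in> ?B" for w
    proof -
      define u where "u = w - c"
      have u: "u \<in> W" using w W by (simp add: subspace_diff u_def)
      have d: "r - norm u > 0" using w by (simp add: u_def dist_norm norm_minus_commute)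
      have "norm (\<psi> w) = norm u / (r - norm u)"
        using d fg(6)[OF u] by (simp add: \<psi>_def u_def[symmetric])
      then have "1 + norm (\<psi> w) = r / (r - norm u)" using d by (simp add: field_simps)
      then have "r / (1 + norm (\<psi> w)) = r - norm u" using d W(3) by simp
      moreover have "f (\<psi> w) = (1 / (r - norm u)) *\<^sub>R u"
        using fg(8)[OF u] by (simp add: \<psi>_def u_def[symmetric] linear_scale[OF fg(1)])
      ultimately show ?thesis using d by (simp add: \<phi>_def u_def)
    qed
  qed
  have "homeomorphism ?B (\<sigma> ` ?B) \<sigma> \<tau>"
    by (rule homeomorphismI) (use cont \<tau> in auto)
  then have "homeomorphism V (\<sigma> ` ?B) (\<sigma> \<circ> \<phi>) (\<psi> \<circ> \<tau>)"
    by (rule homeomorphism_compose[OF hom])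
  moreover have "semialgebraic_map_on V (\<sigma> \<circ> \<phi>)"
    unfolding o_def
  proof (rule semialgebraic_map_on_comp[OF _ sa])
    show "semialgebraic_map_on V \<phi>"
      unfolding \<phi>_def by (rule semialgebraic_ball_chart[OF bl(1) V(3)])
    show "\<phi> ` V \<subseteq> ?B" using hom by (simp add: homeomorphism_def)
  qed
  ultimately show ?thesis
    using V im unfolding contains_cell_def by blast
qed

text \<open>The lexicographically least point of every fibre is selected by minimising one
  coordinate after the other. Compact fibres make the minima exist, and compactness is inherited by
  the minimisers; minimality is a first-order condition, hence semialgebraic.\<close>

lemma semialgebraic_section:
  fixes \<Gamma> :: "'c::euclidean_space set" and \<pi> :: "'c \<Rightarrow> 'd::euclidean_space"
  assumes "semialgebraic \<Gamma>" "compact \<Gamma>" "bounded_linear \<pi>"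
  shows "\<exists>\<Gamma>'\<subseteq>\<Gamma>. semialgebraic \<Gamma>' \<and> \<pi> ` \<Gamma>' = \<pi> ` \<Gamma> \<and> inj_on \<pi> \<Gamma>'"
proof -
  have "\<exists>\<Gamma>'\<subseteq>\<Gamma>. semialgebraic \<Gamma>' \<and> \<pi> ` \<Gamma>' = \<pi> ` \<Gamma> \<and> (\<forall>x. compact {z\<in>\<Gamma>'. \<pi> z = x}) \<and>
      (\<forall>z\<in>\<Gamma>'. \<forall>z'\<in>\<Gamma>'. \<pi> z = \<pi> z' \<longrightarrow> (\<forall>b\<in>B. z \<bullet> b = z' \<bullet> b))" if "finite B" for B :: "'c set"
    using that
  proof (induction B rule: finite_induct)
    case empty
    have "compact {z\<in>\<Gamma>. \<pi> z = x}" for x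
    proof -
      have "{z\<in>\<Gamma>. \<pi> z = x} = \<Gamma> \<inter> \<pi> -` {x}" by auto
      moreover have "closed (\<pi> -` {x})"
        using bounded_linear.continuous_on[OF assms(3) continuous_on_id, of UNIV]
        by (intro continuous_closed_vimage) (auto simp: continuous_on_eq_continuous_at)
      ultimately show ?thesis using assms(2) by (simp add: compact_Int_closed)
    qed
    then show ?case using assms(1) by blast
  next
    case (insert b B)
    then obtain \<Gamma>' where G: "\<Gamma>' \<subseteq> \<Gamma>" "semialgebraic \<Gamma>'" "\<pi> ` \<Gamma>' = \<pi> ` \<Gamma>" "\<And>x. compact {z\<in>\<Gamma>'. \<pi> z = x}"
      "\<And>z z' b. z \<in> \<Gamma>' \<Longrightarrow> z' \<in> \<Gamma>' \<Longrightarrow> \<pi> z = \<pi> z' \<Longrightarrow> b \<in> B \<Longrightarrow> z \<bullet> b = z' \<bullet> b" by blast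
    define M where "M = {z. z \<in> \<Gamma>' \<and> (\<forall>z'. z' \<in> \<Gamma>' \<and> \<pi> z' = \<pi> z \<longrightarrow> z \<bullet> b \<le> z' \<bullet> b)}"
    have m1: "semialgebraic M"
      unfolding M_def
      by (intro semialgebraic_Collect_conj semialgebraic_Collect_all semialgebraic_Collect_imp
        semialgebraic_Collect_mem G(2) semialgebraic_Collect_eq_linear semialgebraic_Collect_le
        real_polynomial_function.intros(1) bounded_linear_compose[OF assms(3)] bounded_linear_ident
        bounded_linear_compose[OF bounded_linear_inner_left] bounded_linear_fst bounded_linear_snd)
    have m2: "\<pi> ` M = \<pi> ` \<Gamma>"
    proof
      show "\<pi> ` \<Gamma> \<subseteq> \<pi> ` M"
      proof
        fix x assume "x \<in> \<pi> ` \<Gamma>"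
        then have "{z\<in>\<Gamma>'. \<pi> z = x} \<noteq> {}" using G(3) by (metis (mono_tags, lifting) empty_iff image_iff mem_Collect_eq)
        moreover have "continuous_on {z\<in>\<Gamma>'. \<pi> z = x} (\<lambda>z. z \<bullet> b)" by (intro continuous_intros)
        ultimately obtain z where z: "z \<in> {z\<in>\<Gamma>'. \<pi> z = x}" "\<forall>z'\<in>{z\<in>\<Gamma>'. \<pi> z = x}. z \<bullet> b \<le> z' \<bullet> b"
          using continuous_attains_inf[OF G(4)] by blast
        then have "z \<in> M" by (auto simp: M_def)
        then show "x \<in> \<pi> ` M" using z(1) by blast
      qed
    qed (use G(1) in \<open>auto simp: M_def\<close>)
    have m3: "compact {z\<in>M. \<pi> z = x}" for x
    proof -
      have "{z\<in>M. \<pi> z = x} = {z\<in>\<Gamma>'. \<pi> z = x} \<inter> (\<Inter>z'\<in>{z\<in>\<Gamma>'. \<pi> z = x}. {z. z \<bullet> b \<le> z' \<bullet> b})"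
        by (auto simp: M_def)
      moreover have "closed {z. z \<bullet> b \<le> a}" for a :: real
        by (intro closed_Collect_le continuous_intros)
      then have "closed (\<Inter>z'\<in>{z\<in>\<Gamma>'. \<pi> z = x}. {z. z \<bullet> b \<le> z' \<bullet> b})" by (intro closed_INT) auto
      ultimately show ?thesis using G(4) by (simp add: compact_Int_closed)
    qed
    have m4: "z \<bullet> d = z' \<bullet> d" if "z \<in> M" "z' \<in> M" "\<pi> z = \<pi> z'" "d \<in> insert b B" for z z' d
    proof (cases "d = b")
      case True
      have "z \<bullet> b \<le> z' \<bullet> b" "z' \<bullet> b \<le> z \<bullet> b" using that by (auto simp: M_def)
      then show ?thesis using True by simp
    next
      case False
      then show ?thesis using that G(5) by (auto simp: M_def)
    qed
    have m5: "M \<subseteq> \<Gamma>" using G(1) by (auto simp: M_def)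
    show ?case by (intro exI[of _ M] conjI allI ballI impI m5 m1 m2 m3) (rule m4)
  qed
  note ex = this[OF finite_Basis]
  show ?thesis
    using ex
  proof (elim exE conjE)
    fix \<Gamma>' assume *: "\<Gamma>' \<subseteq> \<Gamma>" "semialgebraic \<Gamma>'" "\<pi> ` \<Gamma>' = \<pi> ` \<Gamma>"
      and eq: "\<forall>z\<in>\<Gamma>'. \<forall>z'\<in>\<Gamma>'. \<pi> z = \<pi> z' \<longrightarrow> (\<forall>b\<in>Basis. z \<bullet> b = z' \<bullet> b)"
    have "inj_on \<pi> \<Gamma>'"
    proof (rule inj_onI)
      fix z z' assume "z \<in> \<Gamma>'" "z' \<in> \<Gamma>'" "\<pi> z = \<pi> z'"
      then have "\<forall>b\<in>Basis. z \<bullet> b = z' \<bullet> b" using eq by blast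
      then show "z = z'" by (simp add: euclidean_eq_iff[of z])
    qed
    then show ?thesis using * by (intro exI[of _ \<Gamma>'] conjI)
  qed
qed

lemma semialgebraic_map_pieces:
  fixes f :: "'a::euclidean_space \<Rightarrow> 'b::euclidean_space"
  assumes "semialgebraic_map_on T f"
  obtains K where "finite K" "\<forall>p\<in>K. real_polynomial_function p"
    "\<And>x. x \<in> T \<Longrightarrow> sign_class K x \<subseteq> T \<and> continuous_on (sign_class K x) f"
proof -
  have "\<exists>K. finite K \<and> (\<forall>p\<in>K. real_polynomial_function p) \<and>
     (\<forall>x\<in>T. sign_class K x \<subseteq> T \<and> continuous_on (sign_class K x) (\<lambda>x. f x \<bullet> b))" for b
  proof -
    have "semialgebraic_map_on T (\<lambda>x. f x \<bullet> b)"
      by (rule semialgebraic_map_on_linear_comp[OF assms bounded_linear_inner_left])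
    then show ?thesis by (rule semialgebraic_function_pieces) blast
  qed
  then obtain K where K: "\<And>b. finite (K b)" "\<And>b. \<forall>p\<in>K b. real_polynomial_function p"
     "\<And>b. \<forall>x\<in>T. sign_class (K b) x \<subseteq> T \<and> continuous_on (sign_class (K b) x) (\<lambda>x. f x \<bullet> b)"
    by metis
  define L where "L = (\<Union>b\<in>Basis. K b)"
  have sub: "sign_class L x \<subseteq> sign_class (K b) x" if "b \<in> Basis" for b x
    using that unfolding sign_class_def same_signs_def L_def by blast
  show ?thesis
  proof (rule that[of L])
    show "finite L" "\<forall>p\<in>L. real_polynomial_function p" using K(1,2) by (auto simp: L_def)
    fix x assume "x \<in> T"
    obtain b where "b \<in> (Basis :: 'b set)" using nonempty_Basis by blast
    then have "sign_class L x \<subseteq> T" using K(3) sub \<open>x \<in> T\<close> by blast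
    moreover have "continuous_on (sign_class L x) (\<lambda>x. f x \<bullet> b)" if "b \<in> Basis" for b
      using K(3) sub[OF that] \<open>x \<in> T\<close> continuous_on_subset by blast
    ultimately show "sign_class L x \<subseteq> T \<and> continuous_on (sign_class L x) f"
      by (subst continuous_on_componentwise) blast
  qed
qed

text \<open>A semialgebraic section over the projection is continuous on each of finitely many sign
  classes. Finite unions of thin sets are thin, so one class is not thin and contains a ball of the
  coordinate space.\<close>

lemma chart_if_not_thin:
  fixes \<Gamma> :: "'c::euclidean_space set"
  assumes "semialgebraic \<Gamma>" "compact \<Gamma>" "I \<subseteq> Basis" "\<not> thin_in (coord_space I) (coord_proj I ` \<Gamma>)"
  obtains c r \<sigma> where "c \<in> coord_space I" "r > 0" "continuous_on (coord_space I \<inter> ball c r) \<sigma>"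
    "semialgebraic_map_on (coord_space I \<inter> ball c r) \<sigma>"
    "\<And>u. u \<in> coord_space I \<inter> ball c r \<Longrightarrow> \<sigma> u \<in> \<Gamma> \<and> coord_proj I (\<sigma> u) = u"
proof -
  let ?W = "coord_space I" and ?\<pi> = "coord_proj I"
  obtain \<Gamma>' where G: "\<Gamma>' \<subseteq> \<Gamma>" "semialgebraic \<Gamma>'" "?\<pi> ` \<Gamma>' = ?\<pi> ` \<Gamma>" "inj_on ?\<pi> \<Gamma>'"
    using semialgebraic_section[OF assms(1,2) bounded_linear_coord_proj[of I]] by blast
  define T where "T = ?\<pi> ` \<Gamma>'"
  define \<sigma> where "\<sigma> = inv_into \<Gamma>' ?\<pi>"
  have sa: "semialgebraic_map_on T \<sigma>"
    unfolding T_def \<sigma>_def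
    by (rule semialgebraic_map_on_inverse[OF semialgebraic_map_on_linear[OF bounded_linear_coord_proj G(2)]])
      (simp add: G(4))
  obtain K where K: "finite K" "\<forall>p\<in>K. real_polynomial_function p"
    "\<And>x. x \<in> T \<Longrightarrow> sign_class K x \<subseteq> T \<and> continuous_on (sign_class K x) \<sigma>"
    using semialgebraic_map_pieces[OF sa] by blast
  have TW: "T \<subseteq> ?W" using coord_proj_in[OF assms(3)] by (auto simp: T_def)
  have "\<exists>x\<in>T. \<not> thin_in ?W (sign_class K x)"
  proof (rule ccontr)
    assume *: "\<not> ?thesis"
    have "finite (sign_class K ` T)"
      using finite_sign_classes[OF K(1)] by (rule rev_finite_subset) auto
    then have "thin_in ?W (\<Union>(sign_class K ` T))"
      by (rule thin_in_Union[OF _ subspace_coord_space]) (use * in auto)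
    moreover have "T \<subseteq> \<Union>(sign_class K ` T)" by auto
    ultimately have "thin_in ?W T" using thin_in_subset by blast
    then show False using assms(4) G(3) by (simp add: T_def)
  qed
  then obtain x where x: "x \<in> T" "\<not> thin_in ?W (sign_class K x)" by blast
  have sub: "sign_class K x \<subseteq> T" and cont: "continuous_on (sign_class K x) \<sigma>" using K(3)[OF x(1)] by auto
  obtain c r where cr: "c \<in> ?W" "r > 0" "?W \<inter> ball c r \<subseteq> sign_class K x"
    using semialgebraic_thin_or_open[OF semialgebraic_sign_class[OF K(1,2)] _ subspace_coord_space x(2)] sub TW
    by blast
  show ?thesis
  proof (rule that[OF cr(1,2)])
    show "continuous_on (?W \<inter> ball c r) \<sigma>" using cont cr(3) continuous_on_subset by blast
    show "semialgebraic_map_on (?W \<inter> ball c r) \<sigma>"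
      by (rule semialgebraic_map_on_subset[OF sa])
        (use semialgebraic_Int[OF semialgebraic_coord_space semialgebraic_ball] cr(3) sub in auto)
    show "\<sigma> u \<in> \<Gamma> \<and> ?\<pi> (\<sigma> u) = u" if "u \<in> ?W \<inter> ball c r" for u
    proof -
      have "u \<in> ?\<pi> ` \<Gamma>'" using that cr(3) sub by (auto simp: T_def)
      then show ?thesis using G(1) by (auto simp: \<sigma>_def inv_into_into f_inv_into_f)
    qed
  qed
qed

text \<open>Compactness makes \<open>F\<close> a homeomorphism onto its image, with semialgebraic
  inverse, so a chart of the image would be carried back to a cell of \<open>X\<close>. Thus the
  dimension of \<open>X\<close> controls every embedded copy, in particular a pair of
  embeddings.\<close>

lemma thin_projection:
  fixes X :: "'a::euclidean_space set" and F :: "'a \<Rightarrow> 'c::euclidean_space"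
  assumes "compact X" "semialgebraic_map_on X F" "continuous_on X F" "inj_on F X"
    "I \<subseteq> Basis" "\<not> contains_cell (card I) X"
  shows "thin_in (coord_space I) (coord_proj I ` F ` X)"
proof (rule ccontr)
  assume nt: "\<not> ?thesis"
  have G: "semialgebraic (F ` X)" "compact (F ` X)"
    using semialgebraic_map_on_image[OF assms(2)] compact_continuous_image[OF assms(3,1)] by auto
  obtain c r \<sigma> where s: "c \<in> coord_space I" "r > 0" "continuous_on (coord_space I \<inter> ball c r) \<sigma>"
    "semialgebraic_map_on (coord_space I \<inter> ball c r) \<sigma>"
    "\<And>u. u \<in> coord_space I \<inter> ball c r \<Longrightarrow> \<sigma> u \<in> F ` X \<and> coord_proj I (\<sigma> u) = u"
    using chart_if_not_thin[OF G assms(5) nt] by blast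
  let ?B = "coord_space I \<inter> ball c r"
  define H where "H = inv_into X F"
  have H: "H (F x) = x" if "x \<in> X" for x using that assms(4) by (simp add: H_def)
  have FH: "F (H y) = y" "H y \<in> X" if "y \<in> F ` X" for y
    using that by (auto simp: H_def f_inv_into_f inv_into_into)
  have cH: "continuous_on (F ` X) H"
    using continuous_on_inv[OF assms(3,1)] H by blast
  have sH: "semialgebraic_map_on (F ` X) H"
    using semialgebraic_map_on_inverse[OF assms(2)] H by blast
  have "contains_cell (dim (coord_space I)) X"
  proof (rule contains_cell_from_chart[OF subspace_coord_space s(1,2)])
    have im: "\<sigma> ` ?B \<subseteq> F ` X" using s(5) by blast
    then show "continuous_on ?B (\<lambda>u. H (\<sigma> u))"
      using continuous_on_compose2[OF cH s(3)] by blast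
    show "semialgebraic_map_on ?B (\<lambda>u. H (\<sigma> u))"
      by (rule semialgebraic_map_on_comp[OF s(4) sH im])
    show sub: "(\<lambda>u. H (\<sigma> u)) ` ?B \<subseteq> X" using FH(2) im by blast
    have "continuous_on ((\<lambda>u. H (\<sigma> u)) ` ?B) F" using assms(3) sub continuous_on_subset by blast
    then show "continuous_on ((\<lambda>u. H (\<sigma> u)) ` ?B) (\<lambda>x. coord_proj I (F x))"
      by (intro bounded_linear.continuous_on[OF bounded_linear_coord_proj])
    show "coord_proj I (F (H (\<sigma> u))) = u" if "u \<in> ?B" for u
      using s(5)[OF that] FH(1) by auto
  qed
  then show False using assms(5,6) by (simp add: dim_coord_space)
qed

subsection \<open>Hilbert functions\<close>

text \<open>The span of the \<open>\<phi> j\<close> among functions on \<open>\<Omega>\<close>;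
  polynomials are thereby treated modulo those vanishing on \<open>\<Omega>\<close>.\<close>

definition lincomb :: "'w set \<Rightarrow> 'j set \<Rightarrow> ('j \<Rightarrow> 'w \<Rightarrow> real) \<Rightarrow> ('w \<Rightarrow> real) \<Rightarrow> bool" where
  "lincomb \<Omega> J \<phi> f \<longleftrightarrow> (\<exists>c. \<forall>x\<in>\<Omega>. f x = (\<Sum>j\<in>J. c j * \<phi> j x))"

lemma lincomb_basis: "finite J \<Longrightarrow> j \<in> J \<Longrightarrow> lincomb \<Omega> J \<phi> (\<phi> j)"
  unfolding lincomb_def by (rule exI[of _ "\<lambda>i. if i = j then 1 else 0"]) (simp add: if_distrib[of "\<lambda>c. c * _"] cong: if_cong)

lemma lincomb_cong: "lincomb \<Omega> J \<phi> f \<Longrightarrow> (\<And>x. x \<in> \<Omega> \<Longrightarrow> g x = f x) \<Longrightarrow> lincomb \<Omega> J \<phi> g"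
  unfolding lincomb_def by simp

lemma lincomb_sum:
  assumes "\<And>i. i \<in> K \<Longrightarrow> lincomb \<Omega> J \<phi> (f i)"
  shows "lincomb \<Omega> J \<phi> (\<lambda>x. \<Sum>i\<in>K. a i * f i x)"
proof -
  have "\<forall>i\<in>K. \<exists>c. \<forall>x\<in>\<Omega>. f i x = (\<Sum>j\<in>J. c j * \<phi> j x)"
    using assms unfolding lincomb_def by blast
  then obtain c where c: "\<forall>i\<in>K. \<forall>x\<in>\<Omega>. f i x = (\<Sum>j\<in>J. c i j * \<phi> j x)"
    using bchoice[of K "\<lambda>i c. \<forall>x\<in>\<Omega>. f i x = (\<Sum>j\<in>J. c j * \<phi> j x)"] by blast
  have "(\<Sum>i\<in>K. a i * f i x) = (\<Sum>j\<in>J. (\<Sum>i\<in>K. a i * c i j) * \<phi> j x)" if "x \<in> \<Omega>" for x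
  proof -
    have "(\<Sum>i\<in>K. a i * f i x) = (\<Sum>i\<in>K. \<Sum>j\<in>J. a i * c i j * \<phi> j x)"
      using c that by (intro sum.cong refl) (simp add: sum_distrib_left mult.assoc)
    also have "\<dots> = (\<Sum>j\<in>J. \<Sum>i\<in>K. a i * c i j * \<phi> j x)" by (rule sum.swap)
    finally show ?thesis by (simp add: sum_distrib_right)
  qed
  then show ?thesis unfolding lincomb_def by (intro exI[of _ "\<lambda>j. \<Sum>i\<in>K. a i * c i j"]) simp
qed

lemma lincomb_trans:
  assumes "lincomb \<Omega> J \<phi> f" "\<And>j. j \<in> J \<Longrightarrow> lincomb \<Omega> K \<psi> (\<phi> j)"
  shows "lincomb \<Omega> K \<psi> f"
proof -
  obtain c where c: "\<forall>x\<in>\<Omega>. f x = (\<Sum>j\<in>J. c j * \<phi> j x)" using assms(1) unfolding lincomb_def by blast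
  show ?thesis
    by (rule lincomb_cong[OF lincomb_sum[OF assms(2), of J "\<lambda>j. j" c]]) (use c in simp_all)
qed

lemma lincomb_add:
  assumes "lincomb \<Omega> J \<phi> f" "lincomb \<Omega> J \<phi> g" shows "lincomb \<Omega> J \<phi> (\<lambda>x. f x + g x)"
proof -
  have "lincomb \<Omega> J \<phi> (\<lambda>x. \<Sum>i\<in>{True, False}. 1 * (if i then f else g) x)"
    by (rule lincomb_sum) (use assms in auto)
  then show ?thesis by simp
qed

lemma lincomb_mult:
  assumes f: "lincomb \<Omega> J \<phi> f" and g: "lincomb \<Omega> K \<psi> g"
    and jk: "\<And>j k. j \<in> J \<Longrightarrow> k \<in> K \<Longrightarrow> lincomb \<Omega> L \<chi>' (\<lambda>x. \<phi> j x * \<psi> k x)"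
  shows "lincomb \<Omega> L \<chi>' (\<lambda>x. f x * g x)"
proof -
  obtain c where c: "\<forall>x\<in>\<Omega>. f x = (\<Sum>j\<in>J. c j * \<phi> j x)" using f unfolding lincomb_def by blast
  obtain d where d: "\<forall>x\<in>\<Omega>. g x = (\<Sum>k\<in>K. d k * \<psi> k x)" using g unfolding lincomb_def by blast
  have "lincomb \<Omega> L \<chi>' (\<lambda>x. \<Sum>j\<in>J. c j * (\<Sum>k\<in>K. d k * (\<phi> j x * \<psi> k x)))"
    by (intro lincomb_sum jk)
  then show ?thesis
    by (rule lincomb_cong) (simp add: c d sum_distrib_left sum_distrib_right mult_ac, rule sum.swap)
qed

lemma lincomb_subset: "lincomb \<Omega> J \<phi> f \<Longrightarrow> \<Omega>' \<subseteq> \<Omega> \<Longrightarrow> lincomb \<Omega>' J \<phi> f"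
  unfolding lincomb_def by blast

text \<open>Elimination: an unknown \<open>i\<close> with nonzero coefficient in equation
  \<open>s\<close> is solved for and substituted into the other equations.\<close>

lemma homogeneous_system_solution:
  fixes a :: "'j \<Rightarrow> 's \<Rightarrow> real"
  assumes "finite S" "finite J" "card S < card J"
  shows "\<exists>c. (\<exists>j\<in>J. c j \<noteq> 0) \<and> (\<forall>s\<in>S. (\<Sum>j\<in>J. c j * a j s) = 0)"
  using assms
proof (induction S arbitrary: J a rule: finite_induct)
  case empty
  then have "J \<noteq> {}" by auto
  then show ?case by (intro exI[of _ "\<lambda>_. 1"]) auto
next
  case (insert s S)
  show ?case
  proof (cases "\<exists>i\<in>J. a i s \<noteq> 0")
    case False
    have "card S < card J" using insert by simp
    then obtain c where c: "\<exists>j\<in>J. c j \<noteq> 0" "\<forall>s\<in>S. (\<Sum>j\<in>J. c j * a j s) = 0"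
      using insert.IH[OF insert.prems(1), of a] by blast
    have "(\<Sum>j\<in>J. c j * a j s) = 0" using False by (intro sum.neutral) simp
    then show ?thesis using c by (intro exI[of _ c]) simp
  next
    case True
    then obtain i where i: "i \<in> J" "a i s \<noteq> 0" by blast
    define b where "b = (\<lambda>j t. a j t - a j s / a i s * a i t)"
    have "card S < card (J - {i})" "finite (J - {i})" using insert i by auto
    then obtain c where c: "\<exists>j\<in>J - {i}. c j \<noteq> 0" "\<forall>t\<in>S. (\<Sum>j\<in>J - {i}. c j * b j t) = 0"
      using insert.IH[of "J - {i}" b] by blast
    define e where "e = c(i := - (\<Sum>j\<in>J - {i}. c j * a j s / a i s))"
    have sum: "(\<Sum>j\<in>J. e j * a j t) = (\<Sum>j\<in>J - {i}. c j * b j t)" for t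
    proof -
      have "(\<Sum>j\<in>J. e j * a j t) = e i * a i t + (\<Sum>j\<in>J - {i}. e j * a j t)"
        using i(1) insert.prems(1) by (simp add: sum.remove)
      also have "(\<Sum>j\<in>J - {i}. e j * a j t) = (\<Sum>j\<in>J - {i}. c j * a j t)"
        by (rule sum.cong) (auto simp: e_def)
      also have "e i * a i t + \<dots> = (\<Sum>j\<in>J - {i}. c j * b j t)"
      proof -
        have "(\<Sum>j\<in>J - {i}. c j * b j t) = (\<Sum>j\<in>J - {i}. c j * a j t - c j * a j s / a i s * a i t)"
          by (rule sum.cong) (simp_all add: b_def right_diff_distrib)
        then show ?thesis by (simp add: e_def sum_subtractf sum_distrib_right)
      qed
      finally show ?thesis .
    qed
    have "(\<Sum>j\<in>J. e j * a j s) = 0"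
      unfolding sum using i(2) by (simp add: b_def)
    moreover have "\<exists>j\<in>J. e j \<noteq> 0" using c(1) by (auto simp: e_def)
    ultimately show ?thesis using c(2) sum by (intro exI[of _ e]) simp
  qed
qed

text \<open>Only an upper bound on the degree. The rule for linear maps allows every positive bound,
  which makes the predicate monotone in it.\<close>

inductive poly_deg :: "nat \<Rightarrow> ('w::euclidean_space \<Rightarrow> real) \<Rightarrow> bool" where
  const: "poly_deg d (\<lambda>_. c)"
| linear: "bounded_linear f \<Longrightarrow> poly_deg (Suc d) f"
| add: "poly_deg d f \<Longrightarrow> poly_deg d g \<Longrightarrow> poly_deg d (\<lambda>x. f x + g x)"
| mult: "poly_deg d f \<Longrightarrow> poly_deg e g \<Longrightarrow> poly_deg (d + e) (\<lambda>x. f x * g x)"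

lemma poly_deg_mono: "poly_deg d f \<Longrightarrow> d \<le> e \<Longrightarrow> poly_deg e f"
proof (induction arbitrary: e rule: poly_deg.induct)
  case (linear f d)
  then show ?case by (cases e) (auto intro: poly_deg.linear)
next
  case (mult d f d' g)
  then have "poly_deg (d + (e - d)) (\<lambda>x. f x * g x)" by (intro poly_deg.mult) auto
  then show ?case using mult.prems by simp
qed (auto intro: poly_deg.intros)

lemma poly_deg_prod:
  "finite K \<Longrightarrow> (\<And>i. i \<in> K \<Longrightarrow> poly_deg d (f i)) \<Longrightarrow> poly_deg (card K * d) (\<lambda>x. \<Prod>i\<in>K. f i x)"
  by (induction K rule: finite_induct) (simp_all add: poly_deg.const poly_deg.mult)

lemma poly_deg_power: "poly_deg d f \<Longrightarrow> poly_deg (n * d) (\<lambda>x. f x ^ n)"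
  by (induction n) (simp_all add: poly_deg.const poly_deg.mult)

lemma real_polynomial_function_imp_poly_deg: "real_polynomial_function p \<Longrightarrow> \<exists>d. poly_deg d p"
proof (induction p rule: real_polynomial_function.induct)
  case (linear f)
  then show ?case using poly_deg.linear by blast
next
  case (const c)
  then show ?case using poly_deg.const by blast
next
  case (add f g)
  then obtain d e where "poly_deg d f" "poly_deg e g" by blast
  then have "poly_deg (max d e) (\<lambda>x. f x + g x)"
    by (intro poly_deg.add) (auto elim: poly_deg_mono)
  then show ?case ..
next
  case (mult f g)
  then show ?case using poly_deg.mult by blast
qed

definition mon :: "('a::euclidean_space \<Rightarrow> nat) \<Rightarrow> 'a \<Rightarrow> real" where
  "mon \<beta> x = (\<Prod>b\<in>Basis. (x \<bullet> b) ^ \<beta> b)"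

definition exps :: "'a::euclidean_space set \<Rightarrow> nat \<Rightarrow> ('a \<Rightarrow> nat) set" where
  "exps I d = {\<beta>. (\<forall>b. b \<notin> I \<longrightarrow> \<beta> b = 0) \<and> (\<Sum>b\<in>I. \<beta> b) \<le> d}"

lemma finite_exps:
  assumes "finite I" shows "finite (exps I d)"
proof (rule finite_subset)
  show "finite {\<beta>. \<forall>b. (b \<in> I \<longrightarrow> \<beta> b \<in> {..d}) \<and> (b \<notin> I \<longrightarrow> \<beta> b = (0::nat))}"
    by (rule finite_set_of_finite_funs[OF assms]) simp
  have "\<beta> b \<le> d" if "(\<Sum>b\<in>I. \<beta> b) \<le> d" "b \<in> I" for \<beta> :: "'a \<Rightarrow> nat" and b
    using member_le_sum[of b I \<beta>] assms that by simp
  then show "exps I d \<subseteq> {\<beta>. \<forall>b. (b \<in> I \<longrightarrow> \<beta> b \<in> {..d}) \<and> (b \<notin> I \<longrightarrow> \<beta> b = 0)}"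
    by (simp add: exps_def subset_iff)
qed

lemma mon_add: "mon (\<lambda>b. \<beta> b + \<gamma> b) x = mon \<beta> x * mon \<gamma> x"
  by (simp add: mon_def power_add prod.distrib)

lemma mon_zero: "mon (\<lambda>_. 0) x = 1"
  by (simp add: mon_def)

lemma mon_single:
  assumes "b \<in> Basis" shows "mon (\<lambda>c. if c = b then 1 else 0) x = x \<bullet> b"
proof -
  have "mon (\<lambda>c. if c = b then 1 else 0) x = (\<Prod>c\<in>Basis. if c = b then x \<bullet> b else 1)"
    unfolding mon_def by (rule prod.cong) auto
  then show ?thesis using assms by simp
qed

lemma poly_deg_expand:
  fixes p :: "'a::euclidean_space \<Rightarrow> real"
  assumes "poly_deg d p" "I \<subseteq> Basis"
  shows "lincomb UNIV (exps I d) mon (\<lambda>x. p (coord_proj I x))"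
  using assms(1)
proof (induction rule: poly_deg.induct)
  have finI: "finite I" by (rule finite_subset[OF assms(2) finite_Basis])
  {
    case (const d c)
    have "(\<lambda>_. 0) \<in> exps I d" by (simp add: exps_def)
    then have "lincomb UNIV (exps I d) mon (mon (\<lambda>_. 0))"
      by (rule lincomb_basis[OF finite_exps[OF finI]])
    from lincomb_sum[of "{()}", OF this, of "\<lambda>_. c"] show ?case by (simp add: mon_zero)
  next
    case (linear f d)
    have "f (coord_proj I x) = (\<Sum>b\<in>I. f b * mon (\<lambda>c. if c = b then 1 else 0) x)" for x
    proof -
      have lf: "linear f" using linear by (simp add: linear_conv_bounded_linear)
      have "f (coord_proj I x) = (\<Sum>b\<in>I. f ((x \<bullet> b) *\<^sub>R b))"
        unfolding coord_proj_def by (rule linear_sum[OF lf])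
      also have "\<dots> = (\<Sum>b\<in>I. f b * mon (\<lambda>c. if c = b then 1 else 0) x)"
        using assms(2) by (intro sum.cong refl) (simp add: linear_scale[OF lf] mon_single subset_iff)
      finally show ?thesis .
    qed
    moreover have "lincomb UNIV (exps I (Suc d)) mon (\<lambda>x. \<Sum>b\<in>I. f b * mon (\<lambda>c. if c = b then 1 else 0) x)"
    proof (rule lincomb_sum, rule lincomb_basis[OF finite_exps[OF finI]])
      fix b assume "b \<in> I"
      then show "(\<lambda>c. if c = b then 1 else 0) \<in> exps I (Suc d)"
        using finI by (auto simp: exps_def)
    qed
    ultimately show ?case by simp
  next
    case (add d f g)
    then show ?case by (intro lincomb_add)
  next
    case (mult d f e g)
    show ?case
    proof (rule lincomb_mult[OF mult.IH])
      fix \<beta> \<gamma> assume "\<beta> \<in> exps I d" "\<gamma> \<in> exps I e"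
      then have "(\<lambda>b. \<beta> b + \<gamma> b) \<in> exps I (d + e)"
        by (simp add: exps_def sum.distrib add_mono)
      from lincomb_basis[OF finite_exps[OF finI] this, of UNIV mon]
      show "lincomb UNIV (exps I (d + e)) mon (\<lambda>x. mon \<beta> x * mon \<gamma> x)"
        by (rule lincomb_cong) (simp add: mon_add)
    qed
  }
qed

definition weight :: "('a::euclidean_space \<Rightarrow> nat) \<Rightarrow> ('a \<Rightarrow> nat) \<Rightarrow> nat" where
  "weight \<omega> \<beta> = (\<Sum>b\<in>Basis. \<omega> b * \<beta> b)"

lemma weight_add: "weight \<omega> (\<lambda>b. \<beta> b + \<gamma> b) = weight \<omega> \<beta> + weight \<omega> \<gamma>"
  by (simp add: weight_def distrib_left sum.distrib)

text \<open>Positional notation: each new weight exceeds all weighted sums over the earlier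
  coordinates, so exponents are read off by quotient and remainder. Weights then replace a monomial
  order; only the finitely many elements of \<open>M\<close> have to be separated.\<close>

lemma separating_weight:
  fixes M :: "('a::euclidean_space \<Rightarrow> nat) set"
  assumes "finite M" "\<forall>\<beta>\<in>M. \<forall>b. b \<notin> Basis \<longrightarrow> \<beta> b = 0"
  shows "\<exists>\<omega>. (\<forall>b. 1 \<le> \<omega> b) \<and> inj_on (weight \<omega>) M"
proof -
  have "\<exists>\<omega>. (\<forall>b. 1 \<le> \<omega> b) \<and> (\<forall>\<beta>\<in>M. \<forall>\<gamma>\<in>M. (\<Sum>b\<in>B. \<omega> b * \<beta> b) = (\<Sum>b\<in>B. \<omega> b * \<gamma> b) \<longrightarrow> (\<forall>b\<in>B. \<beta> b = \<gamma> b))"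
    if "finite B" for B :: "'a set"
    using that
  proof (induction B rule: finite_induct)
    case empty
    then show ?case by (intro exI[of _ "\<lambda>_. 1"]) simp
  next
    case (insert i B)
    then obtain \<omega> where w: "\<forall>b. 1 \<le> \<omega> b"
      "\<forall>\<beta>\<in>M. \<forall>\<gamma>\<in>M. (\<Sum>b\<in>B. \<omega> b * \<beta> b) = (\<Sum>b\<in>B. \<omega> b * \<gamma> b) \<longrightarrow> (\<forall>b\<in>B. \<beta> b = \<gamma> b)" by blast
    define s where "s = (\<lambda>\<beta>. \<Sum>b\<in>B. \<omega> b * \<beta> b)"
    define K where "K = Suc (Max (insert 0 (s ` M)))"
    have K: "s \<beta> < K" if "\<beta> \<in> M" for \<beta>
      using that assms(1) by (auto simp: K_def less_Suc_eq_le intro!: Max_ge)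
    define \<omega>' where "\<omega>' = (\<lambda>b. if b = i then K else \<omega> b)"
    have s': "(\<Sum>b\<in>insert i B. \<omega>' b * \<beta> b) = K * \<beta> i + s \<beta>" for \<beta>
    proof -
      have "(\<Sum>b\<in>B. \<omega>' b * \<beta> b) = s \<beta>"
        unfolding s_def \<omega>'_def by (rule sum.cong) (use insert.hyps in auto)
      then show ?thesis using insert.hyps by (simp add: \<omega>'_def)
    qed
    have "\<beta> b = \<gamma> b" if M: "\<beta> \<in> M" "\<gamma> \<in> M" and e: "K * \<beta> i + s \<beta> = K * \<gamma> i + s \<gamma>" and b: "b \<in> insert i B" for \<beta> \<gamma> b
    proof -
      have "K * n + s \<delta> = s \<delta> + n * K" for n \<delta> by simp
      then have "(K * \<beta> i + s \<beta>) div K = \<beta> i" "(K * \<gamma> i + s \<gamma>) div K = \<gamma> i"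
        using K[OF M(1)] K[OF M(2)] by simp_all
      then have i: "\<beta> i = \<gamma> i" using e by simp
      then have "s \<beta> = s \<gamma>" using e by simp
      then have "\<forall>b\<in>B. \<beta> b = \<gamma> b" using w(2) M by (simp add: s_def)
      then show ?thesis using i b by blast
    qed
    moreover have "1 \<le> \<omega>' b" for b using w(1) by (simp add: \<omega>'_def K_def)
    ultimately show ?case unfolding s'[symmetric] by (intro exI[of _ \<omega>']) blast
  qed
  from this[OF finite_Basis] obtain \<omega> where w: "\<forall>b. 1 \<le> \<omega> b"
    "\<forall>\<beta>\<in>M. \<forall>\<gamma>\<in>M. weight \<omega> \<beta> = weight \<omega> \<gamma> \<longrightarrow> (\<forall>b\<in>Basis. \<beta> b = \<gamma> b)"
    unfolding weight_def by (elim exE conjE)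
  have "inj_on (weight \<omega>) M"
  proof (rule inj_onI)
    fix \<beta> \<gamma> assume *: "\<beta> \<in> M" "\<gamma> \<in> M" "weight \<omega> \<beta> = weight \<omega> \<gamma>"
    then have "\<forall>b\<in>Basis. \<beta> b = \<gamma> b" using w(2) by blast
    then show "\<beta> = \<gamma>" using assms(2) *(1,2) by (intro ext) metis
  qed
  then show ?thesis using w(1) by blast
qed

text \<open>Kronecker substitution: with \<open>s ^ \<omega> b\<close> as coordinate at
  \<open>b\<close>, the monomials in \<open>M\<close> become distinct powers of \<open>s\<close>, so
  nothing cancels.\<close>

lemma mon_combination_nonzero:
  fixes M :: "('a::euclidean_space \<Rightarrow> nat) set"
  assumes M: "finite M" "\<forall>\<beta>\<in>M. \<forall>b. b \<notin> Basis \<longrightarrow> \<beta> b = 0" and "\<beta>0 \<in> M" "c \<beta>0 \<noteq> 0"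
  shows "\<exists>x. (\<Sum>\<beta>\<in>M. c \<beta> * mon \<beta> x) \<noteq> 0"
proof -
  obtain \<omega> where w: "inj_on (weight \<omega>) M" using separating_weight[OF M] by blast
  define q where "q = (\<Sum>\<beta>\<in>M. monom (c \<beta>) (weight \<omega> \<beta>))"
  have "coeff q (weight \<omega> \<beta>0) = (\<Sum>\<beta>\<in>M. if \<beta> = \<beta>0 then c \<beta>0 else 0)"
    unfolding q_def coeff_sum
    by (rule sum.cong) (use w assms(3) in \<open>auto simp: inj_on_def\<close>)
  then have "q \<noteq> 0" using assms by auto
  then have "finite {s. poly q s = 0}" by (rule poly_roots_finite)
  then obtain s where s: "poly q s \<noteq> 0"
    using ex_new_if_finite[OF infinite_UNIV_char_0] by blast
  define x where "x = (\<Sum>b\<in>Basis. s ^ \<omega> b *\<^sub>R (b::'a))"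
  have "mon \<beta> x = s ^ weight \<omega> \<beta>" for \<beta>
  proof -
    have "mon \<beta> x = (\<Prod>b\<in>Basis. s ^ (\<omega> b * \<beta> b))"
      unfolding mon_def by (rule prod.cong) (simp_all add: x_def power_mult)
    then show ?thesis by (simp add: weight_def power_sum)
  qed
  then have "(\<Sum>\<beta>\<in>M. c \<beta> * mon \<beta> x) = poly q s"
    by (simp add: q_def poly_sum poly_monom)
  then show ?thesis using s by metis
qed

section \<open>Standard monomials\<close>

text \<open>A bound on the dimension of the Zariski closure, phrased as: any \<open>k + 1\<close> of
  the coordinates satisfy a nontrivial relation on \<open>\<Gamma>\<close>. The monomial count uses
  only such relations.\<close>

definition alg_dim_le :: "'a::euclidean_space set \<Rightarrow> nat \<Rightarrow> bool" where
  "alg_dim_le \<Gamma> k \<longleftrightarrow> (\<forall>I\<subseteq>Basis. card I = Suc k \<longrightarrow> thin_in (coord_space I) (coord_proj I ` \<Gamma>))"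

text \<open>Each set \<open>I\<close> of \<open>k + 1\<close> coordinates has a relation with
  monomials supported in \<open>I\<close>. One weight separating all monomials of these finitely
  many relations singles out a leading monomial \<open>\<alpha> I\<close> in each, which is then
  expressed on \<open>\<Gamma>\<close> by the remaining ones.\<close>

lemma leading_reduction:
  fixes \<Gamma> :: "'a::euclidean_space set"
  assumes dim: "alg_dim_le \<Gamma> k"
  obtains \<omega> \<alpha> where "\<And>b. 1 \<le> \<omega> b"
    "\<And>I b. I \<subseteq> Basis \<Longrightarrow> card I = Suc k \<Longrightarrow> b \<notin> I \<Longrightarrow> \<alpha> I b = 0"
    "\<And>I. I \<subseteq> Basis \<Longrightarrow> card I = Suc k \<Longrightarrow> \<exists>M. finite M \<and> (\<forall>\<beta>\<in>M. weight \<omega> \<beta> < weight \<omega> (\<alpha> I) \<and> (\<forall>b. b \<notin> Basis \<longrightarrow> \<beta> b = 0)) \<and>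
        lincomb \<Gamma> M mon (mon (\<alpha> I))"
proof -
  define \<I> where "\<I> = {I. I \<subseteq> (Basis :: 'a set) \<and> card I = Suc k}"
  have fin\<I>: "finite \<I>" by (simp add: \<I>_def)
  have "\<forall>I\<in>\<I>. \<exists>N. finite N \<and> N \<noteq> {} \<and> (\<forall>\<beta>\<in>N. \<forall>b. b \<notin> I \<longrightarrow> \<beta> b = 0) \<and>
     (\<exists>c. (\<forall>\<beta>\<in>N. c \<beta> \<noteq> 0) \<and> (\<forall>x\<in>\<Gamma>. (\<Sum>\<beta>\<in>N. c \<beta> * mon \<beta> x) = 0))"
  proof
    fix I assume "I \<in> \<I>"
    then have I: "I \<subseteq> Basis" "card I = Suc k" by (auto simp: \<I>_def)
    have finI: "finite I" by (rule finite_subset[OF I(1) finite_Basis])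
    have "thin_in (coord_space I) (coord_proj I ` \<Gamma>)"
      using dim[unfolded alg_dim_le_def, rule_format, OF I] .
    then obtain p w where p: "real_polynomial_function p" "w \<in> coord_space I" "p w \<noteq> 0"
      "\<forall>x\<in>coord_proj I ` \<Gamma>. p x = 0"
      unfolding thin_in_def by blast
    obtain d where "poly_deg d p" using real_polynomial_function_imp_poly_deg[OF p(1)] by blast
    from poly_deg_expand[OF this I(1)]
    obtain c where c: "\<And>x. p (coord_proj I x) = (\<Sum>\<beta>\<in>exps I d. c \<beta> * mon \<beta> x)"
      unfolding lincomb_def by blast
    define N where "N = {\<beta> \<in> exps I d. c \<beta> \<noteq> 0}"
    have N: "(\<Sum>\<beta>\<in>N. c \<beta> * mon \<beta> x) = p (coord_proj I x)" for x
      unfolding c by (rule sum.mono_neutral_left) (use finite_exps[OF finI] in \<open>auto simp: N_def\<close>)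
    have "coord_proj I w = w"
    proof (rule euclidean_eqI)
      fix b :: 'a assume "b \<in> Basis"
      then show "coord_proj I w \<bullet> b = w \<bullet> b" using p(2) by (simp add: coord_proj_inner[OF I(1)] coord_space_def)
    qed
    then have "N \<noteq> {}" using N[of w] p(3) by auto
    moreover have "finite N" using finite_exps[OF finI] by (simp add: N_def)
    moreover have "\<forall>\<beta>\<in>N. \<forall>b. b \<notin> I \<longrightarrow> \<beta> b = 0" by (simp add: N_def exps_def)
    moreover have "\<forall>x\<in>\<Gamma>. (\<Sum>\<beta>\<in>N. c \<beta> * mon \<beta> x) = 0" using N p(4) by simp
    moreover have "\<forall>\<beta>\<in>N. c \<beta> \<noteq> 0" by (simp add: N_def)
    ultimately show "\<exists>N. finite N \<and> N \<noteq> {} \<and> (\<forall>\<beta>\<in>N. \<forall>b. b \<notin> I \<longrightarrow> \<beta> b = 0) \<and>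
       (\<exists>c. (\<forall>\<beta>\<in>N. c \<beta> \<noteq> 0) \<and> (\<forall>x\<in>\<Gamma>. (\<Sum>\<beta>\<in>N. c \<beta> * mon \<beta> x) = 0))"
      by (intro exI[of _ N] conjI exI[of _ c])
  qed
  from bchoice[OF this] obtain N where N0: "\<forall>I\<in>\<I>. finite (N I) \<and> N I \<noteq> {} \<and> (\<forall>\<beta>\<in>N I. \<forall>b. b \<notin> I \<longrightarrow> \<beta> b = 0) \<and>
     (\<exists>c. (\<forall>\<beta>\<in>N I. c \<beta> \<noteq> 0) \<and> (\<forall>x\<in>\<Gamma>. (\<Sum>\<beta>\<in>N I. c \<beta> * mon \<beta> x) = 0))" by (elim exE)
  have N: "\<And>I. I \<in> \<I> \<Longrightarrow> finite (N I)" "\<And>I. I \<in> \<I> \<Longrightarrow> N I \<noteq> {}"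
    "\<And>I \<beta> b. I \<in> \<I> \<Longrightarrow> \<beta> \<in> N I \<Longrightarrow> b \<notin> I \<Longrightarrow> \<beta> b = 0"
    "\<And>I. I \<in> \<I> \<Longrightarrow> \<exists>c. (\<forall>\<beta>\<in>N I. c \<beta> \<noteq> 0) \<and> (\<forall>x\<in>\<Gamma>. (\<Sum>\<beta>\<in>N I. c \<beta> * mon \<beta> x) = 0)"
    using N0 by simp_all
  have NB: "\<beta> b = 0" if "I \<in> \<I>" "\<beta> \<in> N I" "b \<notin> Basis" for I \<beta> b
    using N(3)[OF that(1,2)] that(1,3) by (auto simp: \<I>_def)
  have u1: "finite (\<Union>I\<in>\<I>. N I)" using fin\<I> N(1) by simp
  have u2: "\<forall>\<beta>\<in>(\<Union>I\<in>\<I>. N I). \<forall>b. b \<notin> Basis \<longrightarrow> \<beta> b = 0" using NB by blast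
  obtain \<omega> where w: "\<And>b. 1 \<le> \<omega> b" "inj_on (weight \<omega>) (\<Union>I\<in>\<I>. N I)"
    using separating_weight[OF u1 u2] by blast
  have "\<exists>\<alpha>\<in>N I. \<forall>\<beta>\<in>N I. weight \<omega> \<beta> \<le> weight \<omega> \<alpha>" if "I \<in> \<I>" for I
  proof -
    have "Max (weight \<omega> ` N I) \<in> weight \<omega> ` N I" using N(1,2)[OF that] by simp
    then obtain \<alpha> where "\<alpha> \<in> N I" "Max (weight \<omega> ` N I) = weight \<omega> \<alpha>" by blast
    then show ?thesis using N(1)[OF that] by (intro bexI[of _ \<alpha>]) (auto simp flip: \<open>Max _ = _\<close>)
  qed
  then have "\<forall>I\<in>\<I>. \<exists>\<alpha>. \<alpha> \<in> N I \<and> (\<forall>\<beta>\<in>N I. weight \<omega> \<beta> \<le> weight \<omega> \<alpha>)" by blast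
  from bchoice[OF this] obtain \<alpha> where a: "\<And>I. I \<in> \<I> \<Longrightarrow> \<alpha> I \<in> N I"
    "\<And>I \<beta>. I \<in> \<I> \<Longrightarrow> \<beta> \<in> N I \<Longrightarrow> weight \<omega> \<beta> \<le> weight \<omega> (\<alpha> I)" by blast
  show ?thesis
  proof (rule that[OF w(1)])
    fix I :: "'a set" and b :: 'a assume I: "I \<subseteq> Basis" "card I = Suc k"
    then have II: "I \<in> \<I>" by (simp add: \<I>_def)
    show "\<alpha> I b = 0" if "b \<notin> I" using N(3)[OF II a(1)[OF II] that] .
    obtain c where c: "\<forall>\<beta>\<in>N I. c \<beta> \<noteq> 0" "\<forall>x\<in>\<Gamma>. (\<Sum>\<beta>\<in>N I. c \<beta> * mon \<beta> x) = 0"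
      using N(4)[OF II] by blast
    define M where "M = N I - {\<alpha> I}"
    have "weight \<omega> \<beta> < weight \<omega> (\<alpha> I)" if "\<beta> \<in> M" for \<beta>
    proof -
      have "\<beta> \<in> (\<Union>I\<in>\<I>. N I)" "\<alpha> I \<in> (\<Union>I\<in>\<I>. N I)" "\<beta> \<noteq> \<alpha> I" "\<beta> \<in> N I"
        using that II a(1)[OF II] by (auto simp: M_def)
      then have "weight \<omega> \<beta> \<noteq> weight \<omega> (\<alpha> I)" using inj_onD[OF w(2)] by blast
      then show ?thesis using a(2)[OF II \<open>\<beta> \<in> N I\<close>] by simp
    qed
    moreover have "finite M" using N(1)[OF II] by (simp add: M_def)
    moreover have "\<beta> b = 0" if "\<beta> \<in> M" "b \<notin> Basis" for \<beta> b
      using NB[OF II _ that(2)] that(1) by (simp add: M_def)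
    moreover have "lincomb \<Gamma> M mon (mon (\<alpha> I))"
      unfolding lincomb_def
    proof (intro exI ballI)
      fix x assume "x \<in> \<Gamma>"
      have "0 = c (\<alpha> I) * mon (\<alpha> I) x + (\<Sum>\<beta>\<in>M. c \<beta> * mon \<beta> x)"
        using c(2) \<open>x \<in> \<Gamma>\<close> sum.remove[OF N(1)[OF II] a(1)[OF II], of "\<lambda>\<beta>. c \<beta> * mon \<beta> x"]
        by (simp add: M_def)
      then have "c (\<alpha> I) * mon (\<alpha> I) x = - (\<Sum>\<beta>\<in>M. c \<beta> * mon \<beta> x)" by linarith
      moreover have "c (\<alpha> I) \<noteq> 0" using c(1) a(1)[OF II] by blast
      ultimately have "mon (\<alpha> I) x = - (\<Sum>\<beta>\<in>M. c \<beta> * mon \<beta> x) / c (\<alpha> I)"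
        by (simp add: field_simps)
      also have "\<dots> = (\<Sum>\<beta>\<in>M. (- c \<beta> / c (\<alpha> I)) * mon \<beta> x)"
        by (simp add: sum_divide_distrib sum_negf)
      finally show "mon (\<alpha> I) x = (\<Sum>\<beta>\<in>M. (- c \<beta> / c (\<alpha> I)) * mon \<beta> x)" .
    qed
    ultimately show "\<exists>M. finite M \<and> (\<forall>\<beta>\<in>M. weight \<omega> \<beta> < weight \<omega> (\<alpha> I) \<and> (\<forall>b. b \<notin> Basis \<longrightarrow> \<beta> b = 0)) \<and>
        lincomb \<Gamma> M mon (mon (\<alpha> I))" by (intro exI[of _ M]) simp
  qed
qed

text \<open>Standard monomials: each monomial divisible by some leading monomial can be reduced, and
  a monomial divisible by none of them has at most \<open>k\<close> large exponents.\<close>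

lemma hilbert_function_bound:
  fixes \<Gamma> :: "'a::euclidean_space set"
  assumes "alg_dim_le \<Gamma> k"
  shows "\<exists>C. \<forall>d. \<exists>S. finite S \<and> card S \<le> C * (d + 1) ^ k \<and> (\<forall>p. poly_deg d p \<longrightarrow> lincomb \<Gamma> S mon p)"
proof -
  obtain \<omega> \<alpha> where w: "\<And>b. 1 \<le> \<omega> b"
    and a0: "\<And>I b. I \<subseteq> Basis \<Longrightarrow> card I = Suc k \<Longrightarrow> b \<notin> I \<Longrightarrow> \<alpha> I b = 0"
    and red: "\<And>I. I \<subseteq> Basis \<Longrightarrow> card I = Suc k \<Longrightarrow> \<exists>M. finite M \<and> (\<forall>\<beta>\<in>M. weight \<omega> \<beta> < weight \<omega> (\<alpha> I) \<and> (\<forall>b. b \<notin> Basis \<longrightarrow> \<beta> b = 0)) \<and>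
        lincomb \<Gamma> M mon (mon (\<alpha> I))"
    using leading_reduction[OF assms] by metis
  define n where "n = DIM('a)"
  define D where "D = Suc (Max (insert 0 ((\<lambda>(I, b). \<alpha> I b) ` (Pow Basis \<times> Basis))))"
  have D: "\<alpha> I b < D" if "I \<subseteq> Basis" "b \<in> Basis" for I b
  proof -
    have "finite (insert 0 ((\<lambda>(I, b). \<alpha> I b) ` (Pow Basis \<times> Basis)))" by simp
    moreover have "\<alpha> I b \<in> insert 0 ((\<lambda>(I, b). \<alpha> I b) ` (Pow Basis \<times> Basis))" using that by force
    ultimately show ?thesis unfolding D_def less_Suc_eq_le by (rule Max_ge)
  qed
  \<comment> \<open>Standard monomials are bounded by weight and not by degree, because rewriting
    lowers the weight but may raise the degree.\<close>
  define St where "St = (\<lambda>d. {\<beta>. (\<forall>b. b \<notin> Basis \<longrightarrow> \<beta> b = 0) \<and> weight \<omega> \<beta> \<le> d \<and>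
     (\<forall>I\<subseteq>Basis. card I = Suc k \<longrightarrow> \<not> (\<forall>b. \<alpha> I b \<le> \<beta> b))})"
  have small: "\<beta> b \<le> d" if "weight \<omega> \<beta> \<le> d" "b \<in> Basis" for \<beta> b d
  proof -
    have "\<beta> b \<le> \<omega> b * \<beta> b" using w[of b] by simp
    also have "\<dots> \<le> weight \<omega> \<beta>" unfolding weight_def using that(2) by (intro member_le_sum) auto
    finally show ?thesis using that(1) by simp
  qed
  \<comment> \<open>At most \<open>k\<close> exponents of a standard monomial reach
    \<open>D\<close>, since otherwise it would be divisible by some \<open>\<alpha> I\<close>.
    \<open>J\<close> collects the positions of these exponents, which are at most \<open>d\<close>;
    all others are below \<open>D\<close>.\<close>
  define cover where "cover = (\<lambda>d. \<Union>J\<in>{J. J \<subseteq> (Basis::'a set) \<and> card J \<le> k}. PiE Basis (\<lambda>b. if b \<in> J then {..d} else {..<D}))"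
  have fincov: "finite (cover d)" for d
    unfolding cover_def by (intro finite_UN_I finite_PiE) auto
  have rst: "(\<lambda>\<beta>. restrict \<beta> Basis) ` St d \<subseteq> cover d" for d
  proof (rule image_subsetI)
    fix \<beta> assume b: "\<beta> \<in> St d"
    define J where "J = {b \<in> Basis. D \<le> \<beta> b}"
    have "card J \<le> k"
    proof (rule ccontr)
      assume "\<not> ?thesis"
      then have "Suc k \<le> card J" by simp
      then obtain I where I: "I \<subseteq> J" "card I = Suc k" by (meson obtain_subset_with_card_n)
      then have IB: "I \<subseteq> Basis" by (auto simp: J_def)
      have "\<alpha> I b \<le> \<beta> b" for b
      proof (cases "b \<in> I")
        case True
        then have "\<alpha> I b < D" "D \<le> \<beta> b" using D[OF IB, of b] IB I(1) by (auto simp: J_def)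
        then show ?thesis by simp
      next
        case False
        then show ?thesis using a0[OF IB I(2)] by simp
      qed
      then show False using b IB I(2) unfolding St_def by blast
    qed
    moreover have "restrict \<beta> Basis \<in> PiE Basis (\<lambda>b. if b \<in> J then {..d} else {..<D})"
      using b small by (auto simp: St_def J_def)
    moreover have "J \<subseteq> Basis" by (auto simp: J_def)
    ultimately show "restrict \<beta> Basis \<in> cover d" unfolding cover_def by blast
  qed
  have inj: "inj_on (\<lambda>\<beta>. restrict \<beta> Basis) (St d)" for d
  proof (rule inj_onI)
    fix \<beta> \<gamma> :: "'a \<Rightarrow> nat" assume *: "\<beta> \<in> St d" "\<gamma> \<in> St d" "restrict \<beta> Basis = restrict \<gamma> Basis"
    show "\<beta> = \<gamma>"
    proof
      fix b
      have r: "restrict \<beta> Basis b = restrict \<gamma> Basis b" using *(3) by simp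
      show "\<beta> b = \<gamma> b"
      proof (cases "b \<in> Basis")
        case False
        then show ?thesis using *(1,2) by (simp add: St_def)
      qed (use r in simp)
    qed
  qed
  have finSt: "finite (St d)" for d
    using inj_on_finite[OF inj rst fincov] .
  define C where "C = 2 ^ n * D ^ n"
  have card: "card (St d) \<le> C * (d + 1) ^ k" for d
  proof -
    have "card (St d) \<le> card (cover d)" by (rule card_inj_on_le[OF inj rst fincov])
    also have "\<dots> \<le> (\<Sum>J\<in>{J. J \<subseteq> (Basis::'a set) \<and> card J \<le> k}. card (PiE Basis (\<lambda>b. if b \<in> J then {..d} else {..<D})))"
      unfolding cover_def by (rule card_UN_le) simp
    also have "\<dots> \<le> (\<Sum>J\<in>{J. J \<subseteq> (Basis::'a set) \<and> card J \<le> k}. (d + 1) ^ k * D ^ n)"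
    proof (rule sum_mono)
      fix J assume "J \<in> {J. J \<subseteq> (Basis::'a set) \<and> card J \<le> k}"
      then have J: "J \<subseteq> Basis" "card J \<le> k" by auto
      have "card (PiE Basis (\<lambda>b. if b \<in> J then {..d} else {..<D})) = (\<Prod>b\<in>(Basis::'a set). if b \<in> J then d + 1 else D)"
        by (subst card_PiE) (auto intro!: prod.cong)
      also have "\<dots> \<le> (\<Prod>b\<in>(Basis::'a set). (if b \<in> J then d + 1 else 1) * D)"
      proof (rule prod_mono)
        have "1 \<le> D" by (simp add: D_def)
        then have "Suc d \<le> Suc d * D" using mult_le_mono2[of 1 D "Suc d"] by simp
        then show "0 \<le> (if b \<in> J then d + 1 else D) \<and> (if b \<in> J then d + 1 else D) \<le> (if b \<in> J then d + 1 else 1) * D" for b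
          by auto
      qed
      also have "\<dots> = (d + 1) ^ card J * D ^ n"
        using J(1) by (simp add: prod.distrib n_def prod.If_cases Int_absorb1)
      also have "\<dots> \<le> (d + 1) ^ k * D ^ n"
        using J(2) by (intro mult_right_mono power_increasing) auto
      finally show "card (PiE Basis (\<lambda>b. if b \<in> J then {..d} else {..<D})) \<le> (d + 1) ^ k * D ^ n" .
    qed
    also have "\<dots> = card {J. J \<subseteq> (Basis::'a set) \<and> card J \<le> k} * ((d + 1) ^ k * D ^ n)" by simp
    also have "\<dots> \<le> 2 ^ n * ((d + 1) ^ k * D ^ n)"
    proof (rule mult_right_mono)
      have "card {J. J \<subseteq> (Basis::'a set) \<and> card J \<le> k} \<le> card (Pow (Basis::'a set))"
        by (rule card_mono) auto
      then show "card {J. J \<subseteq> (Basis::'a set) \<and> card J \<le> k} \<le> 2 ^ n" by (simp add: card_Pow n_def)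
    qed simp
    finally show ?thesis by (simp add: C_def mult_ac)
  qed
  \<comment> \<open>Induction on the weight: the factor \<open>\<alpha> I\<close> is split off and
    rewritten, and multiplication by the rest \<open>\<delta>\<close> preserves the drop in
    weight.\<close>
  have reduce: "lincomb \<Gamma> (St d) mon (mon \<beta>)"
    if "\<forall>b. b \<notin> Basis \<longrightarrow> \<beta> b = 0" "weight \<omega> \<beta> \<le> d" for \<beta> d
    using that
  proof (induction "weight \<omega> \<beta>" arbitrary: \<beta> rule: less_induct)
    case less
    show ?case
    proof (cases "\<beta> \<in> St d")
      case True
      then show ?thesis by (rule lincomb_basis[OF finSt])
    next
      case False
      then obtain I where I: "I \<subseteq> Basis" "card I = Suc k" "\<forall>b. \<alpha> I b \<le> \<beta> b"
        using less.prems unfolding St_def by blast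
      obtain M where M: "finite M" "\<forall>\<gamma>\<in>M. weight \<omega> \<gamma> < weight \<omega> (\<alpha> I) \<and> (\<forall>b. b \<notin> Basis \<longrightarrow> \<gamma> b = 0)"
        "lincomb \<Gamma> M mon (mon (\<alpha> I))" using red[OF I(1,2)] by blast
      define \<delta> where "\<delta> = (\<lambda>b. \<beta> b - \<alpha> I b)"
      have \<beta>: "\<beta> = (\<lambda>b. \<alpha> I b + \<delta> b)" using I(3) by (auto simp: \<delta>_def)
      have W: "weight \<omega> \<beta> = weight \<omega> (\<alpha> I) + weight \<omega> \<delta>" by (subst \<beta>) (rule weight_add)
      have "lincomb \<Gamma> (St d) mon (\<lambda>x. mon \<gamma> x * mon \<delta> x)" if "\<gamma> \<in> M" for \<gamma>
      proof -
        have "weight \<omega> (\<lambda>b. \<gamma> b + \<delta> b) < weight \<omega> \<beta>"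
          using M(2) that unfolding weight_add W by simp
        moreover have "\<forall>b. b \<notin> Basis \<longrightarrow> \<gamma> b + \<delta> b = 0"
          using M(2) that less.prems(1) by (simp add: \<delta>_def)
        ultimately have "lincomb \<Gamma> (St d) mon (mon (\<lambda>b. \<gamma> b + \<delta> b))"
          using less.hyps[of "\<lambda>b. \<gamma> b + \<delta> b"] less.prems(2) by simp
        then show ?thesis by (rule lincomb_cong) (simp add: mon_add)
      qed
      moreover have "lincomb \<Gamma> {()} (\<lambda>_. mon \<delta>) (mon \<delta>)" by (rule lincomb_basis) auto
      ultimately have "lincomb \<Gamma> (St d) mon (\<lambda>x. mon (\<alpha> I) x * mon \<delta> x)"
        by (intro lincomb_mult[OF M(3)])
      then show ?thesis by (rule lincomb_cong) (subst \<beta>, simp add: mon_add)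
    qed
  qed
  \<comment> \<open>Degree at most \<open>d\<close> implies weight at most \<open>m * d\<close>,
    which affects only the constant of the bound.\<close>
  define m where "m = Max (insert 0 (\<omega> ` Basis))"
  have m: "\<omega> b \<le> m" if "b \<in> Basis" for b
    unfolding m_def using that by (intro Max_ge) auto
  have "\<exists>S. finite S \<and> card S \<le> (C * (m + 1) ^ k) * (d + 1) ^ k \<and> (\<forall>p. poly_deg d p \<longrightarrow> lincomb \<Gamma> S mon p)" for d
  proof (intro exI conjI allI impI)
    show "finite (St (m * d))" by (rule finSt)
    have "card (St (m * d)) \<le> C * (m * d + 1) ^ k" by (rule card)
    also have "\<dots> \<le> C * ((m + 1) * (d + 1)) ^ k"
      by (intro mult_left_mono power_mono) (auto simp: algebra_simps)
    finally show "card (St (m * d)) \<le> (C * (m + 1) ^ k) * (d + 1) ^ k"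
      by (simp only: power_mult_distrib mult.assoc)
    fix p :: "'a \<Rightarrow> real" assume p: "poly_deg d p"
    have "coord_proj Basis x = x" for x :: 'a by (simp add: coord_proj_def euclidean_representation)
    then have "lincomb UNIV (exps Basis d) mon p" using poly_deg_expand[OF p, of Basis] by simp
    then have "lincomb \<Gamma> (exps Basis d) mon p" by (rule lincomb_subset) simp
    then show "lincomb \<Gamma> (St (m * d)) mon p"
    proof (rule lincomb_trans)
      fix \<beta> :: "'a \<Rightarrow> nat" assume b: "\<beta> \<in> exps Basis d"
      have "weight \<omega> \<beta> \<le> (\<Sum>b\<in>Basis. m * \<beta> b)"
        unfolding weight_def by (intro sum_mono mult_right_mono m) auto
      also have "\<dots> \<le> m * d" using b by (simp add: exps_def sum_distrib_left[symmetric])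
      finally show "lincomb \<Gamma> (St (m * d)) mon (mon \<beta>)"
        using b by (intro reduce) (auto simp: exps_def)
    qed
  qed
  then show ?thesis by blast
qed

section \<open>Dimension of products and algebraic dependence\<close>

lemma coord_proj_coord_space:
  assumes "I \<subseteq> Basis" "w \<in> coord_space I" shows "coord_proj I w = w"
proof (rule euclidean_eqI)
  fix b :: 'a assume "b \<in> Basis"
  then show "coord_proj I w \<bullet> b = w \<bullet> b" using assms by (simp add: coord_proj_inner coord_space_def)
qed

lemma alg_dim_le_large:
  assumes "alg_dim_le \<Gamma> k" "I \<subseteq> Basis" "k < card I"
  shows "\<exists>J p w. J \<subseteq> I \<and> real_polynomial_function p \<and> w \<in> coord_space J \<and> p w \<noteq> 0 \<and>
    (\<forall>z\<in>\<Gamma>. p (coord_proj J z) = 0)"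
proof -
  obtain J where J: "J \<subseteq> I" "card J = Suc k" using assms(3) by (meson Suc_leI obtain_subset_with_card_n)
  have "J \<subseteq> Basis" using J(1) assms(2) by (rule order_trans)
  then have "thin_in (coord_space J) (coord_proj J ` \<Gamma>)"
    using assms(1)[unfolded alg_dim_le_def, rule_format, OF _ J(2)] by simp
  then obtain p w where "real_polynomial_function p" "w \<in> coord_space J" "p w \<noteq> 0"
      "\<forall>x\<in>coord_proj J ` \<Gamma>. p x = 0"
    unfolding thin_in_def by (elim exE conjE bexE)
  then show ?thesis using J(1) by (intro exI[of _ J] exI[of _ p] exI[of _ w]) simp
qed

lemma thin_in_via_linear:
  fixes \<Gamma> :: "'a::euclidean_space set" and g :: "'a \<Rightarrow> 'b::euclidean_space"
  assumes "I \<subseteq> Basis" "bounded_linear g" "real_polynomial_function p" "w \<in> coord_space I" "p (g w) \<noteq> 0"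
    "\<And>z. z \<in> \<Gamma> \<Longrightarrow> p (g (coord_proj I z)) = 0"
  shows "thin_in (coord_space I) (coord_proj I ` \<Gamma>)"
  unfolding thin_in_def
  by (rule exI[of _ "\<lambda>x. p (g x)"])
    (use assms real_polynomial_function_comp[OF polynomial_function_bounded_linear[OF assms(2)] assms(3)] in auto)

text \<open>Pigeonhole: among \<open>k + l + 1\<close> coordinates of the product, more than
  \<open>k\<close> belong to the first factor or more than \<open>l\<close> to the second, and a
  relation for that factor stays nontrivial on the product.\<close>

lemma alg_dim_le_Times:
  fixes A :: "'a::euclidean_space set" and B :: "'b::euclidean_space set"
  assumes A: "alg_dim_le A k" and B: "alg_dim_le B l"
  shows "alg_dim_le (A \<times> B) (k + l)"
  unfolding alg_dim_le_def
proof (intro allI impI)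
  fix I :: "('a \<times> 'b) set" assume I: "I \<subseteq> Basis" "card I = Suc (k + l)"
  define I1 where "I1 = {b \<in> Basis. (b, 0) \<in> I}"
  define I2 where "I2 = {b \<in> Basis. (0, b) \<in> I}"
  have fin: "finite I1" "finite I2" by (simp_all add: I1_def I2_def)
  have "I \<subseteq> (\<lambda>b. (b, 0)) ` I1 \<union> (\<lambda>b. (0, b)) ` I2"
    using I(1) by (auto simp: I1_def I2_def Basis_prod_def)
  then have "card I \<le> card ((\<lambda>b. (b, 0::'b)) ` I1 \<union> (\<lambda>b. (0::'a, b)) ` I2)"
    using fin by (intro card_mono) auto
  also have "\<dots> \<le> card ((\<lambda>b. (b, 0::'b)) ` I1) + card ((\<lambda>b. (0::'a, b)) ` I2)" by (rule card_Un_le)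
  also have "\<dots> \<le> card I1 + card I2" using fin by (intro add_mono card_image_le)
  finally have "k < card I1 \<or> l < card I2" using I(2) by linarith
  then show "thin_in (coord_space I) (coord_proj I ` (A \<times> B))"
  proof
    assume c: "k < card I1"
    have I1: "I1 \<subseteq> Basis" by (auto simp: I1_def)
    obtain J p w where J: "J \<subseteq> I1" and p: "real_polynomial_function p" "w \<in> coord_space J" "p w \<noteq> 0"
      "\<forall>z\<in>A. p (coord_proj J z) = 0" using alg_dim_le_large[OF A I1 c] by blast
    have JB: "J \<subseteq> Basis" using J I1 by (rule order_trans)
    show ?thesis
    proof (rule thin_in_via_linear[OF I(1) _ p(1)])
      show "bounded_linear (\<lambda>x. coord_proj J (fst x))"
        by (rule bounded_linear_compose[OF bounded_linear_coord_proj bounded_linear_fst])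
      show "(w, 0) \<in> coord_space I"
        using p(2) J by (auto simp: coord_space_def Basis_prod_def I1_def subset_iff)
      show "p (coord_proj J (fst (w, 0))) \<noteq> 0" using p(2,3) by (simp add: coord_proj_coord_space[OF JB])
      fix z assume "z \<in> A \<times> B"
      have "fst (coord_proj I z) \<bullet> b = fst z \<bullet> b" if "b \<in> J" for b
      proof -
        have b: "b \<in> Basis" "(b, 0) \<in> I" using that J by (auto simp: I1_def)
        have "fst (coord_proj I z) \<bullet> b = coord_proj I z \<bullet> (b, 0)" by (simp add: inner_prod_def)
        also have "\<dots> = z \<bullet> (b, 0)" using b coord_proj_inner[OF I(1), of "(b, 0)" z] I(1) by auto
        finally show ?thesis by (simp add: inner_prod_def)
      qed
      then have "coord_proj J (fst (coord_proj I z)) = coord_proj J (fst z)"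
        unfolding coord_proj_def[of J] by (intro sum.cong refl) simp
      then show "p (coord_proj J (fst (coord_proj I z))) = 0" using p(4) \<open>z \<in> A \<times> B\<close> by auto
    qed
  next
    assume c: "l < card I2"
    have I2: "I2 \<subseteq> Basis" by (auto simp: I2_def)
    obtain J p w where J: "J \<subseteq> I2" and p: "real_polynomial_function p" "w \<in> coord_space J" "p w \<noteq> 0"
      "\<forall>z\<in>B. p (coord_proj J z) = 0" using alg_dim_le_large[OF B I2 c] by blast
    have JB: "J \<subseteq> Basis" using J I2 by (rule order_trans)
    show ?thesis
    proof (rule thin_in_via_linear[OF I(1) _ p(1)])
      show "bounded_linear (\<lambda>x. coord_proj J (snd x))"
        by (rule bounded_linear_compose[OF bounded_linear_coord_proj bounded_linear_snd])
      show "(0, w) \<in> coord_space I"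
        using p(2) J by (auto simp: coord_space_def Basis_prod_def I2_def subset_iff)
      show "p (coord_proj J (snd (0, w))) \<noteq> 0" using p(2,3) by (simp add: coord_proj_coord_space[OF JB])
      fix z assume "z \<in> A \<times> B"
      have "snd (coord_proj I z) \<bullet> b = snd z \<bullet> b" if "b \<in> J" for b
      proof -
        have b: "b \<in> Basis" "(0, b) \<in> I" using that J by (auto simp: I2_def)
        have "snd (coord_proj I z) \<bullet> b = coord_proj I z \<bullet> (0, b)" by (simp add: inner_prod_def)
        also have "\<dots> = z \<bullet> (0, b)" using b coord_proj_inner[OF I(1), of "(0, b)" z] I(1) by auto
        finally show ?thesis by (simp add: inner_prod_def)
      qed
      then have "coord_proj J (snd (coord_proj I z)) = coord_proj J (snd z)"
        unfolding coord_proj_def[of J] by (intro sum.cong refl) simp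
      then show "p (coord_proj J (snd (coord_proj I z))) = 0" using p(4) \<open>z \<in> A \<times> B\<close> by auto
    qed
  qed
qed

text \<open>\<open>I\<close> is larger than \<open>J\<close>, so one of its coordinates vanishes on
  \<open>coord_space J\<close> and is itself the relation.\<close>

lemma alg_dim_le_coord_space:
  fixes J :: "'a::euclidean_space set"
  assumes "J \<subseteq> Basis" shows "alg_dim_le (coord_space J) (card J)"
  unfolding alg_dim_le_def
proof (intro allI impI)
  fix I :: "'a set" assume I: "I \<subseteq> Basis" "card I = Suc (card J)"
  have "\<not> I \<subseteq> J" using card_mono[OF finite_subset[OF assms finite_Basis], of I] I(2) by auto
  then obtain b where b: "b \<in> I" "b \<notin> J" by blast
  then have bB: "b \<in> Basis" using I(1) by blast
  show "thin_in (coord_space I) (coord_proj I ` coord_space J)"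
  proof (rule thin_in_via_linear[OF I(1) bounded_linear_ident])
    show "real_polynomial_function (\<lambda>x. x \<bullet> b)"
      by (intro real_polynomial_function.intros(1) bounded_linear_inner_left)
    show "b \<in> coord_space I" using b(1) bB by (auto simp: coord_space_def inner_Basis)
    show "b \<bullet> b \<noteq> 0" using bB by (simp add: inner_Basis)
    show "coord_proj I z \<bullet> b = 0" if "z \<in> coord_space J" for z
      using that b bB I(1) by (simp add: coord_proj_inner coord_space_def)
  qed
qed

lemma real_polynomial_function_mon: "real_polynomial_function (mon \<beta>)"
  unfolding mon_def
  by (intro real_polynomial_function_prod real_polynomial_function_power
    real_polynomial_function.intros(1) bounded_linear_inner_left) simp

text \<open>Counting: the monomials of bounded degree in \<open>v\<close> outnumber the dimension of the space of
  polynomials of comparable degree on \<open>\<Omega>\<close>.\<close>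

lemma algebraic_relation:
  fixes \<Omega> :: "'w::euclidean_space set" and v :: "'w \<Rightarrow> 'e::euclidean_space"
  assumes dim: "alg_dim_le \<Omega> \<kappa>" "\<kappa> < DIM('e)"
    and D: "real_polynomial_function D"
    and v: "\<And>b. b \<in> Basis \<Longrightarrow> \<exists>f. real_polynomial_function f \<and> (\<forall>x\<in>\<Omega>. D x \<noteq> 0 \<longrightarrow> D x * (v x \<bullet> b) = f x)"
  shows "\<exists>q. real_polynomial_function q \<and> (\<exists>y. q y \<noteq> 0) \<and> (\<forall>x\<in>\<Omega>. D x \<noteq> 0 \<longrightarrow> q (v x) = 0)"
proof -
  have "\<forall>b\<in>Basis. \<exists>f. real_polynomial_function f \<and> (\<forall>x\<in>\<Omega>. D x \<noteq> 0 \<longrightarrow> D x * (v x \<bullet> b) = f x)"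
    using v by blast
  from bchoice[OF this] obtain f where f: "\<And>b. b \<in> Basis \<Longrightarrow> real_polynomial_function (f b)"
    "\<And>b x. b \<in> Basis \<Longrightarrow> x \<in> \<Omega> \<Longrightarrow> D x \<noteq> 0 \<Longrightarrow> D x * (v x \<bullet> b) = f b x" by blast
  have "\<forall>b\<in>Basis. \<exists>d. poly_deg d (f b)" using f(1) real_polynomial_function_imp_poly_deg by blast
  from bchoice[OF this] obtain df where df: "\<forall>b\<in>Basis. poly_deg (df b) (f b)" by blast
  obtain dD where dD: "poly_deg dD D" using real_polynomial_function_imp_poly_deg[OF D] by blast
  define c where "c = Max (insert dD (df ` Basis))"
  have cD: "poly_deg c D" by (rule poly_deg_mono[OF dD]) (simp add: c_def)
  have cf: "poly_deg c (f b)" if "b \<in> Basis" for b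
  proof (rule poly_deg_mono)
    show "poly_deg (df b) (f b)" using df that by blast
    show "df b \<le> c" unfolding c_def using that by (intro Max_ge) auto
  qed
  obtain C where C: "\<And>d. \<exists>S. finite S \<and> card S \<le> C * (d + 1) ^ \<kappa> \<and> (\<forall>p. poly_deg d p \<longrightarrow> lincomb \<Omega> S mon p)"
    using hilbert_function_bound[OF dim(1)] by blast
  define N where "N = DIM('e)"
  \<comment> \<open>Chosen so that the Hilbert bound for degree \<open>N * (d * c)\<close> is at
    most \<open>d * (d + 1) ^ \<kappa>\<close>, which is less than the number
    \<open>(d + 1) ^ N\<close> of monomials because \<open>\<kappa> < N\<close>.\<close>
  define d where "d = C * (N * c + 1) ^ \<kappa>"
  define ext where "ext = (\<lambda>(\<beta> :: 'e \<Rightarrow> nat) b. if b \<in> Basis then \<beta> b else 0)"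
  define J where "J = ext ` (PiE Basis (\<lambda>_. {..d}))"
  have finJ: "finite J" unfolding J_def by (intro finite_imageI finite_PiE) auto
  have inj: "inj_on ext (PiE Basis (\<lambda>_. {..d}))"
  proof (rule inj_onI)
    fix \<beta> \<gamma> :: "'e \<Rightarrow> nat" assume *: "\<beta> \<in> PiE Basis (\<lambda>_. {..d})" "\<gamma> \<in> PiE Basis (\<lambda>_. {..d})" "ext \<beta> = ext \<gamma>"
    show "\<beta> = \<gamma>"
    proof (rule PiE_ext[OF *(1,2)])
      fix b :: 'e assume "b \<in> Basis"
      then show "\<beta> b = \<gamma> b" using fun_cong[OF *(3), of b] by (simp add: ext_def)
    qed
  qed
  have cardJ: "card J = (d + 1) ^ N"
    unfolding J_def card_image[OF inj] by (simp add: card_PiE N_def)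
  have Jd: "\<beta> b \<le> d" if "\<beta> \<in> J" "b \<in> Basis" for \<beta> b using that by (auto simp: J_def ext_def)
  have J0: "\<forall>\<beta>\<in>J. \<forall>b. b \<notin> Basis \<longrightarrow> \<beta> b = 0" by (auto simp: J_def ext_def)
  obtain S where S: "finite S" "card S \<le> C * (N * (d * c) + 1) ^ \<kappa>"
    "\<And>p. poly_deg (N * (d * c)) p \<Longrightarrow> lincomb \<Omega> S mon p" using C[of "N * (d * c)"] by blast
  \<comment> \<open>Denominators cleared: where \<open>D x\<close> is nonzero on
    \<open>\<Omega>\<close>, this is \<open>D x ^ (N * d)\<close> times the monomial
    \<open>\<beta>\<close> at \<open>v x\<close>.\<close>
  define g where "g = (\<lambda>\<beta> x. \<Prod>b\<in>Basis. f b x ^ \<beta> b * D x ^ (d - \<beta> b))"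
  have gdeg: "poly_deg (N * (d * c)) (g \<beta>)" if "\<beta> \<in> J" for \<beta>
    unfolding g_def N_def
  proof (rule poly_deg_prod)
    fix b :: 'e assume b: "b \<in> Basis"
    have "poly_deg (\<beta> b * c + (d - \<beta> b) * c) (\<lambda>x. f b x ^ \<beta> b * D x ^ (d - \<beta> b))"
      by (intro poly_deg.mult poly_deg_power cf[OF b] cD)
    moreover have "\<beta> b * c + (d - \<beta> b) * c = d * c"
      using Jd[OF that b] by (simp add: distrib_right[symmetric])
    ultimately show "poly_deg (d * c) (\<lambda>x. f b x ^ \<beta> b * D x ^ (d - \<beta> b))" by simp
  qed simp
  have "card S < card J"
  proof -
    have "N * (d * c) + 1 \<le> (N * c + 1) * (d + 1)" by (simp add: algebra_simps)
    then have "card S \<le> C * ((N * c + 1) * (d + 1)) ^ \<kappa>"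
      using S(2) by (meson mult_le_mono2 order_trans power_mono zero_le)
    also have "\<dots> = d * (d + 1) ^ \<kappa>" by (simp only: d_def power_mult_distrib mult.assoc)
    also have "\<dots> < (d + 1) * (d + 1) ^ \<kappa>" by simp
    also have "\<dots> = (d + 1) ^ Suc \<kappa>" by simp
    also have "\<dots> \<le> (d + 1) ^ N" using dim(2) unfolding N_def by (intro power_increasing) auto
    finally show ?thesis by (simp add: cardJ)
  qed
  have "\<forall>\<beta>\<in>J. \<exists>a. \<forall>x\<in>\<Omega>. g \<beta> x = (\<Sum>s\<in>S. a s * mon s x)"
    using S(3)[OF gdeg] unfolding lincomb_def by blast
  from bchoice[OF this] obtain a where a: "\<forall>\<beta>\<in>J. \<forall>x\<in>\<Omega>. g \<beta> x = (\<Sum>s\<in>S. a \<beta> s * mon s x)" by blast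
  \<comment> \<open>More monomials than elements of \<open>S\<close>: some nontrivial combination of
    the \<open>g \<beta>\<close> has zero coordinates with respect to \<open>S\<close> and so
    vanishes on \<open>\<Omega>\<close>.\<close>
  obtain k where k: "\<exists>\<beta>\<in>J. k \<beta> \<noteq> 0" "\<forall>s\<in>S. (\<Sum>\<beta>\<in>J. k \<beta> * a \<beta> s) = 0"
    using homogeneous_system_solution[OF S(1) finJ \<open>card S < card J\<close>] by blast
  define q where "q = (\<lambda>y. \<Sum>\<beta>\<in>J. k \<beta> * mon \<beta> y)"
  have "q (v x) = 0" if x: "x \<in> \<Omega>" "D x \<noteq> 0" for x
  proof -
    have g: "g \<beta> x = D x ^ (N * d) * mon \<beta> (v x)" if "\<beta> \<in> J" for \<beta>
    proof -
      have "g \<beta> x = (\<Prod>b\<in>Basis. D x ^ d * (v x \<bullet> b) ^ \<beta> b)"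
        unfolding g_def
      proof (rule prod.cong)
        fix b :: 'e assume b: "b \<in> Basis"
        have "f b x ^ \<beta> b * D x ^ (d - \<beta> b) = (v x \<bullet> b) ^ \<beta> b * (D x ^ \<beta> b * D x ^ (d - \<beta> b))"
          by (simp add: f(2)[OF b x, symmetric] power_mult_distrib)
        also have "D x ^ \<beta> b * D x ^ (d - \<beta> b) = D x ^ d"
          using Jd[OF that b] by (simp add: power_add[symmetric])
        finally show "f b x ^ \<beta> b * D x ^ (d - \<beta> b) = D x ^ d * (v x \<bullet> b) ^ \<beta> b" by simp
      qed simp
      then show ?thesis by (simp add: prod.distrib mon_def N_def power_mult[symmetric] mult.commute[of d])
    qed
    have "D x ^ (N * d) * q (v x) = (\<Sum>\<beta>\<in>J. k \<beta> * g \<beta> x)"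
      unfolding q_def sum_distrib_left by (rule sum.cong) (simp_all add: g)
    also have "\<dots> = (\<Sum>\<beta>\<in>J. \<Sum>s\<in>S. k \<beta> * a \<beta> s * mon s x)"
      using a x(1) by (intro sum.cong refl) (simp add: sum_distrib_left mult.assoc)
    also have "\<dots> = (\<Sum>s\<in>S. \<Sum>\<beta>\<in>J. k \<beta> * a \<beta> s * mon s x)" by (rule sum.swap)
    also have "\<dots> = 0" using k(2) by (intro sum.neutral) (simp add: sum_distrib_right[symmetric])
    finally show ?thesis using x(2) by simp
  qed
  moreover have "\<exists>y. q y \<noteq> 0"
    using mon_combination_nonzero[OF finJ J0] k(1) unfolding q_def by blast
  moreover have "real_polynomial_function q"
    unfolding q_def
    by (intro real_polynomial_function_sum finJ real_polynomial_function.intros(2,4) real_polynomial_function_mon)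
  ultimately show ?thesis by blast
qed

text \<open>Dividing by the largest power of \<open>t\<close> makes the specialisation at \<open>t = 0\<close> nontrivial.\<close>

lemma relation_at_zero:
  fixes q :: "'a::euclidean_space \<times> real \<Rightarrow> real"
  assumes "real_polynomial_function q" "q y \<noteq> 0"
  shows "\<exists>p. real_polynomial_function p \<and> (\<exists>\<theta>. p \<theta> \<noteq> 0) \<and>
    (\<forall>\<theta>s ts \<theta>. (\<forall>\<^sub>F n in sequentially. ts n \<noteq> 0 \<and> q (\<theta>s n, ts n) = 0) \<longrightarrow> \<theta>s \<longlonglongrightarrow> \<theta> \<longrightarrow> ts \<longlonglongrightarrow> 0 \<longrightarrow> p \<theta> = 0)"
proof -
  obtain n P where P: "param_poly n P" "\<And>\<theta> t. q (\<theta>, t) = poly (P \<theta>) t"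
    using real_polynomial_function_imp_param_poly[OF assms(1)] by blast
  have "\<exists>i \<theta>. coeff (P \<theta>) i \<noteq> 0"
  proof (rule ccontr)
    assume "\<not> ?thesis"
    then have "P \<theta> = 0" for \<theta> by (auto simp: poly_eq_iff)
    then show False using assms(2) P(2)[of "fst y" "snd y"] by simp
  qed
  \<comment> \<open>The lowest exponent of \<open>t\<close> whose coefficient is not identically
    zero: \<open>t ^ i\<close> is divided out, and this coefficient is the desired
    polynomial.\<close>
  define i where "i = (LEAST i. \<exists>\<theta>. coeff (P \<theta>) i \<noteq> 0)"
  have i: "\<exists>\<theta>. coeff (P \<theta>) i \<noteq> 0"
    unfolding i_def by (rule LeastI_ex) fact
  have less: "coeff (P \<theta>) j = 0" if "j < i" for j \<theta>
    using not_less_Least[OF that[unfolded i_def]] by blast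
  define R where "R = (\<lambda>\<theta>. poly_shift i (P \<theta>))"
  have PR: "P \<theta> = monom 1 i * R \<theta>" for \<theta>
    by (rule poly_eqI) (auto simp: coeff_monom_mult R_def coeff_poly_shift less)
  have pR: "param_poly n R"
    using P(1) by (simp add: param_poly_def R_def coeff_poly_shift)
  have "coeff (P \<theta>) i = 0"
    if ev: "\<forall>\<^sub>F n in sequentially. ts n \<noteq> 0 \<and> q (\<theta>s n, ts n) = 0" and lim: "\<theta>s \<longlonglongrightarrow> \<theta>" "ts \<longlonglongrightarrow> 0" for \<theta>s ts \<theta>
  proof -
    have c: "(\<lambda>m. coeff (R (\<theta>s m)) j) \<longlonglongrightarrow> coeff (R \<theta>) j" for j
    proof -
      have "continuous_on UNIV (\<lambda>\<theta>. coeff (R \<theta>) j)"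
        using pR by (intro continuous_real_polynomial_function) (simp add: param_poly_def)
      then have "isCont (\<lambda>\<theta>. coeff (R \<theta>) j) \<theta>" by (simp add: continuous_on_eq_continuous_at)
      then show ?thesis using lim(1) by (rule isCont_tendsto_compose)
    qed
    have "(\<lambda>m. poly (R (\<theta>s m)) (ts m)) \<longlonglongrightarrow> poly (R \<theta>) 0"
      unfolding poly_param_sum[OF pR] by (intro tendsto_sum tendsto_mult tendsto_power c lim(2))
    moreover have "\<forall>\<^sub>F m in sequentially. poly (R (\<theta>s m)) (ts m) = 0"
      using ev
    proof (rule eventually_mono)
      fix m assume m: "ts m \<noteq> 0 \<and> q (\<theta>s m, ts m) = 0"
      have "q (\<theta>s m, ts m) = ts m ^ i * poly (R (\<theta>s m)) (ts m)"
        unfolding P(2) PR poly_mult poly_monom by simp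
      then show "poly (R (\<theta>s m)) (ts m) = 0" using m by simp
    qed
    then have "(\<lambda>m. poly (R (\<theta>s m)) (ts m)) \<longlonglongrightarrow> 0" by (rule tendsto_eventually)
    ultimately have "poly (R \<theta>) 0 = 0" by (rule LIMSEQ_unique)
    then show ?thesis by (simp add: poly_0_coeff_0 R_def coeff_poly_shift)
  qed
  moreover have "real_polynomial_function (\<lambda>\<theta>. coeff (P \<theta>) i)" using P(1) by (simp add: param_poly_def)
  ultimately show ?thesis using i by (intro exI[of _ "\<lambda>\<theta>. coeff (P \<theta>) i"]) blast
qed

subsection \<open>Limits of secants and generic linear forms\<close>

text \<open>Both end points tend to 0, so the set depends only on the germ of
  \<open>\<Gamma>\<close>; normalisation makes its elements unit vectors.\<close>

definition limit_secants :: "'a::euclidean_space set \<Rightarrow> 'a set" where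
  "limit_secants \<Gamma> = {u. \<exists>z z'. (\<forall>n::nat. z n \<in> \<Gamma> \<and> z' n \<in> \<Gamma> \<and> z n \<noteq> z' n) \<and> z \<longlonglongrightarrow> 0 \<and> z' \<longlonglongrightarrow> 0 \<and>
     (\<lambda>n. (z n - z' n) /\<^sub>R norm (z n - z' n)) \<longlonglongrightarrow> u}"

text \<open>Compactness of the unit sphere: pairs violating the estimate with constants tending to 0
  would have a limit direction annihilated by \<open>L\<close>.\<close>

lemma secant_bound:
  fixes L :: "'a::euclidean_space \<Rightarrow> 'b::euclidean_space"
  assumes L: "bounded_linear L" and ne: "\<And>u. u \<in> limit_secants \<Gamma> \<Longrightarrow> L u \<noteq> 0"
  shows "\<exists>\<rho>>0. \<exists>c>0. \<forall>z\<in>\<Gamma>. \<forall>z'\<in>\<Gamma>. norm z \<le> \<rho> \<longrightarrow> norm z' \<le> \<rho> \<longrightarrow> c * norm (z - z') \<le> norm (L (z - z'))"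
proof (rule ccontr)
  assume neg: "\<not> ?thesis"
  \<comment> \<open>One null sequence serves both as radius and as constant.\<close>
  define h where "h = (\<lambda>n::nat. 1 / real (Suc n))"
  have h: "h n > 0" for n by (simp add: h_def)
  have h0: "h \<longlonglongrightarrow> 0"
    unfolding h_def using LIMSEQ_inverse_real_of_nat by (simp add: inverse_eq_divide)
  have "\<exists>z z'. z \<in> \<Gamma> \<and> z' \<in> \<Gamma> \<and> norm z \<le> h n \<and> norm z' \<le> h n \<and> norm (L (z - z')) < h n * norm (z - z')" for n
    using neg h[of n] by (meson not_le)
  then obtain z z' where z: "\<And>n. z n \<in> \<Gamma>" "\<And>n. z' n \<in> \<Gamma>" "\<And>n. norm (z n) \<le> h n" "\<And>n. norm (z' n) \<le> h n"
    "\<And>n. norm (L (z n - z' n)) < h n * norm (z n - z' n)" by metis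
  have ne': "z n \<noteq> z' n" for n using z(5)[of n] by auto
  define w where "w = (\<lambda>n. (z n - z' n) /\<^sub>R norm (z n - z' n))"
  have "w n \<in> sphere 0 1" for n using ne'[of n] by (simp add: w_def)
  then obtain u r where u: "strict_mono (r :: nat \<Rightarrow> nat)" "(w \<circ> r) \<longlonglongrightarrow> u"
    using compact_sphere[of 0 1] unfolding compact_def by blast
  have hr: "(\<lambda>n. h (r n)) \<longlonglongrightarrow> 0" using LIMSEQ_subseq_LIMSEQ[OF h0 u(1)] by (simp add: o_def)
  have "u \<in> limit_secants \<Gamma>"
    unfolding limit_secants_def
  proof (intro CollectI exI conjI allI)
    show "z (r n) \<in> \<Gamma>" "z' (r n) \<in> \<Gamma>" "z (r n) \<noteq> z' (r n)" for n by (rule z ne')+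
    show "(\<lambda>n. z (r n)) \<longlonglongrightarrow> 0" by (rule Lim_null_comparison[OF _ hr]) (simp add: z(3))
    show "(\<lambda>n. z' (r n)) \<longlonglongrightarrow> 0" by (rule Lim_null_comparison[OF _ hr]) (simp add: z(4))
    show "(\<lambda>n. (z (r n) - z' (r n)) /\<^sub>R norm (z (r n) - z' (r n))) \<longlonglongrightarrow> u"
      using u(2) by (simp add: w_def o_def)
  qed
  moreover have "L u = 0"
  proof -
    have "norm (L (w n)) \<le> h n" for n
    proof -
      have "norm (L (w n)) = norm (L (z n - z' n)) / norm (z n - z' n)"
        by (simp add: w_def linear_scale[OF bounded_linear.linear[OF L]] divide_inverse mult.commute)
      then show ?thesis using z(5)[of n] ne'[of n] by (simp add: divide_le_eq)
    qed
    then have "(\<lambda>n. L (w (r n))) \<longlonglongrightarrow> 0" by (intro Lim_null_comparison[OF _ hr]) simp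
    moreover have "(\<lambda>n. L (w (r n))) \<longlonglongrightarrow> L u"
      using u(2) by (intro bounded_linear.tendsto[OF L]) (simp add: o_def)
    ultimately show ?thesis using LIMSEQ_unique by blast
  qed
  ultimately show False using ne by blast
qed

text \<open>Lower bounds for secants pass to the limit. Applied to the two factor projections, this
  shows that neither component of a limit of secants of the pairs vanishes.\<close>

lemma limit_secants_lower_bound:
  fixes L :: "'a::euclidean_space \<Rightarrow> 'b::euclidean_space"
  assumes "bounded_linear L" "\<And>z z'. z \<in> \<Gamma> \<Longrightarrow> z' \<in> \<Gamma> \<Longrightarrow> c * norm (z - z') \<le> norm (L (z - z'))"
    "u \<in> limit_secants \<Gamma>"
  shows "c \<le> norm (L u)"
proof -
  obtain z z' where z: "\<And>n::nat. z n \<in> \<Gamma>" "\<And>n. z' n \<in> \<Gamma>" "\<And>n. z n \<noteq> z' n"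
    "(\<lambda>n. (z n - z' n) /\<^sub>R norm (z n - z' n)) \<longlonglongrightarrow> u"
    using assms(3) unfolding limit_secants_def by blast
  have "(\<lambda>n. norm (L ((z n - z' n) /\<^sub>R norm (z n - z' n)))) \<longlonglongrightarrow> norm (L u)"
    by (intro tendsto_norm bounded_linear.tendsto[OF assms(1)] z(4))
  moreover have "c \<le> norm (L ((z n - z' n) /\<^sub>R norm (z n - z' n)))" for n
  proof -
    have "norm (L ((z n - z' n) /\<^sub>R norm (z n - z' n))) = norm (L (z n - z' n)) / norm (z n - z' n)"
      by (simp add: linear_scale[OF bounded_linear.linear[OF assms(1)]] divide_inverse mult.commute)
    then show ?thesis using assms(2)[OF z(1,2), of n n] z(3)[of n] by (simp add: le_divide_eq)
  qed
  ultimately show ?thesis by (intro LIMSEQ_le_const) auto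
qed

lemma limit_secants_nonzero: "u \<in> limit_secants \<Gamma> \<Longrightarrow> u \<noteq> 0"
  using limit_secants_lower_bound[OF bounded_linear_ident, of \<Gamma> 1 u] by auto

text \<open>The parameters \<open>\<theta>\<close> whose rows all annihilate a limit \<open>u\<close> of secants: solving each row for
  its pivot coefficient parametrises them by two points of \<open>\<Gamma>\<close> and the remaining coefficients.\<close>

lemma generic_rows_pivot:
  fixes \<Gamma> :: "'c::euclidean_space set" and e :: "'r \<Rightarrow> 'c \<Rightarrow> 'q::euclidean_space"
  assumes \<Gamma>: "alg_dim_le \<Gamma> k" and R: "finite R" "2 * k \<le> card R"
    and S: "\<And>r. r \<in> R \<Longrightarrow> S r \<subseteq> Basis" and p: "\<And>r. r \<in> R \<Longrightarrow> p r \<in> S r"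
    and e: "\<And>r l. r \<in> R \<Longrightarrow> l \<in> S r \<Longrightarrow> e r l \<in> Basis"
    and inj: "\<And>r l r' l'. r \<in> R \<Longrightarrow> l \<in> S r \<Longrightarrow> r' \<in> R \<Longrightarrow> l' \<in> S r' \<Longrightarrow> e r l = e r' l' \<Longrightarrow> r = r' \<and> l = l'"
  shows "\<exists>P. real_polynomial_function P \<and> (\<exists>\<theta>. P \<theta> \<noteq> 0) \<and>
    (\<forall>u\<in>limit_secants \<Gamma>. \<forall>\<theta>. (\<forall>r\<in>R. u \<bullet> p r \<noteq> 0 \<and> (\<Sum>l\<in>S r. (\<theta> \<bullet> e r l) * (u \<bullet> l)) = 0) \<longrightarrow> P \<theta> = 0)"
proof -
  define piv where "piv = (\<lambda>r. e r (p r)) ` R"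
  have pivB: "piv \<subseteq> Basis" using e p by (auto simp: piv_def)
  have "inj_on (\<lambda>r. e r (p r)) R" using inj p by (meson inj_onI)
  then have card_piv: "card piv = card R" unfolding piv_def by (rule card_image)
  define N where "N = Basis - piv"
  have NB: "N \<subseteq> Basis" by (auto simp: N_def)
  have "card piv \<le> DIM('q)" using pivB by (simp add: card_mono)
  then have cN: "card N + card R = DIM('q)"
    unfolding N_def using pivB card_piv by (simp add: card_Diff_subset finite_subset[OF pivB finite_Basis])
  define \<Omega> where "\<Omega> = \<Gamma> \<times> (\<Gamma> \<times> coord_space N)"
  have dim\<Omega>: "alg_dim_le \<Omega> (k + (k + card N))"
    unfolding \<Omega>_def by (intro alg_dim_le_Times \<Gamma> alg_dim_le_coord_space NB)
  define a where "a = (\<lambda>\<delta> \<theta> r. \<Sum>l\<in>S r - {p r}. (\<theta> \<bullet> e r l) * (\<delta> \<bullet> l))"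
  \<comment> \<open>For \<open>\<theta>\<close> in \<open>coord_space N\<close>, whose pivot entries
    are 0, this fills in the pivot entries so that every row annihilates
    \<open>\<delta>\<close>.\<close>
  define W where "W = (\<lambda>\<delta> \<theta>. \<theta> + (\<Sum>r\<in>R. (- a \<delta> \<theta> r / (\<delta> \<bullet> p r)) *\<^sub>R e r (p r)))"
  define del where "del = (\<lambda>x :: 'c \<times> 'c \<times> 'q. fst x - fst (snd x))"
  define D where "D = (\<lambda>x. \<Prod>r\<in>R. del x \<bullet> p r)"
  define v where "v = (\<lambda>x :: 'c \<times> 'c \<times> 'q. (W (del x) (snd (snd x)), fst x \<bullet> fst x + fst (snd x) \<bullet> fst (snd x)))"
  have r1: "real_polynomial_function (\<lambda>x. del x \<bullet> l)" for l
    unfolding del_def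
    by (intro real_polynomial_function.intros(1) bounded_linear_compose[OF bounded_linear_inner_left] bounded_linear_intros)
  have r2: "real_polynomial_function (\<lambda>x :: 'c \<times> 'c \<times> 'q. snd (snd x) \<bullet> l)" for l
    by (intro real_polynomial_function.intros(1) bounded_linear_compose[OF bounded_linear_inner_left] bounded_linear_intros)
  have finS: "finite (S r)" if "r \<in> R" for r by (rule finite_subset[OF S[OF that] finite_Basis])
  have r3: "real_polynomial_function (\<lambda>x. a (del x) (snd (snd x)) r)" if "r \<in> R" for r
    unfolding a_def using finS[OF that]
    by (intro real_polynomial_function_sum real_polynomial_function.intros(4) r1 r2) simp
  have rD: "real_polynomial_function D"
    unfolding D_def by (intro real_polynomial_function_prod R(1) r1)
  have r4: "real_polynomial_function (\<lambda>x :: 'c \<times> 'c \<times> 'q. fst x \<bullet> fst x + fst (snd x) \<bullet> fst (snd x))"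
    by (intro real_polynomial_function.intros(3) real_polynomial_function_comp[OF _ real_polynomial_function_inner_self]
      polynomial_function_bounded_linear bounded_linear_intros)
  have "\<exists>q. real_polynomial_function q \<and> (\<exists>y. q y \<noteq> 0) \<and> (\<forall>x\<in>\<Omega>. D x \<noteq> 0 \<longrightarrow> q (v x) = 0)"
  proof (rule algebraic_relation[OF dim\<Omega> _ rD])
    \<comment> \<open>The additional real coordinate holds \<open>t\<close>; it makes the inequality
      strict even when there are exactly \<open>2 * k\<close> rows.\<close>
    show "k + (k + card N) < DIM('q \<times> real)" using cN R(2) by simp
    fix b :: "'q \<times> real" assume "b \<in> Basis"
    then consider b' where "b = (b', 0)" | "b = (0, 1)" by (auto simp: Basis_prod_def)
    then show "\<exists>f. real_polynomial_function f \<and> (\<forall>x\<in>\<Omega>. D x \<noteq> 0 \<longrightarrow> D x * (v x \<bullet> b) = f x)"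
    proof cases
      case 2
      then show ?thesis
        by (intro exI[of _ "\<lambda>x. D x * (fst x \<bullet> fst x + fst (snd x) \<bullet> fst (snd x))"] conjI
          real_polynomial_function.intros(4) rD r4) (simp add: v_def inner_prod_def)
    next
      case 1
      \<comment> \<open>Multiplication by the product of all pivot components of the secant cancels
        each denominator and leaves the product over the other rows.\<close>
      define f where "f = (\<lambda>x. D x * (snd (snd x) \<bullet> b') +
        (\<Sum>r\<in>R. - a (del x) (snd (snd x)) r * (e r (p r) \<bullet> b') * (\<Prod>s\<in>R - {r}. del x \<bullet> p s)))"
      have "real_polynomial_function f"
        unfolding f_def using R(1)
        by (intro real_polynomial_function.intros(3,4) real_polynomial_function_sum real_polynomial_function_prod
            real_polynomial_function_minus r1 r2 r3 rD) (auto intro: real_polynomial_function.intros(2))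
      moreover have "D x * (v x \<bullet> b) = f x" if "D x \<noteq> 0" for x
      proof -
        have nz: "del x \<bullet> p r \<noteq> 0" if "r \<in> R" for r using \<open>D x \<noteq> 0\<close> R(1) that by (simp add: D_def)
        have "v x \<bullet> b = snd (snd x) \<bullet> b' + (\<Sum>r\<in>R. - a (del x) (snd (snd x)) r / (del x \<bullet> p r) * (e r (p r) \<bullet> b'))"
          by (simp add: v_def W_def 1 inner_prod_def inner_add_left inner_sum_left)
        moreover have "D x * (- a (del x) (snd (snd x)) r / (del x \<bullet> p r) * (e r (p r) \<bullet> b')) =
           - a (del x) (snd (snd x)) r * (e r (p r) \<bullet> b') * (\<Prod>s\<in>R - {r}. del x \<bullet> p s)" if "r \<in> R" for r
        proof -
          have "D x = (del x \<bullet> p r) * (\<Prod>s\<in>R - {r}. del x \<bullet> p s)"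
            unfolding D_def using R(1) that by (rule prod.remove)
          then show ?thesis using nz[OF that] by simp
        qed
        ultimately show ?thesis
          by (simp only: f_def distrib_left sum_distrib_left cong: sum.cong)
      qed
      ultimately show ?thesis by blast
    qed
  qed
  then obtain q y where q: "real_polynomial_function q" "q y \<noteq> 0" "\<And>x. x \<in> \<Omega> \<Longrightarrow> D x \<noteq> 0 \<Longrightarrow> q (v x) = 0"
    by blast
  obtain P where P: "real_polynomial_function P" "\<exists>\<theta>. P \<theta> \<noteq> 0"
    "\<forall>\<theta>s ts \<theta>. (\<forall>\<^sub>F n in sequentially. ts n \<noteq> 0 \<and> q (\<theta>s n, ts n) = 0) \<longrightarrow> \<theta>s \<longlonglongrightarrow> \<theta> \<longrightarrow> ts \<longlonglongrightarrow> 0 \<longrightarrow> P \<theta> = 0"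
    using relation_at_zero[OF q(1,2)] by blast
  have "P \<theta> = 0" if u: "u \<in> limit_secants \<Gamma>" and row: "\<forall>r\<in>R. u \<bullet> p r \<noteq> 0 \<and> (\<Sum>l\<in>S r. (\<theta> \<bullet> e r l) * (u \<bullet> l)) = 0" for u \<theta>
  proof -
    obtain z z' where z: "\<And>n::nat. z n \<in> \<Gamma>" "\<And>n. z' n \<in> \<Gamma>" "\<And>n. z n \<noteq> z' n" "z \<longlonglongrightarrow> 0" "z' \<longlonglongrightarrow> 0"
      "(\<lambda>n. (z n - z' n) /\<^sub>R norm (z n - z' n)) \<longlonglongrightarrow> u"
      using u unfolding limit_secants_def by blast
    define w where "w = (\<lambda>n. (z n - z' n) /\<^sub>R norm (z n - z' n))"
    have w: "w \<longlonglongrightarrow> u" using z(6) by (simp add: w_def)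
    have zw: "z n - z' n = norm (z n - z' n) *\<^sub>R w n" "norm (z n - z' n) \<noteq> 0" for n
      using z(3)[of n] by (simp_all add: w_def)
    define \<theta>0 where "\<theta>0 = coord_proj N \<theta>"
    define \<theta>s where "\<theta>s = (\<lambda>n. W (z n - z' n) \<theta>0)"
    define ts where "ts = (\<lambda>n. z n \<bullet> z n + z' n \<bullet> z' n)"
    \<comment> \<open>\<open>W\<close> is homogeneous of degree 0 in the secant, so the secant may
      be normalised, and the limit exists because the pivot components of \<open>u\<close> are
      nonzero.\<close>
    have scale: "W (c *\<^sub>R \<delta>) \<theta>0 = W \<delta> \<theta>0" if "c \<noteq> 0" for c \<delta>
    proof -
      have "a (c *\<^sub>R \<delta>) \<theta>0 r = c * a \<delta> \<theta>0 r" for r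
        by (simp add: a_def sum_distrib_left mult_ac)
      then show ?thesis using that by (simp add: W_def)
    qed
    have "\<theta>s = (\<lambda>n. W (w n) \<theta>0)"
    proof
      fix n
      have "W (norm (z n - z' n) *\<^sub>R w n) \<theta>0 = W (w n) \<theta>0" by (rule scale[OF zw(2)])
      then show "\<theta>s n = W (w n) \<theta>0" by (simp only: \<theta>s_def zw(1)[symmetric])
    qed
    moreover have "(\<lambda>n. W (w n) \<theta>0) \<longlonglongrightarrow> W u \<theta>0"
      unfolding W_def a_def using row by (intro tendsto_intros w) simp
    \<comment> \<open>The rows of \<open>\<theta>\<close> annihilate \<open>u\<close>, so its pivot
      entries are exactly the ones that \<open>W\<close> reconstructs. Injectivity of
      \<open>e\<close> keeps the entries of different rows apart.\<close>
    moreover have "W u \<theta>0 = \<theta>"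
    proof (rule euclidean_eqI)
      fix b :: 'q assume b: "b \<in> Basis"
      have W: "W u \<theta>0 \<bullet> b = \<theta>0 \<bullet> b + (\<Sum>r\<in>R. - a u \<theta>0 r / (u \<bullet> p r) * (e r (p r) \<bullet> b))"
        by (simp add: W_def inner_add_left inner_sum_left)
      have \<theta>0: "\<theta>0 \<bullet> c = (if c \<in> N then \<theta> \<bullet> c else 0)" if "c \<in> Basis" for c
        unfolding \<theta>0_def by (rule coord_proj_inner[OF NB that])
      show "W u \<theta>0 \<bullet> b = \<theta> \<bullet> b"
      proof (cases "b \<in> piv")
        case False
        have "(\<Sum>r\<in>R. - a u \<theta>0 r / (u \<bullet> p r) * (e r (p r) \<bullet> b)) = 0"
        proof (rule sum.neutral, rule ballI)
          fix r assume r: "r \<in> R"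
          then have "e r (p r) \<noteq> b" using False by (auto simp: piv_def)
          then have "e r (p r) \<bullet> b = 0" using e[OF r p[OF r]] b by (simp add: inner_Basis)
          then show "- a u \<theta>0 r / (u \<bullet> p r) * (e r (p r) \<bullet> b) = 0" by simp
        qed
        then show ?thesis using W \<theta>0[OF b] False b by (simp add: N_def)
      next
        case True
        then obtain s where s: "s \<in> R" "b = e s (p s)" by (auto simp: piv_def)
        have "(\<Sum>r\<in>R. - a u \<theta>0 r / (u \<bullet> p r) * (e r (p r) \<bullet> b)) = (\<Sum>r\<in>R. if r = s then - a u \<theta>0 s / (u \<bullet> p s) else 0)"
        proof (rule sum.cong)
          fix r assume r: "r \<in> R"
          have "e r (p r) \<bullet> b = (if r = s then 1 else 0)"
            using inj[OF r p[OF r] s(1) p[OF s(1)]] e[OF r p[OF r]] b by (auto simp: inner_Basis s(2))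
          then show "- a u \<theta>0 r / (u \<bullet> p r) * (e r (p r) \<bullet> b) = (if r = s then - a u \<theta>0 s / (u \<bullet> p s) else 0)" by simp
        qed simp
        also have "\<dots> = - a u \<theta>0 s / (u \<bullet> p s)" using R(1) s(1) by simp
        finally have W': "W u \<theta>0 \<bullet> b = - a u \<theta>0 s / (u \<bullet> p s)" using W \<theta>0[OF b] True by (simp add: N_def)
        have "a u \<theta>0 s = (\<Sum>l\<in>S s - {p s}. (\<theta> \<bullet> e s l) * (u \<bullet> l))"
          unfolding a_def
        proof (rule sum.cong)
          fix l assume l: "l \<in> S s - {p s}"
          then have el: "e s l \<in> Basis" using e[OF s(1)] by simp
          have "e s l \<notin> piv"
          proof
            assume "e s l \<in> piv"
            then obtain r where "r \<in> R" "e s l = e r (p r)" by (auto simp: piv_def)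
            then have "s = r \<and> l = p r" using inj[OF s(1), of l r "p r"] l p by simp
            then show False using l by simp
          qed
          then show "\<theta>0 \<bullet> e s l * (u \<bullet> l) = \<theta> \<bullet> e s l * (u \<bullet> l)" using \<theta>0[OF el] el by (simp add: N_def)
        qed simp
        then have "(\<theta> \<bullet> b) * (u \<bullet> p s) + a u \<theta>0 s = 0"
          using row s(1) sum.remove[OF finS[OF s(1)] p[OF s(1)], of "\<lambda>l. (\<theta> \<bullet> e s l) * (u \<bullet> l)"] by (simp add: s(2))
        then have "- a u \<theta>0 s = (\<theta> \<bullet> b) * (u \<bullet> p s)" by linarith
        then show ?thesis using row s(1) unfolding W' by simp
      qed
    qed
    ultimately have "\<theta>s \<longlonglongrightarrow> \<theta>" by simp
    moreover have "ts \<longlonglongrightarrow> 0"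
    proof -
      have "ts \<longlonglongrightarrow> 0 \<bullet> (0::'c) + 0 \<bullet> (0::'c)" unfolding ts_def by (intro tendsto_intros z)
      then show ?thesis by simp
    qed
    moreover have "\<forall>\<^sub>F n in sequentially. ts n \<noteq> 0 \<and> q (\<theta>s n, ts n) = 0"
    proof -
      have "\<forall>\<^sub>F n in sequentially. \<forall>r\<in>R. w n \<bullet> p r \<noteq> 0"
      proof (rule eventually_ball_finite[OF R(1)], rule ballI)
        fix r assume "r \<in> R"
        then have "u \<bullet> p r \<noteq> 0" using row by simp
        moreover have "(\<lambda>n. w n \<bullet> p r) \<longlonglongrightarrow> u \<bullet> p r" by (intro tendsto_intros w)
        ultimately show "\<forall>\<^sub>F n in sequentially. w n \<bullet> p r \<noteq> 0" by (rule tendsto_imp_eventually_ne[rotated])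
      qed
      then show ?thesis
      proof (rule eventually_mono)
        fix n assume wn: "\<forall>r\<in>R. w n \<bullet> p r \<noteq> 0"
        define x where "x = (z n, z' n, \<theta>0)"
        have "x \<in> \<Omega>" using z coord_proj_in[OF NB] by (simp add: x_def \<Omega>_def \<theta>0_def)
        moreover have "D x \<noteq> 0"
        proof -
          have "del x \<bullet> p r \<noteq> 0" if "r \<in> R" for r
          proof -
            have "del x = norm (z n - z' n) *\<^sub>R w n" unfolding zw(1)[symmetric] by (simp add: del_def x_def)
            then show ?thesis using wn that zw(2)[of n] by simp
          qed
          then show ?thesis using R(1) by (simp add: D_def)
        qed
        ultimately have "q (v x) = 0" by (rule q(3))
        moreover have "v x = (\<theta>s n, ts n)" by (simp add: v_def x_def del_def \<theta>s_def ts_def)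
        \<comment> \<open>The two points differ, hence are not both 0; this is what makes
          \<open>t\<close> an admissible divisor.\<close>
        moreover have "ts n \<noteq> 0"
        proof
          assume "ts n = 0"
          then have "z n \<bullet> z n = 0" "z' n \<bullet> z' n = 0"
            using inner_ge_zero[of "z n"] inner_ge_zero[of "z' n"] unfolding ts_def by linarith+
          then show False using z(3)[of n] by simp
        qed
        ultimately show "ts n \<noteq> 0 \<and> q (\<theta>s n, ts n) = 0" by simp
      qed
    qed
    ultimately show ?thesis using P(3) by blast
  qed
  then show ?thesis using P(1,2) by blast
qed

text \<open>The position of a nonzero component varies with \<open>u\<close>, but there are only
  finitely many ways to select one per row; the product of the polynomials for all selections serves
  every \<open>u\<close>.\<close>

lemma generic_rows:
  fixes \<Gamma> :: "'c::euclidean_space set" and e :: "'r \<Rightarrow> 'c \<Rightarrow> 'q::euclidean_space"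
  assumes \<Gamma>: "alg_dim_le \<Gamma> k" and R: "finite R" "2 * k \<le> card R"
    and S: "\<And>r. r \<in> R \<Longrightarrow> S r \<subseteq> Basis"
    and e: "\<And>r l. r \<in> R \<Longrightarrow> l \<in> S r \<Longrightarrow> e r l \<in> Basis"
    and inj: "\<And>r l r' l'. r \<in> R \<Longrightarrow> l \<in> S r \<Longrightarrow> r' \<in> R \<Longrightarrow> l' \<in> S r' \<Longrightarrow> e r l = e r' l' \<Longrightarrow> r = r' \<and> l = l'"
  shows "\<exists>P. real_polynomial_function P \<and> (\<exists>\<theta>. P \<theta> \<noteq> 0) \<and>
    (\<forall>u\<in>limit_secants \<Gamma>. \<forall>\<theta>. (\<forall>r\<in>R. (\<exists>l\<in>S r. u \<bullet> l \<noteq> 0) \<and> (\<Sum>l\<in>S r. (\<theta> \<bullet> e r l) * (u \<bullet> l)) = 0) \<longrightarrow> P \<theta> = 0)"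
proof -
  define T where "T = PiE R S"
  have finT: "finite T" unfolding T_def by (intro finite_PiE R(1) finite_subset[OF S finite_Basis])
  have "\<forall>p\<in>T. \<exists>P. real_polynomial_function P \<and> (\<exists>\<theta>. P \<theta> \<noteq> 0) \<and>
    (\<forall>u\<in>limit_secants \<Gamma>. \<forall>\<theta>. (\<forall>r\<in>R. u \<bullet> p r \<noteq> 0 \<and> (\<Sum>l\<in>S r. (\<theta> \<bullet> e r l) * (u \<bullet> l)) = 0) \<longrightarrow> P \<theta> = 0)"
  proof
    fix p assume "p \<in> T"
    then have p: "p r \<in> S r" if "r \<in> R" for r using that by (auto simp: T_def)
    show "\<exists>P. real_polynomial_function P \<and> (\<exists>\<theta>. P \<theta> \<noteq> 0) \<and>
    (\<forall>u\<in>limit_secants \<Gamma>. \<forall>\<theta>. (\<forall>r\<in>R. u \<bullet> p r \<noteq> 0 \<and> (\<Sum>l\<in>S r. (\<theta> \<bullet> e r l) * (u \<bullet> l)) = 0) \<longrightarrow> P \<theta> = 0)"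
      by (rule generic_rows_pivot[OF \<Gamma> R S p e inj])
  qed
  from bchoice[OF this] obtain P where P: "\<And>p. p \<in> T \<Longrightarrow> real_polynomial_function (P p)"
    "\<And>p. p \<in> T \<Longrightarrow> \<exists>\<theta>. P p \<theta> \<noteq> 0"
    "\<And>p u \<theta>. p \<in> T \<Longrightarrow> u \<in> limit_secants \<Gamma> \<Longrightarrow> (\<forall>r\<in>R. u \<bullet> p r \<noteq> 0 \<and> (\<Sum>l\<in>S r. (\<theta> \<bullet> e r l) * (u \<bullet> l)) = 0) \<Longrightarrow> P p \<theta> = 0"
    by blast
  have "\<exists>\<theta>\<in>UNIV. \<forall>q\<in>P ` T. q \<theta> \<noteq> 0"
    by (rule common_nonzero_on_subspace) (use finT P(1,2) in auto)
  then obtain \<theta> where \<theta>: "\<And>p. p \<in> T \<Longrightarrow> P p \<theta> \<noteq> 0" by blast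
  show ?thesis
  proof (intro exI[of _ "\<lambda>\<theta>. \<Prod>p\<in>T. P p \<theta>"] conjI ballI allI impI)
    show "real_polynomial_function (\<lambda>\<theta>. \<Prod>p\<in>T. P p \<theta>)" by (intro real_polynomial_function_prod finT P(1))
    show "\<exists>\<theta>. (\<Prod>p\<in>T. P p \<theta>) \<noteq> 0" using \<theta> finT by (intro exI[of _ \<theta>]) simp
    fix u \<theta> assume u: "u \<in> limit_secants \<Gamma>"
      and row: "\<forall>r\<in>R. (\<exists>l\<in>S r. u \<bullet> l \<noteq> 0) \<and> (\<Sum>l\<in>S r. (\<theta> \<bullet> e r l) * (u \<bullet> l)) = 0"
    then have "\<forall>r\<in>R. \<exists>l. l \<in> S r \<and> u \<bullet> l \<noteq> 0" by blast
    from bchoice[OF this] obtain p where p: "\<forall>r\<in>R. p r \<in> S r \<and> u \<bullet> p r \<noteq> 0" by blast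
    define p' where "p' = restrict p R"
    have "p' \<in> T" using p by (simp add: T_def p'_def)
    moreover have "P p' \<theta> = 0" by (rule P(3)[OF \<open>p' \<in> T\<close> u]) (use p row in \<open>simp add: p'_def\<close>)
    ultimately show "(\<Prod>p\<in>T. P p \<theta>) = 0" using finT by (auto intro!: prod_zero)
  qed
qed

subsection \<open>Existence of embeddings\<close>

lemma contains_cell_mono:
  fixes A :: "'a::euclidean_space set"
  shows "contains_cell d A \<Longrightarrow> A \<subseteq> B \<Longrightarrow> contains_cell d B"
proof -
  assume "contains_cell d A" and AB: "A \<subseteq> B"
  then obtain V :: "'a set" and C h h' where *: "subspace V" "dim V = d" "C \<subseteq> A" "homeomorphism V C h h'" "semialgebraic_map_on V h"
    unfolding contains_cell_def by blast
  have "C \<subseteq> B" using *(3) AB by (rule order_trans)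
  then show ?thesis unfolding contains_cell_def
    by (intro exI[of _ V] exI[of _ C] exI[of _ h] exI[of _ h'] conjI * )
qed

lemma contains_cell_le_semialgebraic_dim:
  fixes A :: "'a::euclidean_space set"
  assumes "contains_cell d A" shows "d \<le> semialgebraic_dim A"
proof -
  have "e \<le> DIM('a)" if "contains_cell e A" for e
    using that dim_subset_UNIV[where 'a = 'a] unfolding contains_cell_def by blast
  then have "finite {e. contains_cell e A}" by (intro finite_subset[OF _ finite_atMost[of "DIM('a)"]]) auto
  then show ?thesis unfolding semialgebraic_dim_def using assms by (intro Max_ge) auto
qed

text \<open>The form in which the dimension enters the proof: absence of
  \<open>(k + 1)\<close>-cells near 0. Fitting a closed ball of radius \<open>b / 3\<close> into the
  open one of radius \<open>b / 2\<close> makes compact pieces available.\<close>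

lemma germ_dim_no_cell:
  assumes "germ_dim X k"
  obtains \<rho> where "\<rho> > 0" "\<And>A. A \<subseteq> X \<inter> cball 0 \<rho> \<Longrightarrow> \<not> contains_cell (Suc k) A"
proof -
  obtain b where b: "b > 0" "\<And>r. 0 < r \<Longrightarrow> r < b \<Longrightarrow> semialgebraic_dim (X \<inter> ball 0 r) = k"
    using assms unfolding germ_dim_def eventually_at_right_field by auto
  show ?thesis
  proof (rule that[of "b / 3"])
    fix A assume A: "A \<subseteq> X \<inter> cball 0 (b / 3)"
    have "cball 0 (b / 3) \<subseteq> ball 0 (b / 2)" using b(1) by (auto simp: subset_iff)
    then have "A \<subseteq> X \<inter> ball 0 (b / 2)" using A by blast
    then show "\<not> contains_cell (Suc k) A"
      using contains_cell_le_semialgebraic_dim[of "Suc k" "X \<inter> ball 0 (b / 2)"] contains_cell_mono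
        b(2)[of "b / 2"] b(1) by fastforce
  qed (use b in simp)
qed

lemma alg_dim_le_image:
  fixes X :: "'a::euclidean_space set" and F :: "'a \<Rightarrow> 'c::euclidean_space"
  assumes "compact X" "semialgebraic_map_on X F" "continuous_on X F" "inj_on F X" "\<not> contains_cell (Suc k) X"
  shows "alg_dim_le (F ` X) k"
  unfolding alg_dim_le_def using thin_projection[OF assms(1-4)] assms(5) by simp

lemma compact_closed_Int_cball: "closed X \<Longrightarrow> compact (X \<inter> cball (0::'a::euclidean_space) r)"
  by (simp add: closed_Int_compact)

lemma axis_in_Basis: "b \<in> Basis \<Longrightarrow> axis i b \<in> Basis"
  by (auto simp: Basis_vec_def)

lemma sum_inner_Basis: "(\<Sum>l\<in>Basis. (x \<bullet> l) * (y \<bullet> l)) = x \<bullet> (y::'a::euclidean_space)"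
  by (rule euclidean_inner[symmetric])

text \<open>The image of a neighbourhood has to be of the form \<open>Y \<inter> V\<close> with
  \<open>V\<close> open. With \<open>Y\<close> the compact image of a closed ball in
  \<open>X\<close>, the complement of the image of the boundary sphere is such a \<open>V\<close>;
  injectivity ensures that nothing else is removed.\<close>

lemma semialgebraic_bilipschitz_embedding_linear:
  fixes X :: "'a::euclidean_space set" and L :: "'a \<Rightarrow> 'b::euclidean_space"
  assumes X: "closed X" "semialgebraic X" "0 \<in> X" and L: "bounded_linear L" and pos: "\<rho> > 0" "c > 0"
    and lower: "\<And>x y. x \<in> X \<Longrightarrow> y \<in> X \<Longrightarrow> norm x \<le> \<rho> \<Longrightarrow> norm y \<le> \<rho> \<Longrightarrow> c * norm (x - y) \<le> norm (L (x - y))"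
  shows "semialgebraic_bilipschitz_embedding X L"
proof -
  define Xc where "Xc = X \<inter> cball 0 \<rho>"
  define U where "U = ball (0::'a) \<rho>"
  define Y where "Y = L ` Xc"
  define V where "V = - L ` (X \<inter> sphere 0 \<rho>)"
  have lin: "linear L" by (rule bounded_linear.linear[OF L])
  have low: "c * norm (x - y) \<le> norm (L x - L y)" if "x \<in> Xc" "y \<in> Xc" for x y
    using lower[of x y] that by (simp add: Xc_def linear_diff[OF lin])
  have inj: "inj_on L Xc"
  proof (rule inj_onI)
    fix x y assume "x \<in> Xc" "y \<in> Xc" "L x = L y"
    then have "c * norm (x - y) \<le> 0" using low[of x y] by simp
    then show "x = y" using pos(2) by (simp add: mult_le_0_iff)
  qed
  have contL: "continuous_on A L" for A by (rule linear_continuous_on[OF L])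
  have compX: "compact Xc" unfolding Xc_def by (rule compact_closed_Int_cball[OF X(1)])
  have saX: "semialgebraic Xc" unfolding Xc_def by (rule semialgebraic_Int[OF X(2) semialgebraic_cball])
  have Y: "closed Y" "semialgebraic Y" "0 \<in> Y"
  proof -
    show "closed Y" unfolding Y_def by (rule compact_imp_closed[OF compact_continuous_image[OF contL compX]])
    show "semialgebraic Y" unfolding Y_def by (rule semialgebraic_linear_image[OF L saX])
    have "0 \<in> Xc" using X(3) pos by (simp add: Xc_def)
    then show "0 \<in> Y" unfolding Y_def using linear_0[OF lin] by (metis image_eqI)
  qed
  have sub: "X \<inter> U \<subseteq> Xc" "X \<inter> sphere 0 \<rho> \<subseteq> Xc" by (auto simp: Xc_def U_def)
  have YV: "Y \<inter> V = L ` (X \<inter> U)"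
  proof
    show "Y \<inter> V \<subseteq> L ` (X \<inter> U)"
    proof
      fix y assume "y \<in> Y \<inter> V"
      then obtain x where x: "x \<in> Xc" "y = L x" unfolding Y_def by blast
      moreover have "x \<notin> X \<inter> sphere 0 \<rho>" using \<open>y \<in> Y \<inter> V\<close> x(2) unfolding V_def by blast
      ultimately have "x \<in> X \<inter> U" by (auto simp: Xc_def U_def)
      then show "y \<in> L ` (X \<inter> U)" using x(2) by blast
    qed
    show "L ` (X \<inter> U) \<subseteq> Y \<inter> V"
    proof (rule image_subsetI)
      fix x assume x: "x \<in> X \<inter> U"
      have "L x \<noteq> L y" if "y \<in> X \<inter> sphere 0 \<rho>" for y
      proof
        assume "L x = L y"
        then have "x = y" using inj_onD[OF inj] x that sub by blast
        then show False using x that by (simp add: U_def)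
      qed
      then have "L x \<notin> L ` (X \<inter> sphere 0 \<rho>)" by blast
      then show "L x \<in> Y \<inter> V" using x sub unfolding Y_def V_def by blast
    qed
  qed
  have injU: "inj_on L (X \<inter> U)" using inj sub(1) by (rule inj_on_subset)
  have bij: "bij_betw L (X \<inter> U) (Y \<inter> V)" unfolding YV using injU by (simp add: bij_betw_def)
  have saXU: "semialgebraic (X \<inter> U)" unfolding U_def by (rule semialgebraic_Int[OF X(2) semialgebraic_ball])
  have invL: "inv_into (X \<inter> U) L (L x) = x" if "x \<in> X \<inter> U" for x using injU that by simp
  have "bilipschitz_bij (X \<inter> U) (Y \<inter> V) L"
    unfolding bilipschitz_bij_def
  proof (intro conjI bij)
    obtain K where K: "\<And>x. norm (L x) \<le> norm x * K" "K > 0" using bounded_linear.pos_bounded[OF L] by blast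
    have "K-lipschitz_on (X \<inter> U) L"
      by (rule lipschitz_onI) (use K in \<open>auto simp: dist_norm linear_diff[OF lin, symmetric] mult.commute\<close>)
    then show "\<exists>K. K-lipschitz_on (X \<inter> U) L" ..
    have "(1 / c)-lipschitz_on (Y \<inter> V) (inv_into (X \<inter> U) L)"
      unfolding YV
    proof (rule lipschitz_onI)
      fix y z assume "y \<in> L ` (X \<inter> U)" "z \<in> L ` (X \<inter> U)"
      then obtain x x' where x: "x \<in> X \<inter> U" "x' \<in> X \<inter> U" "y = L x" "z = L x'" by blast
      have "c * norm (x - x') \<le> norm (L x - L x')" using low x(1,2) sub(1) by blast
      then show "dist (inv_into (X \<inter> U) L y) (inv_into (X \<inter> U) L z) \<le> 1 / c * dist y z"
        using pos(2) by (simp only: x(3,4) invL[OF x(1)] invL[OF x(2)]) (simp add: dist_norm field_simps)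
    qed (use pos in simp)
    then show "\<exists>K. K-lipschitz_on (Y \<inter> V) (inv_into (X \<inter> U) L)" ..
  qed
  moreover have "semialgebraic_bij (X \<inter> U) (Y \<inter> V) L"
    unfolding semialgebraic_bij_def
  proof (intro conjI bij)
    show "semialgebraic_map_on (X \<inter> U) L" by (rule semialgebraic_map_on_linear[OF L saXU])
    then show "semialgebraic_map_on (Y \<inter> V) (inv_into (X \<inter> U) L)"
      unfolding YV by (rule semialgebraic_map_on_inverse) (rule invL)
  qed
  moreover have "open U" "0 \<in> U" using pos by (simp_all add: U_def)
  moreover have "open V"
    unfolding V_def
    by (intro open_Compl compact_imp_closed compact_continuous_image contL closed_Int_compact X(1) compact_sphere)
  moreover have "0 \<in> V"
  proof -
    have "L x \<noteq> 0" if x: "x \<in> X \<inter> sphere 0 \<rho>" for x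
    proof
      assume "L x = 0"
      then have "c * norm (x - 0) \<le> 0" using lower[of x 0] x X(3) pos by simp
      then show False using x pos by (simp add: mult_le_0_iff)
    qed
    then show ?thesis by (force simp: V_def)
  qed
  ultimately have "semialgebraic_bilipschitz_germ X Y L"
    unfolding semialgebraic_bilipschitz_germ_def using linear_0[OF lin]
    by (intro conjI exI[of _ U] exI[of _ V])
  then show ?thesis unfolding semialgebraic_bilipschitz_embedding_def using Y by blast
qed

text \<open>All entries of the matrix are free, row \<open>r\<close> having its coefficients at
  \<open>axis r l\<close>. A limit secant in the kernel would be annihilated by every row; a kernel
  without limit secants gives the lower Lipschitz estimate near 0.\<close>

theorem semialgebraic_embedding_exists:
  fixes X :: "(real^'m) set"
  assumes X: "closed X" "semialgebraic X" "0 \<in> X" and k: "germ_dim X k" "2 * k \<le> CARD('n::finite)"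
  shows "\<exists>f :: real^'m \<Rightarrow> real^'n. semialgebraic_bilipschitz_embedding X f"
proof -
  obtain \<rho> where \<rho>: "\<rho> > 0" "\<And>A. A \<subseteq> X \<inter> cball 0 \<rho> \<Longrightarrow> \<not> contains_cell (Suc k) A"
    using germ_dim_no_cell[OF k(1)] by blast
  define \<Gamma> where "\<Gamma> = X \<inter> cball 0 \<rho>"
  have "alg_dim_le ((\<lambda>x. x) ` \<Gamma>) k"
  proof (rule alg_dim_le_image)
    show "compact \<Gamma>" unfolding \<Gamma>_def by (rule compact_closed_Int_cball[OF X(1)])
    show "semialgebraic_map_on \<Gamma> (\<lambda>x. x)"
      unfolding \<Gamma>_def by (intro semialgebraic_map_on_linear bounded_linear_ident semialgebraic_Int X(2) semialgebraic_cball)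
    show "\<not> contains_cell (Suc k) \<Gamma>" by (rule \<rho>(2)) (simp add: \<Gamma>_def)
  qed (auto intro: continuous_intros)
  then have dim: "alg_dim_le \<Gamma> k" by simp
  have "\<exists>P. real_polynomial_function P \<and> (\<exists>\<theta>. P \<theta> \<noteq> 0) \<and>
    (\<forall>u\<in>limit_secants \<Gamma>. \<forall>\<theta> :: real^'m^'n. (\<forall>r\<in>UNIV. (\<exists>l\<in>Basis. u \<bullet> l \<noteq> 0) \<and> (\<Sum>l\<in>Basis. (\<theta> \<bullet> axis r l) * (u \<bullet> l)) = 0) \<longrightarrow> P \<theta> = 0)"
  proof (rule generic_rows[OF dim])
    show "2 * k \<le> card (UNIV :: 'n set)" using k(2) by simp
    show "axis r l \<in> Basis" if "l \<in> Basis" for r :: 'n and l :: "real^'m" using that by (rule axis_in_Basis)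
    show "r = r' \<and> l = l'" if "l \<in> Basis" "l' \<in> Basis" "axis r l = axis r' l'" for r r' :: 'n and l l' :: "real^'m"
      using that nonzero_Basis unfolding axis_eq_axis by blast
  qed simp_all
  then show ?thesis
  proof (elim exE conjE)
    fix P and \<theta> :: "real^'m^'n" assume \<theta>: "P \<theta> \<noteq> 0"
      and P: "\<forall>u\<in>limit_secants \<Gamma>. \<forall>\<theta> :: real^'m^'n. (\<forall>r\<in>UNIV. (\<exists>l\<in>Basis. u \<bullet> l \<noteq> 0) \<and> (\<Sum>l\<in>Basis. (\<theta> \<bullet> axis r l) * (u \<bullet> l)) = 0) \<longrightarrow> P \<theta> = 0"
  define L where "L = (\<lambda>x. \<theta> *v x)"
  have L: "bounded_linear L" unfolding L_def by (simp add: linear_conv_bounded_linear[symmetric] matrix_vector_mul_linear)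
  have "L u \<noteq> 0" if u: "u \<in> limit_secants \<Gamma>" for u
  proof
    assume "L u = 0"
    then have "\<theta> $ r \<bullet> u = 0" for r
      unfolding L_def by (metis matrix_vector_mul_component zero_index)
    then have "(\<Sum>l\<in>Basis. (\<theta> \<bullet> axis r l) * (u \<bullet> l)) = 0" for r
      by (simp only: inner_axis sum_inner_Basis)
    moreover have "\<exists>l\<in>Basis. u \<bullet> l \<noteq> 0" using limit_secants_nonzero[OF u] euclidean_eq_iff[of u 0] by auto
    ultimately show False using P[rule_format, OF u, of \<theta>] \<theta> by blast
  qed
  from secant_bound[OF L this] obtain \<rho>' c where c: "\<rho>' > 0" "c > 0"
    "\<And>z z'. z \<in> \<Gamma> \<Longrightarrow> z' \<in> \<Gamma> \<Longrightarrow> norm z \<le> \<rho>' \<Longrightarrow> norm z' \<le> \<rho>' \<Longrightarrow> c * norm (z - z') \<le> norm (L (z - z'))" by blast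
  have "semialgebraic_bilipschitz_embedding X L"
    by (rule semialgebraic_bilipschitz_embedding_linear[OF X L _ c(2), of "min \<rho> \<rho>'"])
      (use \<rho>(1) c(1,3) in \<open>auto simp: \<Gamma>_def\<close>)
  then show ?thesis by (rule exI[of _ L])
  qed
qed

subsection \<open>Lipschitz extension\<close>

lemma semialgebraic_norm_le:
  fixes f :: "'a::euclidean_space \<Rightarrow> 'b::euclidean_space"
  assumes "bounded_linear f" "bounded_linear g" "bounded_linear h"
  shows "semialgebraic {x. g x \<le> h x + C * norm (f x)}"
proof -
  have "{x. g x \<le> h x + C * norm (f x)} = {x. \<exists>r::real. 0 \<le> r \<and> r * r = f x \<bullet> f x \<and> g x \<le> h x + C * r}"
  proof (intro Collect_cong iffI)
    fix x assume "g x \<le> h x + C * norm (f x)"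
    then show "\<exists>r::real. 0 \<le> r \<and> r * r = f x \<bullet> f x \<and> g x \<le> h x + C * r"
      by (intro exI[of _ "norm (f x)"]) (simp add: dot_square_norm power2_eq_square)
  next
    fix x assume "\<exists>r::real. 0 \<le> r \<and> r * r = f x \<bullet> f x \<and> g x \<le> h x + C * r"
    then obtain r where r: "0 \<le> r" "r * r = f x \<bullet> f x" "g x \<le> h x + C * r" by blast
    have "r\<^sup>2 = (norm (f x))\<^sup>2" using r(2) by (simp add: power2_norm_eq_inner power2_eq_square[of r])
    then have "r = norm (f x)" using r(1) by (simp add: power2_eq_iff_nonneg)
    then show "g x \<le> h x + C * norm (f x)" using r(3) by simp
  qed
  moreover have "semialgebraic \<dots>"
  proof (intro semialgebraic_Collect_ex semialgebraic_Collect_conj)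
    let ?r = "snd :: 'a \<times> real \<Rightarrow> real"
    have rp: "real_polynomial_function ?r" by (rule real_polynomial_function.intros(1)[OF bounded_linear_snd])
    show "semialgebraic {z. 0 \<le> ?r z}"
      by (rule semialgebraic_Collect_le[OF real_polynomial_function.intros(2) rp])
    show "semialgebraic {z. ?r z * ?r z = f (fst z) \<bullet> f (fst z)}"
      by (rule semialgebraic_Collect_eq; unfold real_polynomial_function_eq[symmetric])
        (intro real_polynomial_function.intros(4) rp
          real_polynomial_function_comp[OF polynomial_function_bounded_linear[OF bounded_linear_compose[OF assms(1) bounded_linear_fst]]
            real_polynomial_function_inner_self])+
    show "semialgebraic {z. g (fst z) \<le> h (fst z) + C * ?r z}"
      by (intro semialgebraic_Collect_le real_polynomial_function.intros(3,4) rp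
        real_polynomial_function.intros(2) real_polynomial_function.intros(1)[OF bounded_linear_compose[OF assms(2) bounded_linear_fst]]
        real_polynomial_function.intros(1)[OF bounded_linear_compose[OF assms(3) bounded_linear_fst]])
  qed
  ultimately show ?thesis by simp
qed

text \<open>McShane extension, the infimum of the functions \<open>q z + C * norm (x - z)\<close>.
  To see that it is semialgebraic it is described as the greatest lower bound in first-order terms;
  \<open>M\<close> consists of the points and their lower bounds.\<close>

lemma semialgebraic_lipschitz_extension:
  fixes q :: "'a::euclidean_space \<Rightarrow> real"
  assumes ne: "Z \<noteq> {}" and sa: "semialgebraic_map_on Z q" and C: "C \<ge> 0"
    and lip: "\<And>z z'. z \<in> Z \<Longrightarrow> z' \<in> Z \<Longrightarrow> \<bar>q z - q z'\<bar> \<le> C * norm (z - z')"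
  obtains Q where "C-lipschitz_on UNIV Q" "semialgebraic_map_on UNIV Q" "\<And>z. z \<in> Z \<Longrightarrow> Q z = q z"
proof -
  define G where "G = (\<lambda>z. (z, q z)) ` Z"
  define M where "M = {w. \<forall>y. y \<in> G \<longrightarrow> snd w \<le> snd y + C * norm (fst w - fst y)}"
  have sM: "semialgebraic M"
    unfolding M_def G_def
    by (intro semialgebraic_Collect_all semialgebraic_Collect_imp semialgebraic_Collect_mem
      semialgebraic_norm_le semialgebraic_map_onD[OF sa] bounded_linear_intros)
  have M: "(x, s) \<in> M \<longleftrightarrow> (\<forall>z\<in>Z. s \<le> q z + C * norm (x - z))" for x s
    by (auto simp: M_def G_def)
  define Q where "Q = (\<lambda>x. Inf ((\<lambda>z. q z + C * norm (x - z)) ` Z))"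
  have lower: "q z0 - C * norm (x - z0) \<le> q z + C * norm (x - z)" if "z \<in> Z" "z0 \<in> Z" for x z z0
  proof -
    have "norm (z0 - z) \<le> norm (x - z) + norm (x - z0)" by norm
    then have "C * norm (z0 - z) \<le> C * norm (x - z) + C * norm (x - z0)"
      using mult_left_mono[OF _ C] by (simp add: distrib_left[symmetric])
    then show ?thesis using lip[OF that(2,1)] by linarith
  qed
  obtain z0 where z0: "z0 \<in> Z" using ne by blast
  have bdd: "bdd_below ((\<lambda>z. q z + C * norm (x - z)) ` Z)" for x
    by (rule bdd_belowI2[of _ "q z0 - C * norm (x - z0)"]) (rule lower[OF _ z0])
  have Qle: "Q x \<le> q z + C * norm (x - z)" if "z \<in> Z" for x z
    unfolding Q_def using that bdd by (rule cINF_lower[rotated])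
  have Qge: "s \<le> Q x" if "(x, s) \<in> M" for x s
    unfolding Q_def using ne that by (intro cINF_greatest) (simp_all add: M)
  have QM: "(x, Q x) \<in> M" for x using Qle by (simp add: M)
  have Qq: "Q z = q z" if "z \<in> Z" for z
  proof (rule antisym)
    show "Q z \<le> q z" using Qle[OF that, of z] by simp
    show "q z \<le> Q z" by (rule Qge) (use lower[of _ z z] that in \<open>simp add: M\<close>)
  qed
  have lipQ: "Q x \<le> Q y + C * norm (x - y)" for x y
  proof -
    have "(y, Q x - C * norm (x - y)) \<in> M"
      unfolding M
    proof
      fix z assume "z \<in> Z"
      have "norm (x - z) \<le> norm (x - y) + norm (y - z)" by norm
      then have "C * norm (x - z) \<le> C * norm (x - y) + C * norm (y - z)"
        using mult_left_mono[OF _ C] by (simp add: distrib_left[symmetric])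
      then show "Q x - C * norm (x - y) \<le> q z + C * norm (y - z)" using Qle[OF \<open>z \<in> Z\<close>, of x] by linarith
    qed
    then show ?thesis using Qge by fastforce
  qed
  have "C-lipschitz_on UNIV Q"
  proof (rule lipschitz_onI[OF _ C])
    fix x y show "dist (Q x) (Q y) \<le> C * dist x y"
      using lipQ[of x y] lipQ[of y x] by (simp add: dist_norm norm_minus_commute abs_le_iff)
  qed
  moreover have "semialgebraic_map_on UNIV Q"
  proof -
    have "range (\<lambda>x. (x, Q x)) = {w. w \<in> M \<and> (\<forall>s. (fst w, s) \<in> M \<longrightarrow> s \<le> snd w)}"
    proof (intro set_eqI iffI)
      fix w assume "w \<in> {w. w \<in> M \<and> (\<forall>s. (fst w, s) \<in> M \<longrightarrow> s \<le> snd w)}"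
      then have "w \<in> M" "Q (fst w) \<le> snd w" using QM[of "fst w"] by auto
      moreover from this(1) have "snd w \<le> Q (fst w)" by (intro Qge) simp
      ultimately have "w = (fst w, Q (fst w))" by (simp add: prod_eq_iff)
      then show "w \<in> range (\<lambda>x. (x, Q x))" by (rule range_eqI)
    qed (use QM Qge in auto)
    moreover have "semialgebraic \<dots>"
      by (intro semialgebraic_Collect_conj semialgebraic_Collect_all semialgebraic_Collect_imp
        semialgebraic_Collect_mem sM semialgebraic_Collect_le real_polynomial_function.intros(1) bounded_linear_intros)
    ultimately show ?thesis by (simp add: semialgebraic_map_on_def)
  qed
  ultimately show ?thesis using that Qq by blast
qed

subsection \<open>Tame homeomorphisms\<close>

definition drop_coord :: "'n \<Rightarrow> real^'n::finite \<Rightarrow> real^'n" where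
  "drop_coord i x = x - (x $ i) *\<^sub>R axis i 1"

definition coord_shear :: "'n \<Rightarrow> (real^'n::finite \<Rightarrow> real) \<Rightarrow> real^'n \<Rightarrow> real^'n" where
  "coord_shear i q x = x + q (drop_coord i x) *\<^sub>R axis i 1"

text \<open>Global homeomorphisms, although only germs are asked for, so that compositions need no
  shrinking of neighbourhoods.\<close>

definition tame_homeo :: "(real^('n::{finite,linorder}) \<Rightarrow> real^('n::{finite,linorder})) \<Rightarrow> bool" where
  "tame_homeo \<Phi> \<longleftrightarrow> \<Phi> 0 = 0 \<and> bij \<Phi> \<and> (\<exists>K. K-lipschitz_on UNIV \<Phi>) \<and> (\<exists>K. K-lipschitz_on UNIV (inv \<Phi>)) \<and>
     semialgebraic_map_on UNIV \<Phi> \<and> tame_germ \<Phi>"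

lemma lipschitz_on_UNIV_comp:
  assumes "C-lipschitz_on UNIV f" "D-lipschitz_on UNIV g"
  shows "(D * C)-lipschitz_on UNIV (\<lambda>x. g (f x))"
  by (rule lipschitz_on_compose2[OF assms(1) lipschitz_on_subset[OF assms(2) subset_UNIV]])

lemma bounded_linear_lipschitz:
  assumes "bounded_linear f" shows "\<exists>K. K-lipschitz_on UNIV f"
proof -
  obtain K where K: "\<And>x. norm (f x) \<le> norm x * K" "K > 0" using bounded_linear.pos_bounded[OF assms] by blast
  have "K-lipschitz_on UNIV f"
    by (rule lipschitz_onI)
      (use K in \<open>auto simp: dist_norm linear_diff[OF bounded_linear.linear[OF assms], symmetric] mult.commute\<close>)
  then show ?thesis ..
qed

lemma tame_homeo_comp:
  assumes "tame_homeo \<Phi>" "tame_homeo \<Psi>" shows "tame_homeo (\<Phi> \<circ> \<Psi>)"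
proof -
  obtain C D C' D' where 1: "\<Phi> 0 = 0" "bij \<Phi>" "C-lipschitz_on UNIV \<Phi>" "C'-lipschitz_on UNIV (inv \<Phi>)"
      "semialgebraic_map_on UNIV \<Phi>" "tame_germ \<Phi>"
    and 2: "\<Psi> 0 = 0" "bij \<Psi>" "D-lipschitz_on UNIV \<Psi>" "D'-lipschitz_on UNIV (inv \<Psi>)"
      "semialgebraic_map_on UNIV \<Psi>" "tame_germ \<Psi>"
    using assms unfolding tame_homeo_def by blast
  have "(C * D)-lipschitz_on UNIV (\<Phi> \<circ> \<Psi>)"
    using lipschitz_on_UNIV_comp[OF 2(3) 1(3)] by (simp add: o_def)
  moreover have "(D' * C')-lipschitz_on UNIV (inv (\<Phi> \<circ> \<Psi>))"
    using lipschitz_on_UNIV_comp[OF 1(4) 2(4)] unfolding o_inv_distrib[OF 1(2) 2(2)] by (simp only: o_def)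
  moreover have "semialgebraic_map_on UNIV (\<Phi> \<circ> \<Psi>)"
    using semialgebraic_map_on_comp[OF 2(5) 1(5)] by (simp add: o_def)
  moreover have "bij (\<Phi> \<circ> \<Psi>)" using 2(2) 1(2) by (rule bij_comp)
  moreover have "tame_germ (\<Phi> \<circ> \<Psi>)" using 1(6) 2(6) by (rule tame_germ.comp)
  moreover have "(\<Phi> \<circ> \<Psi>) 0 = 0" using 1(1) 2(1) by simp
  ultimately show ?thesis unfolding tame_homeo_def by blast
qed

lemma linear_inverse_det_one:
  fixes T :: "real^'n::finite \<Rightarrow> real^'n"
  assumes "linear T" "det (matrix T) = 1"
  obtains T' where "linear T'" "\<And>x. T' (T x) = x" "\<And>x. T (T' x) = x" "det (matrix T') = 1"
proof -
  have "inj T" using det_nz_iff_inj[OF assms(1)] assms(2) by simp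
  then obtain T' where T': "linear T'" "\<forall>x. T' (T x) = x" "\<forall>x. T (T' x) = x"
    using linear_injective_isomorphism[OF assms(1)] by blast
  have "T \<circ> T' = id" using T'(3) by (auto simp: fun_eq_iff)
  then have "matrix T ** matrix T' = mat 1"
    using matrix_compose[OF T'(1) assms(1)] by (simp add: matrix_id_mat_1[symmetric])
  then have "det (matrix T) * det (matrix T') = 1" by (metis det_mul det_I)
  then show ?thesis using that T' assms(2) by simp
qed

lemma tame_homeo_linear:
  fixes T :: "real^('n::{finite,linorder}) \<Rightarrow> real^('n::{finite,linorder})"
  assumes T: "linear T" "det (matrix T) = 1"
  shows "tame_homeo T"
proof -
  obtain T' where T': "linear T'" "\<And>x. T' (T x) = x" "\<And>x. T (T' x) = x"
    using linear_inverse_det_one[OF T] by metis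
  have inv: "inv T = T'" using T'(2,3) by (rule inv_equality)
  have bl: "bounded_linear T" "bounded_linear T'" using T T' by (simp_all add: linear_conv_bounded_linear)
  have "bij T" using T'(2,3) by (metis bijI')
  then show ?thesis
    unfolding tame_homeo_def inv
    using linear_0[OF T(1)] bounded_linear_lipschitz[OF bl(1)] bounded_linear_lipschitz[OF bl(2)]
      semialgebraic_map_on_linear[OF bl(1) semialgebraic_UNIV] tame_germ.linear[OF T] by blast
qed

lemma tame_homeo_imp_germ:
  assumes "tame_homeo \<Phi>" shows "semialgebraic_bilipschitz_germ UNIV UNIV \<Phi>"
proof -
  have 1: "\<Phi> 0 = 0" "bij \<Phi>" "\<exists>K. K-lipschitz_on UNIV \<Phi>" "\<exists>K. K-lipschitz_on UNIV (inv \<Phi>)"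
      "semialgebraic_map_on UNIV \<Phi>"
    using assms unfolding tame_homeo_def by blast+
  have "semialgebraic_map_on (\<Phi> ` UNIV) (inv \<Phi>)"
    by (rule semialgebraic_map_on_inverse[OF 1(5)]) (simp add: bij_is_inj[OF 1(2)])
  then have "semialgebraic_map_on UNIV (inv \<Phi>)" using bij_is_surj[OF 1(2)] by simp
  then have "bilipschitz_bij (UNIV \<inter> UNIV) (UNIV \<inter> UNIV) \<Phi>" "semialgebraic_bij (UNIV \<inter> UNIV) (UNIV \<inter> UNIV) \<Phi>"
    using 1 by (simp_all add: bilipschitz_bij_def semialgebraic_bij_def)
  then show ?thesis
    unfolding semialgebraic_bilipschitz_germ_def using 1(1)
    by (intro conjI exI[of _ UNIV]) simp_all
qed

lemma bounded_linear_drop_coord: "bounded_linear (drop_coord i)"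
proof -
  have "linear (drop_coord i)"
    unfolding drop_coord_def by (rule linearI) (simp_all add: algebra_simps)
  then show ?thesis by (simp add: linear_conv_bounded_linear)
qed

lemma drop_coord_nth: "drop_coord i x $ j = (if j = i then 0 else x $ j)"
  by (simp add: drop_coord_def axis_def)

lemma drop_coord_add_axis: "drop_coord i (x + t *\<^sub>R axis i 1) = drop_coord i x"
  by (simp add: vec_eq_iff drop_coord_nth axis_def)

lemma norm_drop_coord_le: "norm (drop_coord i x) \<le> norm x"
  by (rule norm_le_componentwise_cart) (simp add: drop_coord_nth)

lemma coord_shear_inverse: "coord_shear i (\<lambda>x. - q x) (coord_shear i q x) = x"
  by (simp add: coord_shear_def drop_coord_add_axis)

lemma inv_coord_shear: "inv (coord_shear i q) = coord_shear i (\<lambda>x. - q x)"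
proof (rule inv_equality)
  show "coord_shear i (\<lambda>x. - q x) (coord_shear i q x) = x" for x by (rule coord_shear_inverse)
  show "coord_shear i q (coord_shear i (\<lambda>x. - q x) x) = x" for x
    using coord_shear_inverse[of i "\<lambda>x. - q x" x] by simp
qed

lemma bij_coord_shear: "bij (coord_shear i q)"
proof (rule bijI')
  show "coord_shear i q x = coord_shear i q y \<longleftrightarrow> x = y" for x y
    using coord_shear_inverse[of i q] by metis
  show "\<exists>x. y = coord_shear i q x" for y
    using coord_shear_inverse[of i "\<lambda>x. - q x" y] by (intro exI[of _ "coord_shear i (\<lambda>x. - q x) y"]) simp
qed

lemma lipschitz_coord_shear:
  assumes "C-lipschitz_on UNIV q" shows "(1 + C)-lipschitz_on UNIV (coord_shear i q)"
proof (rule lipschitz_onI)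
  have C: "C \<ge> 0" using assms by (rule lipschitz_on_nonneg)
  then show "0 \<le> 1 + C" by simp
  fix x y
  have "norm (drop_coord i x - drop_coord i y) \<le> norm (x - y)"
    using norm_drop_coord_le[of i "x - y"]
    by (simp add: linear_diff[OF bounded_linear.linear[OF bounded_linear_drop_coord]])
  then have "\<bar>q (drop_coord i x) - q (drop_coord i y)\<bar> \<le> C * norm (x - y)"
    using lipschitz_onD[OF assms, of "drop_coord i x" "drop_coord i y"] mult_left_mono[OF _ C]
    by (simp add: dist_norm) (meson order_trans)
  moreover have "coord_shear i q x - coord_shear i q y =
    (x - y) + (q (drop_coord i x) - q (drop_coord i y)) *\<^sub>R axis i 1"
    by (simp add: coord_shear_def algebra_simps)
  ultimately have "norm (coord_shear i q x - coord_shear i q y) \<le> norm (x - y) + C * norm (x - y)"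
    using norm_triangle_ineq[of "x - y" "(q (drop_coord i x) - q (drop_coord i y)) *\<^sub>R axis i 1"]
    by (simp add: norm_axis_1)
  then show "dist (coord_shear i q x) (coord_shear i q y) \<le> (1 + C) * dist x y"
    by (simp add: dist_norm distrib_right)
qed

lemma coord_shear_zero: "q 0 = 0 \<Longrightarrow> coord_shear i q 0 = 0"
  by (simp add: coord_shear_def linear_0[OF bounded_linear.linear[OF bounded_linear_drop_coord]])

lemma bilipschitz_germ_coord_shear:
  assumes "C-lipschitz_on UNIV q" "q 0 = 0"
  shows "bilipschitz_germ UNIV UNIV (coord_shear i q)"
proof -
  have "C-lipschitz_on UNIV (\<lambda>x. - q x)"
    using assms(1) by (simp add: lipschitz_on_def dist_minus)
  then have "(1 + C)-lipschitz_on UNIV (inv (coord_shear i q))"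
    unfolding inv_coord_shear by (rule lipschitz_coord_shear)
  then have "bilipschitz_bij (UNIV \<inter> UNIV) (UNIV \<inter> UNIV) (coord_shear i q)"
    using lipschitz_coord_shear[OF assms(1), of i] bij_coord_shear[of i q]
    by (auto simp: bilipschitz_bij_def)
  then show ?thesis
    unfolding bilipschitz_germ_def using coord_shear_zero[of q, OF assms(2)]
    by (intro conjI exI[of _ UNIV]) simp_all
qed

lemma shear_eq_coord_shear:
  fixes p :: "real^('n::{finite,linorder}) \<Rightarrow> real"
  shows "shear p = coord_shear last_index p"
proof
  fix x :: "real^('n::{finite,linorder})"
  have "(\<chi> j. if j = last_index then 0 else x $ j) = drop_coord last_index x"
    by (simp add: vec_eq_iff drop_coord_nth)
  then show "shear p x = coord_shear last_index p x"
    by (simp add: vec_eq_iff shear_def coord_shear_def axis_def)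
qed

text \<open>A rotation carrying the \<open>i\<close>-th axis to the last one conjugates the two shears.\<close>

lemma tame_germ_coord_shear:
  fixes q :: "real^('n::{finite,linorder}) \<Rightarrow> real"
  assumes q: "C-lipschitz_on UNIV q" "q 0 = 0"
  shows "tame_germ (coord_shear i q)"
proof (cases "i = last_index")
  case True
  then show ?thesis
    using tame_germ.shear[of q] bilipschitz_germ_coord_shear[OF q, of last_index] by (simp add: shear_eq_coord_shear)
next
  case False
  have "card {i, last_index} \<le> CARD('n)" by (rule card_mono) simp_all
  \<comment> \<open>A rotation carrying one axis to another needs two coordinates, which
    \<open>i \<noteq> last_index\<close> provides.\<close>
  then have two: "2 \<le> CARD('n)" using False by simp
  have eq: "norm (axis i (1::real)) = norm (axis last_index (1::real))" by (simp only: norm_axis_1)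
  obtain T where T: "orthogonal_transformation T" "det (matrix T) = 1"
      "T (axis i (1::real)) = axis last_index 1"
    using rotation_exists[OF two eq] by blast
  have linT: "linear T" using T(1) by (rule orthogonal_transformation_linear)
  obtain T' where T': "linear T'" "\<And>x. T' (T x) = x" "\<And>x. T (T' x) = x" "det (matrix T') = 1"
    using linear_inverse_det_one[OF linT T(2)] by metis
  define p where "p = (\<lambda>y. q (T' y))"
  obtain K where K: "K-lipschitz_on UNIV T'"
    using bounded_linear_lipschitz T'(1) by (auto simp: linear_conv_bounded_linear)
  have p: "(C * K)-lipschitz_on UNIV p" unfolding p_def by (rule lipschitz_on_UNIV_comp[OF K q(1)])
  have "p 0 = 0" using q(2) linear_0[OF T'(1)] by (simp add: p_def)
  have "tame_germ (shear p)"
    unfolding shear_eq_coord_shear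
    using tame_germ.shear[of p] bilipschitz_germ_coord_shear[OF p \<open>p 0 = 0\<close>] by (simp add: shear_eq_coord_shear)
  then have "tame_germ (T' \<circ> (shear p \<circ> T))"
    by (rule tame_germ.comp[OF tame_germ.linear[OF T'(1,4)] tame_germ.comp[OF _ tame_germ.linear[OF linT T(2)]]])
  moreover have "T' \<circ> (shear p \<circ> T) = coord_shear i q"
  proof
    fix x
    \<comment> \<open>Orthogonality turns the last coordinate of \<open>T x\<close> into the
      \<open>i\<close>-th coordinate of \<open>x\<close>, so \<open>T\<close> intertwines the two
      coordinate projections.\<close>
    have "T x $ last_index = T x \<bullet> T (axis i 1)" by (simp add: T(3) inner_axis)
    also have "\<dots> = x $ i" using T(1) by (simp add: orthogonal_transformation_def inner_axis)
    finally have "drop_coord last_index (T x) = T (drop_coord i x)"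
      by (simp add: drop_coord_def linear_diff[OF linT] linear_scale[OF linT] T(3))
    then have "shear p (T x) = T (x + q (drop_coord i x) *\<^sub>R axis i 1)"
      by (simp add: shear_eq_coord_shear coord_shear_def p_def T'(2) linear_add[OF linT] linear_scale[OF linT] T(3))
    then show "(T' \<circ> (shear p \<circ> T)) x = coord_shear i q x" by (simp add: T'(2) coord_shear_def)
  qed
  ultimately show ?thesis by simp
qed

lemma tame_homeo_coord_shear:
  fixes q :: "real^('n::{finite,linorder}) \<Rightarrow> real"
  assumes q: "C-lipschitz_on UNIV q" "q 0 = 0" "semialgebraic_map_on UNIV q"
  shows "tame_homeo (coord_shear i q)"
proof -
  have "C-lipschitz_on UNIV (\<lambda>x. - q x)"
    using q(1) by (simp add: lipschitz_on_def dist_minus)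
  then have "(1 + C)-lipschitz_on UNIV (inv (coord_shear i q))"
    unfolding inv_coord_shear by (rule lipschitz_coord_shear)
  moreover have "semialgebraic_map_on UNIV (coord_shear i q)"
  proof -
    have "semialgebraic_map_on UNIV (\<lambda>x. q (drop_coord i x))"
      by (rule semialgebraic_map_on_comp[OF semialgebraic_map_on_linear[OF bounded_linear_drop_coord semialgebraic_UNIV] q(3)]) simp
    then have "semialgebraic_map_on UNIV (\<lambda>x. (x, q (drop_coord i x)))"
      by (rule semialgebraic_map_on_Pair[OF semialgebraic_map_on_linear[OF bounded_linear_ident semialgebraic_UNIV]])
    from semialgebraic_map_on_linear_comp[OF this, of "\<lambda>z. fst z + snd z *\<^sub>R axis i 1"]
    have "semialgebraic_map_on UNIV (\<lambda>x. x + q (drop_coord i x) *\<^sub>R axis i 1)"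
      by (simp add: bounded_linear_add bounded_linear_fst bounded_linear_snd
        bounded_linear_compose[OF bounded_linear_scaleR_left])
    then show ?thesis by (rule semialgebraic_map_on_cong) (simp add: coord_shear_def)
  qed
  ultimately show ?thesis
    unfolding tame_homeo_def
    using coord_shear_zero[of q, OF q(2)] bij_coord_shear lipschitz_coord_shear[OF q(1)] tame_germ_coord_shear[OF q(1,2)]
    by (intro conjI exI)
qed

subsection \<open>Uniqueness of embeddings\<close>

text \<open>At \<open>w = (f x, g x)\<close> this interpolates between \<open>A *v f x\<close> for
  empty \<open>J\<close> and \<open>B *v g x\<close> for full \<open>J\<close>; \<open>J\<close> is
  the set of coordinates already exchanged.\<close>

definition hybrid :: "real^'n^'n \<Rightarrow> real^'n^'n \<Rightarrow> 'n set \<Rightarrow> (real^'n) \<times> (real^'n) \<Rightarrow> real^'n::finite" where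
  "hybrid A B J w = (\<chi> r. if r \<in> J then B $ r \<bullet> snd w else A $ r \<bullet> fst w)"

lemma bounded_linear_hybrid: "bounded_linear (hybrid A B J)"
proof -
  have "linear (hybrid A B J)"
  proof (rule linearI)
    show "hybrid A B J (x + y) = hybrid A B J x + hybrid A B J y" for x y
      unfolding vec_eq_iff by (simp add: hybrid_def inner_add_right)
    show "hybrid A B J (c *\<^sub>R x) = c *\<^sub>R hybrid A B J x" for c x
      unfolding vec_eq_iff by (simp add: hybrid_def)
  qed
  then show ?thesis by (simp add: linear_conv_bounded_linear)
qed

lemma embedding_bounds:
  fixes f :: "'a::euclidean_space \<Rightarrow> 'b::euclidean_space"
  assumes "semialgebraic_bilipschitz_embedding X f"
  obtains U K where "open U" "0 \<in> U" "K > 0" "f 0 = 0" "semialgebraic_map_on (X \<inter> U) f"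
    "\<And>x y. x \<in> X \<inter> U \<Longrightarrow> y \<in> X \<inter> U \<Longrightarrow> norm (f x - f y) \<le> K * norm (x - y)"
    "\<And>x y. x \<in> X \<inter> U \<Longrightarrow> y \<in> X \<inter> U \<Longrightarrow> norm (x - y) \<le> K * norm (f x - f y)"
proof -
  obtain Y U V where U: "f 0 = 0" "open U" "0 \<in> U"
    "bilipschitz_bij (X \<inter> U) (Y \<inter> V) f" "semialgebraic_bij (X \<inter> U) (Y \<inter> V) f"
    using assms unfolding semialgebraic_bilipschitz_embedding_def semialgebraic_bilipschitz_germ_def by blast
  obtain C D where bij: "bij_betw f (X \<inter> U) (Y \<inter> V)" and C: "C-lipschitz_on (X \<inter> U) f"
    and D: "D-lipschitz_on (Y \<inter> V) (inv_into (X \<inter> U) f)"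
    using U(4) unfolding bilipschitz_bij_def by blast
  have sa: "semialgebraic_map_on (X \<inter> U) f" using U(5) by (simp add: semialgebraic_bij_def)
  have CD: "C \<ge> 0" "D \<ge> 0" using C D lipschitz_on_nonneg by blast+
  define K where "K = C + D + 1"
  show ?thesis
  proof (rule that[OF U(2,3) _ U(1) sa, of K])
    show "K > 0" using CD by (simp add: K_def)
    fix x y assume xy: "x \<in> X \<inter> U" "y \<in> X \<inter> U"
    have "norm (f x - f y) \<le> C * norm (x - y)" using lipschitz_onD[OF C xy] by (simp add: dist_norm)
    also have "\<dots> \<le> K * norm (x - y)" using CD by (intro mult_right_mono) (auto simp: K_def)
    finally show "norm (f x - f y) \<le> K * norm (x - y)" .
    have inv: "inv_into (X \<inter> U) f (f z) = z" if "z \<in> X \<inter> U" for z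
      using bij_betw_inv_into_left[OF bij that] .
    have "f x \<in> Y \<inter> V" "f y \<in> Y \<inter> V" using bij xy by (auto simp: bij_betw_def)
    from lipschitz_onD[OF D this] have "norm (x - y) \<le> D * norm (f x - f y)"
      by (simp only: inv[OF xy(1)] inv[OF xy(2)] dist_norm)
    also have "\<dots> \<le> K * norm (f x - f y)" using CD by (intro mult_right_mono) (auto simp: K_def)
    finally show "norm (x - y) \<le> K * norm (f x - f y)" .
  qed
qed

text \<open>Rescaling a single row corrects the determinant. Rows change only by nonzero factors, so
  it remains the same which hybrid coordinates vanish.\<close>

lemma scale_to_det_one:
  fixes A :: "real^'n^'n::finite"
  assumes "det A \<noteq> 0"
  shows "\<exists>A'. det A' = 1 \<and> (\<forall>r. \<exists>c. c \<noteq> 0 \<and> A' $ r = c *\<^sub>R A $ r)"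
proof -
  obtain k :: 'n where True by simp
  define A' where "A' = (\<chi> r. if r = k then (1 / det A) *s A $ r else A $ r)"
  have "det A' = (1 / det A) * det (\<chi> r. if r = k then A $ r else A $ r)"
    unfolding A'_def by (rule det_row_mul)
  then have "det A' = 1" using assms by simp
  moreover have "\<exists>c. c \<noteq> 0 \<and> A' $ r = c *\<^sub>R A $ r" for r
  proof (cases "r = k")
    case True
    then show ?thesis using assms by (intro exI[of _ "1 / det A"]) (simp add: A'_def scalar_mult_eq_scaleR)
  next
    case False
    then show ?thesis by (intro exI[of _ 1]) (simp add: A'_def)
  qed
  ultimately show ?thesis by blast
qed

lemma real_polynomial_function_det:
  fixes g :: "'a::euclidean_space \<Rightarrow> real^'n^'n::finite"
  assumes "bounded_linear g" shows "real_polynomial_function (\<lambda>x. det (g x))"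
  unfolding det_def
  by (intro real_polynomial_function_sum real_polynomial_function.intros(2,4) real_polynomial_function_prod
      real_polynomial_function.intros(1) bounded_linear_compose[OF bounded_linear_vec_nth]
      bounded_linear_compose[OF bounded_linear_vec_nth assms]) simp_all

text \<open>Omitting row \<open>i\<close> leaves \<open>CARD('n) - 1\<close>, hence at least
  \<open>2 * k\<close>, rows. A row in \<open>J\<close> has its free coefficients in the second
  matrix and pairs with the second component of \<open>u\<close>, the other rows with the first; as
  neither component vanishes, each block contains a pivot.\<close>

lemma generic_hybrid_row:
  fixes \<Gamma> :: "((real^'n::finite) \<times> (real^'n)) set"
  assumes dim: "alg_dim_le \<Gamma> k" "2 * k + 1 \<le> CARD('n)"
    and ne: "\<And>u. u \<in> limit_secants \<Gamma> \<Longrightarrow> fst u \<noteq> 0 \<and> snd u \<noteq> 0"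
  shows "\<exists>P. real_polynomial_function P \<and> (\<exists>\<theta>. P \<theta> \<noteq> 0) \<and>
    (\<forall>u\<in>limit_secants \<Gamma>. \<forall>\<theta>. drop_coord i (hybrid (fst \<theta>) (snd \<theta>) J u) = 0 \<longrightarrow> P \<theta> = 0)"
proof -
  define S :: "'n \<Rightarrow> ((real^'n) \<times> (real^'n)) set" where
    "S = (\<lambda>r. if r \<in> J then (\<lambda>b. (0, b)) ` Basis else (\<lambda>b. (b, 0)) ` Basis)"
  define e :: "'n \<Rightarrow> (real^'n) \<times> (real^'n) \<Rightarrow> (real^'n^'n) \<times> (real^'n^'n)" where
    "e = (\<lambda>r l. if r \<in> J then (0, axis r (snd l)) else (axis r (fst l), 0))"
  have ex: "\<exists>P. real_polynomial_function P \<and> (\<exists>\<theta>. P \<theta> \<noteq> 0) \<and>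
    (\<forall>u\<in>limit_secants \<Gamma>. \<forall>\<theta>. (\<forall>r\<in>UNIV - {i}. (\<exists>l\<in>S r. u \<bullet> l \<noteq> 0) \<and> (\<Sum>l\<in>S r. (\<theta> \<bullet> e r l) * (u \<bullet> l)) = 0) \<longrightarrow> P \<theta> = 0)"
  proof (rule generic_rows[OF dim(1)])
    show "2 * k \<le> card (UNIV - {i})" using dim(2) by (simp add: card_Diff_subset)
    show "S r \<subseteq> Basis" for r by (auto simp: S_def Basis_prod_def)
    show "e r l \<in> Basis" if "l \<in> S r" for r l
      using that by (auto simp: S_def e_def Basis_prod_def axis_in_Basis split: if_splits)
    fix r l r' l' assume *: "l \<in> S r" "l' \<in> S r'" "e r l = e r' l'"
    have nz: "axis r (b :: real^'n) \<noteq> 0" if "b \<in> Basis" for r and b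
      using nonzero_Basis[OF that] by (simp add: axis_eq_0_iff)
    have ax: "r = r' \<and> b = b'" if "axis r b = axis r' b'" "b \<in> Basis" for b b' :: "real^'n"
      using that nonzero_Basis[OF that(2)] unfolding axis_eq_axis by blast
    show "r = r' \<and> l = l'"
    proof (cases "r \<in> J")
      case True
      then obtain b where b: "b \<in> Basis" "l = (0, b)" using *(1) by (auto simp: S_def)
      have rJ: "r' \<in> J"
      proof (rule ccontr)
        assume "r' \<notin> J"
        then have "axis r b = 0" using *(3) True b by (simp add: e_def)
        then show False using nz[OF b(1)] by blast
      qed
      then obtain b' where b': "l' = (0, b')" using *(2) by (auto simp: S_def)
      have "axis r b = axis r' b'" using *(3) True rJ b b' by (simp add: e_def)
      then show ?thesis using ax[OF _ b(1)] b(2) b' by blast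
    next
      case False
      then obtain b where b: "b \<in> Basis" "l = (b, 0)" using *(1) by (auto simp: S_def)
      have rJ: "r' \<notin> J"
      proof
        assume "r' \<in> J"
        then have "axis r b = 0" using *(3) False b by (simp add: e_def)
        then show False using nz[OF b(1)] by blast
      qed
      then obtain b' where b': "l' = (b', 0)" using *(2) by (auto simp: S_def)
      have "axis r b = axis r' b'" using *(3) False rJ b b' by (simp add: e_def)
      then show ?thesis using ax[OF _ b(1)] b(2) b' by blast
    qed
  qed simp
  have row: "(\<Sum>l\<in>S r. (\<theta> \<bullet> e r l) * (u \<bullet> l)) = hybrid (fst \<theta>) (snd \<theta>) J u $ r" for \<theta> u r
  proof (cases "r \<in> J")
    case True
    have "(\<Sum>l\<in>S r. (\<theta> \<bullet> e r l) * (u \<bullet> l)) = (\<Sum>b\<in>Basis. (\<theta> \<bullet> e r (0, b)) * (u \<bullet> (0, b)))"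
      using True by (simp add: S_def sum.reindex inj_on_def)
    also have "\<dots> = (\<Sum>b\<in>Basis. (snd \<theta> $ r \<bullet> b) * (snd u \<bullet> b))"
      using True by (simp add: e_def inner_prod_def inner_axis)
    finally show ?thesis using True by (simp only: sum_inner_Basis hybrid_def vec_lambda_beta if_True)
  next
    case False
    have "(\<Sum>l\<in>S r. (\<theta> \<bullet> e r l) * (u \<bullet> l)) = (\<Sum>b\<in>Basis. (\<theta> \<bullet> e r (b, 0)) * (u \<bullet> (b, 0)))"
      using False by (simp add: S_def sum.reindex inj_on_def)
    also have "\<dots> = (\<Sum>b\<in>Basis. (fst \<theta> $ r \<bullet> b) * (fst u \<bullet> b))"
      using False by (simp add: e_def inner_prod_def inner_axis)
    finally show ?thesis using False by (simp only: sum_inner_Basis hybrid_def vec_lambda_beta if_False)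
  qed
  have piv: "\<exists>l\<in>S r. u \<bullet> l \<noteq> 0" if u: "u \<in> limit_secants \<Gamma>" for u r
  proof -
    obtain b where "b \<in> Basis" "fst u \<bullet> b \<noteq> 0" using ne[OF u] euclidean_eq_iff[of "fst u" 0] by auto
    moreover obtain b' where "b' \<in> Basis" "snd u \<bullet> b' \<noteq> 0" using ne[OF u] euclidean_eq_iff[of "snd u" 0] by auto
    ultimately show ?thesis by (cases "r \<in> J") (auto simp: S_def inner_prod_def)
  qed
  show ?thesis
    using ex
  proof (elim exE conjE)
    fix P \<theta>0
    assume P: "real_polynomial_function P" "P \<theta>0 \<noteq> 0"
      "\<forall>u\<in>limit_secants \<Gamma>. \<forall>\<theta>. (\<forall>r\<in>UNIV - {i}. (\<exists>l\<in>S r. u \<bullet> l \<noteq> 0) \<and> (\<Sum>l\<in>S r. (\<theta> \<bullet> e r l) * (u \<bullet> l)) = 0) \<longrightarrow> P \<theta> = 0"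
    have "P \<theta> = 0" if u: "u \<in> limit_secants \<Gamma>" and z: "drop_coord i (hybrid (fst \<theta>) (snd \<theta>) J u) = 0" for u \<theta>
    proof (rule P(3)[rule_format, OF u])
      fix r assume "r \<in> UNIV - {i}"
      then have "hybrid (fst \<theta>) (snd \<theta>) J u $ r = 0"
        using z drop_coord_nth[of i "hybrid (fst \<theta>) (snd \<theta>) J u" r] by simp
      then show "(\<exists>l\<in>S r. u \<bullet> l \<noteq> 0) \<and> (\<Sum>l\<in>S r. (\<theta> \<bullet> e r l) * (u \<bullet> l)) = 0"
        using piv[OF u] row by simp
    qed
    then show ?thesis using P(1,2) by (intro exI[of _ P]) blast
  qed
qed

text \<open>The conditions for all \<open>(i, J)\<close> and the two determinants are finitely many
  polynomial conditions, so one pair of matrices meets them all. Every \<open>J\<close> is included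
  because the later induction exchanges coordinates in no fixed order.\<close>

lemma generic_matrices:
  fixes \<Gamma> :: "((real^'n::finite) \<times> (real^'n)) set"
  assumes dim: "alg_dim_le \<Gamma> k" "2 * k + 1 \<le> CARD('n)"
    and ne: "\<And>u. u \<in> limit_secants \<Gamma> \<Longrightarrow> fst u \<noteq> 0 \<and> snd u \<noteq> 0"
  obtains A B where "det A = 1" "det B = 1"
    "\<And>i J u. u \<in> limit_secants \<Gamma> \<Longrightarrow> drop_coord i (hybrid A B J u) \<noteq> 0"
proof -
  have "\<forall>x. \<exists>P. real_polynomial_function P \<and> (\<exists>\<theta>. P \<theta> \<noteq> 0) \<and>
    (\<forall>u\<in>limit_secants \<Gamma>. \<forall>\<theta>. drop_coord (fst x) (hybrid (fst \<theta>) (snd \<theta>) (snd x) u) = 0 \<longrightarrow> P \<theta> = 0)"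
    using generic_hybrid_row[OF dim ne] by blast
  from choice[OF this] obtain P where P: "\<And>x. real_polynomial_function (P x)" "\<And>x. \<exists>\<theta>. P x \<theta> \<noteq> 0"
    "\<And>x u \<theta>. u \<in> limit_secants \<Gamma> \<Longrightarrow> drop_coord (fst x) (hybrid (fst \<theta>) (snd \<theta>) (snd x) u) = 0 \<Longrightarrow> P x \<theta> = 0"
    by blast
  define Q where "Q = insert (\<lambda>\<theta>. det (fst \<theta>)) (insert (\<lambda>\<theta>. det (snd \<theta>)) (range P))"
  have "\<exists>\<theta>\<in>UNIV. \<forall>q\<in>Q. q \<theta> \<noteq> 0"
  proof (rule common_nonzero_on_subspace)
    have "finite (UNIV :: ('n \<times> 'n set) set)" by simp
    then show "finite Q" by (simp add: Q_def)
    show "real_polynomial_function q" if "q \<in> Q" for q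
      using that P(1) real_polynomial_function_det[OF bounded_linear_fst] real_polynomial_function_det[OF bounded_linear_snd]
      by (auto simp: Q_def)
    have "det (fst (mat 1 :: real^'n^'n, mat 1 :: real^'n^'n)) \<noteq> 0" "det (snd (mat 1 :: real^'n^'n, mat 1 :: real^'n^'n)) \<noteq> 0"
      by simp_all
    then show "\<exists>\<theta>\<in>UNIV. q \<theta> \<noteq> 0" if "q \<in> Q" for q
      using that P(2) unfolding Q_def by blast
  qed simp
  then obtain \<theta> where \<theta>: "\<forall>q\<in>Q. q \<theta> \<noteq> 0" by blast
  then have "det (fst \<theta>) \<noteq> 0" "det (snd \<theta>) \<noteq> 0" by (simp_all add: Q_def)
  then obtain A B where A: "det A = 1" "\<And>r. \<exists>c. c \<noteq> 0 \<and> A $ r = c *\<^sub>R fst \<theta> $ r"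
    and B: "det B = 1" "\<And>r. \<exists>c. c \<noteq> 0 \<and> B $ r = c *\<^sub>R snd \<theta> $ r"
    using scale_to_det_one by meson
  show ?thesis
  proof (rule that[OF A(1) B(1)])
    fix i J u assume u: "u \<in> limit_secants \<Gamma>"
    show "drop_coord i (hybrid A B J u) \<noteq> 0"
    proof
      assume z: "drop_coord i (hybrid A B J u) = 0"
      have "drop_coord i (hybrid (fst \<theta>) (snd \<theta>) J u) $ r = 0" for r
      proof (cases "r = i")
        case False
        then have h: "hybrid A B J u $ r = 0" using drop_coord_nth[of i "hybrid A B J u" r] z by simp
        obtain c c' where "c \<noteq> 0" "A $ r = c *\<^sub>R fst \<theta> $ r" "c' \<noteq> 0" "B $ r = c' *\<^sub>R snd \<theta> $ r"
          using A(2) B(2) by meson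
        then show ?thesis using h by (simp add: drop_coord_nth hybrid_def split: if_splits)
      qed (simp add: drop_coord_nth)
      then have "drop_coord i (hybrid (fst \<theta>) (snd \<theta>) J u) = 0" by (simp add: vec_eq_iff)
      then have "P (i, J) \<theta> = 0" using P(3)[OF u, of "(i, J)" \<theta>] by simp
      then show False using \<theta> by (auto simp: Q_def)
    qed
  qed
qed

text \<open>The lower bound says that \<open>L (F x)\<close> determines \<open>F x\<close> in a
  Lipschitz way, so \<open>l (F x)\<close> is a Lipschitz function of \<open>L (F x)\<close> and can
  be extended to the whole space.\<close>

lemma shear_function_exists:
  fixes F :: "'a::euclidean_space \<Rightarrow> 'w::euclidean_space" and L :: "'w \<Rightarrow> 'b::euclidean_space" and l :: "'w \<Rightarrow> real"
  assumes F: "semialgebraic_map_on X F" "0 \<in> X" "F 0 = 0" and L: "bounded_linear L" "bounded_linear l" and c: "c > 0"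
    and lower: "\<And>x y. x \<in> X \<Longrightarrow> y \<in> X \<Longrightarrow> c * norm (F x - F y) \<le> norm (L (F x - F y))"
  obtains q C where "C-lipschitz_on UNIV q" "semialgebraic_map_on UNIV q" "q 0 = 0"
    "\<And>x. x \<in> X \<Longrightarrow> q (L (F x)) = l (F x)"
proof -
  have linL: "linear L" and linl: "linear l" using L bounded_linear.linear by blast+
  define \<phi> where "\<phi> = (\<lambda>x. L (F x))"
  define q0 where "q0 = (\<lambda>z. l (F (inv_into X \<phi> z)))"
  have q0: "q0 (\<phi> x) = l (F x)" if x: "x \<in> X" for x
  proof -
    define y where "y = inv_into X \<phi> (\<phi> x)"
    have y: "y \<in> X" "\<phi> y = \<phi> x" using x by (auto simp: y_def inv_into_into f_inv_into_f)
    have "L (F y - F x) = 0" using y(2) by (simp add: \<phi>_def linear_diff[OF linL])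
    then have "c * norm (F y - F x) \<le> 0" using lower[OF y(1) x] by simp
    then have "F y = F x" using c by (simp add: mult_le_0_iff)
    then show ?thesis by (simp add: q0_def y_def)
  qed
  obtain K where K: "\<And>w. norm (l w) \<le> norm w * K" "K > 0" using bounded_linear.pos_bounded[OF L(2)] by blast
  have sa: "semialgebraic_map_on (\<phi> ` X) q0"
  proof (rule semialgebraic_map_on_descend)
    show "semialgebraic_map_on X \<phi>" unfolding \<phi>_def by (rule semialgebraic_map_on_linear_comp[OF F(1) L(1)])
    show "semialgebraic_map_on X (\<lambda>x. l (F x))" by (rule semialgebraic_map_on_linear_comp[OF F(1) L(2)])
  qed (rule q0)
  have ne: "\<phi> ` X \<noteq> {}" using F(2) by blast
  have Kc: "0 \<le> K / c" using K(2) c by simp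
  have lip: "\<bar>q0 z - q0 z'\<bar> \<le> K / c * norm (z - z')" if zz: "z \<in> \<phi> ` X" "z' \<in> \<phi> ` X" for z z'
  proof -
    obtain x y where xy: "x \<in> X" "y \<in> X" "z = \<phi> x" "z' = \<phi> y" using zz by blast
    have "\<bar>q0 z - q0 z'\<bar> = norm (l (F x - F y))" by (simp add: xy q0 linear_diff[OF linl])
    also have "\<dots> \<le> K * norm (F x - F y)" using K(1)[of "F x - F y"] by (simp add: mult.commute)
    also have "\<dots> \<le> K * (norm (L (F x - F y)) / c)"
      using lower[OF xy(1,2)] c K(2) by (intro mult_left_mono) (simp_all add: field_simps)
    also have "\<dots> = K / c * norm (z - z')" by (simp add: xy(3,4) \<phi>_def linear_diff[OF linL])
    finally show ?thesis .
  qed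
  obtain q where q: "(K / c)-lipschitz_on UNIV q" "semialgebraic_map_on UNIV q" "\<And>z. z \<in> \<phi> ` X \<Longrightarrow> q z = q0 z"
    using semialgebraic_lipschitz_extension[OF ne sa Kc lip] by blast
  have qx: "q (L (F x)) = l (F x)" if "x \<in> X" for x
    using q(3)[of "\<phi> x"] q0[OF that] that by (simp add: \<phi>_def)
  moreover have "q 0 = 0"
    using qx[OF F(2)] F(3) by (simp add: linear_0[OF linL] linear_0[OF linl])
  ultimately show ?thesis using that q(1,2) by blast
qed

theorem semialgebraic_embedding_unique:
  fixes X :: "(real^'m) set" and f g :: "real^'m \<Rightarrow> real^('n::{finite,linorder})"
  assumes X: "closed X" "semialgebraic X" "0 \<in> X" and k: "germ_dim X k" "2 * k + 1 \<le> CARD('n)"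
    and f: "semialgebraic_bilipschitz_embedding X f" and g: "semialgebraic_bilipschitz_embedding X g"
  shows "\<exists>\<Phi>. tame_homeo \<Phi> \<and> (\<forall>\<^sub>F x in nhds 0. x \<in> X \<longrightarrow> g x = \<Phi> (f x))"
proof -
  obtain U K where U: "open U" "0 \<in> U" "K > 0" "f 0 = 0" "semialgebraic_map_on (X \<inter> U) f"
    "\<And>x y. x \<in> X \<inter> U \<Longrightarrow> y \<in> X \<inter> U \<Longrightarrow> norm (f x - f y) \<le> K * norm (x - y)"
    "\<And>x y. x \<in> X \<inter> U \<Longrightarrow> y \<in> X \<inter> U \<Longrightarrow> norm (x - y) \<le> K * norm (f x - f y)"
    by (rule embedding_bounds[OF f]) (rule that)
  obtain V M where V: "open V" "0 \<in> V" "M > 0" "g 0 = 0" "semialgebraic_map_on (X \<inter> V) g"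
    "\<And>x y. x \<in> X \<inter> V \<Longrightarrow> y \<in> X \<inter> V \<Longrightarrow> norm (g x - g y) \<le> M * norm (x - y)"
    "\<And>x y. x \<in> X \<inter> V \<Longrightarrow> y \<in> X \<inter> V \<Longrightarrow> norm (x - y) \<le> M * norm (g x - g y)"
    by (rule embedding_bounds[OF g]) (rule that)
  obtain \<rho>1 where \<rho>1: "\<rho>1 > 0" "\<And>A. A \<subseteq> X \<inter> cball 0 \<rho>1 \<Longrightarrow> \<not> contains_cell (Suc k) A"
    using germ_dim_no_cell[OF k(1)] by blast
  obtain \<rho>2 where \<rho>2: "\<rho>2 > 0" "cball 0 \<rho>2 \<subseteq> U \<inter> V"
    using open_contains_cball[of "U \<inter> V"] U(1,2) V(1,2) by (meson IntI open_Int)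
  define \<rho> where "\<rho> = min \<rho>1 \<rho>2"
  have \<rho>: "\<rho> > 0" using \<rho>1(1) \<rho>2(1) by (simp add: \<rho>_def)
  define Xc where "Xc = (\<lambda>r. X \<inter> cball 0 r)"
  have Xcsub: "Xc r \<subseteq> X \<inter> U" "Xc r \<subseteq> X \<inter> V" "Xc r \<subseteq> X \<inter> cball 0 \<rho>1" if "r \<le> \<rho>" for r
  proof -
    have "cball (0::real^'m) r \<subseteq> cball 0 \<rho>2" "cball (0::real^'m) r \<subseteq> cball 0 \<rho>1" using that by (auto simp: \<rho>_def)
    then show "Xc r \<subseteq> X \<inter> U" "Xc r \<subseteq> X \<inter> V" "Xc r \<subseteq> X \<inter> cball 0 \<rho>1" using \<rho>2(2) unfolding Xc_def by blast+
  qed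
  have saX: "semialgebraic (Xc r)" for r unfolding Xc_def by (rule semialgebraic_Int[OF X(2) semialgebraic_cball])
  define F where "F = (\<lambda>x. (f x, g x))"
  have saF: "semialgebraic_map_on (Xc r) F" if "r \<le> \<rho>" for r
    unfolding F_def
    by (intro semialgebraic_map_on_Pair semialgebraic_map_on_subset[OF U(5) saX Xcsub(1)[OF that]]
      semialgebraic_map_on_subset[OF V(5) saX Xcsub(2)[OF that]])
  define \<Gamma> where "\<Gamma> = F ` Xc \<rho>"
  have bounds: "norm (f x - f y) \<le> K * norm (x - y)" "norm (x - y) \<le> K * norm (f x - f y)"
      "norm (g x - g y) \<le> M * norm (x - y)" "norm (x - y) \<le> M * norm (g x - g y)"
    if "x \<in> Xc \<rho>" "y \<in> Xc \<rho>" for x y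
    using that Xcsub(1,2)[OF order_refl] by (blast intro: U(6,7) V(6,7))+
  have dim: "alg_dim_le \<Gamma> k"
    unfolding \<Gamma>_def
  proof (rule alg_dim_le_image)
    show "compact (Xc \<rho>)" unfolding Xc_def by (rule compact_closed_Int_cball[OF X(1)])
    show "semialgebraic_map_on (Xc \<rho>) F" by (rule saF) simp
    have "continuous_on (Xc \<rho>) f" "continuous_on (Xc \<rho>) g"
    proof -
      have "K-lipschitz_on (Xc \<rho>) f" using U(3) bounds(1) by (intro lipschitz_onI) (auto simp: dist_norm)
      then show "continuous_on (Xc \<rho>) f" by (rule lipschitz_on_continuous_on)
      have "M-lipschitz_on (Xc \<rho>) g" using V(3) bounds(3) by (intro lipschitz_onI) (auto simp: dist_norm)
      then show "continuous_on (Xc \<rho>) g" by (rule lipschitz_on_continuous_on)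
    qed
    then show "continuous_on (Xc \<rho>) F" unfolding F_def by (rule continuous_on_Pair)
    show "inj_on F (Xc \<rho>)"
    proof (rule inj_onI)
      fix x y assume "x \<in> Xc \<rho>" "y \<in> Xc \<rho>" "F x = F y"
      then show "x = y" using bounds(2)[of x y] by (simp add: F_def)
    qed
    show "\<not> contains_cell (Suc k) (Xc \<rho>)" by (rule \<rho>1(2)) (rule Xcsub(3)[OF order_refl])
  qed
  have Fle: "norm (F x - F y) \<le> norm (f x - f y) + norm (g x - g y)" for x y
    unfolding F_def by (simp add: norm_Pair_le)
  \<comment> \<open>\<open>f\<close> and \<open>g\<close> control each other through
    \<open>x\<close>: a secant of the pairs has norm at most \<open>1 + K * M\<close> times that of
    either component.\<close>
  have ne: "fst u \<noteq> 0 \<and> snd u \<noteq> 0" if u: "u \<in> limit_secants \<Gamma>" for u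
  proof
    have pos: "1 + K * M > 0" using U(3) V(3) by (simp add: add_pos_pos)
    have "1 / (1 + K * M) \<le> norm (fst u)"
    proof (rule limit_secants_lower_bound[OF bounded_linear_fst _ u])
      fix z z' assume "z \<in> \<Gamma>" "z' \<in> \<Gamma>"
      then obtain x y where xy: "x \<in> Xc \<rho>" "y \<in> Xc \<rho>" "z = F x" "z' = F y" unfolding \<Gamma>_def by blast
      have "norm (g x - g y) \<le> M * (K * norm (f x - f y))"
        using bounds(2,3)[OF xy(1,2)] V(3) by (meson mult_left_mono order_trans less_imp_le)
      then have "norm (F x - F y) \<le> (1 + K * M) * norm (f x - f y)"
        using Fle[of x y] by (simp add: algebra_simps)
      then show "1 / (1 + K * M) * norm (z - z') \<le> norm (fst (z - z'))"
        using pos by (simp add: xy F_def divide_le_eq mult.commute)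
    qed
    then show "fst u \<noteq> 0" using pos by (auto simp: divide_le_0_iff)
    have "1 / (1 + K * M) \<le> norm (snd u)"
    proof (rule limit_secants_lower_bound[OF bounded_linear_snd _ u])
      fix z z' assume "z \<in> \<Gamma>" "z' \<in> \<Gamma>"
      then obtain x y where xy: "x \<in> Xc \<rho>" "y \<in> Xc \<rho>" "z = F x" "z' = F y" unfolding \<Gamma>_def by blast
      have "norm (f x - f y) \<le> K * (M * norm (g x - g y))"
        using bounds(1,4)[OF xy(1,2)] U(3) by (meson mult_left_mono order_trans less_imp_le)
      then have "norm (F x - F y) \<le> (1 + K * M) * norm (g x - g y)"
        using Fle[of x y] by (simp add: algebra_simps)
      then show "1 / (1 + K * M) * norm (z - z') \<le> norm (snd (z - z'))"
        using pos by (simp add: xy F_def divide_le_eq mult.commute)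
    qed
    then show "snd u \<noteq> 0" using pos by (auto simp: divide_le_0_iff)
  qed
  obtain A B where AB: "det A = 1" "det B = 1"
    "\<And>i J u. u \<in> limit_secants \<Gamma> \<Longrightarrow> drop_coord i (hybrid A B J u) \<noteq> 0"
    using generic_matrices[OF dim k(2) ne] by blast
  \<comment> \<open>Each exchange may shrink the radius, because the estimate for \<open>L\<close>
    holds only near 0; after finitely many exchanges it is still positive.\<close>
  have chain: "\<exists>\<Phi> r. tame_homeo \<Phi> \<and> 0 < r \<and> r \<le> \<rho> \<and> (\<forall>x\<in>Xc r. \<Phi> (f x) = hybrid A B J (F x))"
    if "finite J" for J
    using that
  proof (induction J rule: finite_induct)
    case empty
    have "tame_homeo (\<lambda>x. A *v x)"
      by (rule tame_homeo_linear) (simp_all add: matrix_vector_mul_linear AB(1))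
    moreover have "A *v f x = hybrid A B {} (F x)" for x
      by (simp add: vec_eq_iff hybrid_def F_def matrix_vector_mul_component)
    ultimately show ?case using \<rho> by (intro exI[of _ "\<lambda>x. A *v x"] exI[of _ \<rho>]) simp
  next
    case (insert i J)
    then obtain \<Phi> r where \<Phi>: "tame_homeo \<Phi>" and r: "0 < r" "r \<le> \<rho>" "\<forall>x\<in>Xc r. \<Phi> (f x) = hybrid A B J (F x)"
      by blast
    define L where "L = (\<lambda>w. drop_coord i (hybrid A B J w))"
    \<comment> \<open>The new value of coordinate \<open>i\<close> minus the old one, that is, the
      displacement which the shear has to produce.\<close>
    define l where "l = (\<lambda>w. B $ i \<bullet> snd w - A $ i \<bullet> fst w)"
    have L: "bounded_linear L" unfolding L_def by (rule bounded_linear_compose[OF bounded_linear_drop_coord bounded_linear_hybrid])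
    have l: "bounded_linear l" unfolding l_def
      by (intro bounded_linear_sub bounded_linear_compose[OF bounded_linear_inner_right] bounded_linear_fst bounded_linear_snd)
    have "L u \<noteq> 0" if "u \<in> limit_secants \<Gamma>" for u unfolding L_def by (rule AB(3)[OF that])
    from secant_bound[OF L this] obtain s c where s: "s > 0" "c > 0"
      "\<And>z z'. z \<in> \<Gamma> \<Longrightarrow> z' \<in> \<Gamma> \<Longrightarrow> norm z \<le> s \<Longrightarrow> norm z' \<le> s \<Longrightarrow> c * norm (z - z') \<le> norm (L (z - z'))" by blast
    \<comment> \<open>Since \<open>norm (F x) \<le> (K + M) * norm x\<close>, this radius keeps
      \<open>F x\<close> in the ball where the secant estimate holds.\<close>
    define r' where "r' = min r (s / (K + M))"
    have KM: "K + M > 0" using U(3) V(3) by simp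
    have r': "0 < r'" "r' \<le> r" "r' \<le> \<rho>" using r(1,2) s(1) KM by (auto simp: r'_def)
    have sub: "Xc r' \<subseteq> Xc r" "Xc r' \<subseteq> Xc \<rho>" using r' r(2) by (auto simp: Xc_def)
    have X0: "0 \<in> Xc t" if "t > 0" for t using X(3) that by (simp add: Xc_def)
    have F0: "F 0 = 0" using U(4) V(4) by (simp add: F_def zero_prod_def)
    have small: "F x \<in> \<Gamma>" "norm (F x) \<le> s" if x: "x \<in> Xc r'" for x
    proof -
      have x': "x \<in> Xc \<rho>" using x sub(2) by blast
      then show "F x \<in> \<Gamma>" by (simp add: \<Gamma>_def)
      have nx: "norm x \<le> s / (K + M)" using x by (simp add: Xc_def r'_def)
      have "norm (F x) \<le> norm (f x) + norm (g x)" using Fle[of x 0] U(4) V(4) F0 by simp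
      also have "\<dots> \<le> K * norm x + M * norm x"
        using bounds(1,3)[OF x' X0[OF \<rho>]] U(4) V(4) by simp
      also have "\<dots> \<le> s" using nx KM by (simp add: le_divide_eq algebra_simps)
      finally show "norm (F x) \<le> s" .
    qed
    obtain q C where q: "C-lipschitz_on UNIV q" "semialgebraic_map_on UNIV q" "q 0 = 0"
      "\<And>x. x \<in> Xc r' \<Longrightarrow> q (L (F x)) = l (F x)"
    proof (rule shear_function_exists[OF saF[OF r'(3)] X0[OF r'(1)] F0 L l s(2)])
      show "c * norm (F x - F y) \<le> norm (L (F x - F y))" if "x \<in> Xc r'" "y \<in> Xc r'" for x y
        by (rule s(3)[OF small(1)[OF that(1)] small(1)[OF that(2)] small(2)[OF that(1)] small(2)[OF that(2)]])
    qed (rule that)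
    have th: "tame_homeo (coord_shear i q \<circ> \<Phi>)"
      by (rule tame_homeo_comp[OF tame_homeo_coord_shear[OF q(1,3,2)] \<Phi>])
    have eq: "(coord_shear i q \<circ> \<Phi>) (f x) = hybrid A B (insert i J) (F x)" if x: "x \<in> Xc r'" for x
    proof -
      have "\<Phi> (f x) = hybrid A B J (F x)" using r(3) x sub(1) by blast
      then have "(coord_shear i q \<circ> \<Phi>) (f x) = hybrid A B J (F x) + l (F x) *\<^sub>R axis i 1"
        using q(4)[OF x] by (simp add: coord_shear_def L_def)
      also have "\<dots> = hybrid A B (insert i J) (F x)"
        using insert.hyps(2) by (auto simp: vec_eq_iff hybrid_def l_def axis_def)
      finally show ?thesis .
    qed
    show ?case
      by (intro exI[of _ "coord_shear i q \<circ> \<Phi>"] exI[of _ r'] conjI ballI th r'(1,3) eq)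
  qed
  obtain \<Phi> r where \<Phi>: "tame_homeo \<Phi>" and r: "0 < r" "\<forall>x\<in>Xc r. \<Phi> (f x) = hybrid A B UNIV (F x)"
    using chain[of UNIV] by auto
  \<comment> \<open>After all exchanges the result is \<open>B *v g x\<close>; the inverse of
    \<open>B\<close>, again of determinant one, leads back to \<open>g x\<close>.\<close>
  have linB: "linear (\<lambda>x. B *v x)" by (rule matrix_vector_mul_linear)
  have "det (matrix (\<lambda>x. B *v x)) = 1" using AB(2) by simp
  then obtain T where T: "linear T" "\<And>x. T (B *v x) = x" "det (matrix T) = 1"
    using linear_inverse_det_one[OF linB] by metis
  have "tame_homeo (T \<circ> \<Phi>)" by (rule tame_homeo_comp[OF tame_homeo_linear[OF T(1,3)] \<Phi>])
  moreover have "\<forall>\<^sub>F x in nhds 0. x \<in> X \<longrightarrow> g x = (T \<circ> \<Phi>) (f x)"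
  proof -
    have "\<forall>\<^sub>F x in nhds (0::real^'m). x \<in> ball 0 r" using r(1) by (intro eventually_nhds_in_open) simp_all
    then show ?thesis
    proof (rule eventually_mono)
      fix x :: "real^'m" assume x: "x \<in> ball 0 r"
      show "x \<in> X \<longrightarrow> g x = (T \<circ> \<Phi>) (f x)"
      proof
        assume "x \<in> X"
        then have "\<Phi> (f x) = hybrid A B UNIV (F x)" using r(2) x by (simp add: Xc_def)
        also have "\<dots> = B *v g x" by (simp add: vec_eq_iff hybrid_def F_def matrix_vector_mul_component)
        finally show "g x = (T \<circ> \<Phi>) (f x)" by (simp add: T(2))
      qed
    qed
  qed
  ultimately show ?thesis by blast
qed

theorem corollary5p10:
  fixes X :: "(real^'m) set" and k :: nat
  assumes "closed X" and "semialgebraic X" and "0 \<in> X" and "germ_dim X k"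
    and "CARD('n::{finite,linorder}) \<ge> 2 * k + 1"
  shows "(\<exists>f :: real^'m \<Rightarrow> real^('n::{finite,linorder}). semialgebraic_bilipschitz_embedding X f) \<and>
    (\<forall>f g :: real^'m \<Rightarrow> real^('n::{finite,linorder}).
       semialgebraic_bilipschitz_embedding X f \<longrightarrow> semialgebraic_bilipschitz_embedding X g \<longrightarrow>
       (\<exists>\<Phi> :: real^('n::{finite,linorder}) \<Rightarrow> real^('n::{finite,linorder}).
          semialgebraic_bilipschitz_germ UNIV UNIV \<Phi> \<and> tame_germ \<Phi> \<and>
          (\<forall>\<^sub>F x in nhds 0. x \<in> X \<longrightarrow> g x = \<Phi> (f x))))"
proof (intro conjI allI impI)
  have "2 * k \<le> CARD('n)" using assms(5) by simp
  then show "\<exists>f :: real^'m \<Rightarrow> real^('n::{finite,linorder}). semialgebraic_bilipschitz_embedding X f"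
    by (rule semialgebraic_embedding_exists[OF assms(1-4)])
next
  fix f g :: "real^'m \<Rightarrow> real^('n::{finite,linorder})"
  assume "semialgebraic_bilipschitz_embedding X f" "semialgebraic_bilipschitz_embedding X g"
  from semialgebraic_embedding_unique[OF assms this]
  obtain \<Phi> where \<Phi>: "tame_homeo \<Phi>" "\<forall>\<^sub>F x in nhds 0. x \<in> X \<longrightarrow> g x = \<Phi> (f x)" by blast
  have "tame_germ \<Phi>" using \<Phi>(1) by (simp add: tame_homeo_def)
  then show "\<exists>\<Phi> :: real^('n::{finite,linorder}) \<Rightarrow> real^('n::{finite,linorder}).
          semialgebraic_bilipschitz_germ UNIV UNIV \<Phi> \<and> tame_germ \<Phi> \<and>
          (\<forall>\<^sub>F x in nhds 0. x \<in> X \<longrightarrow> g x = \<Phi> (f x))"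
    using tame_homeo_imp_germ[OF \<Phi>(1)] \<Phi>(2) by blast
qed

end
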